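(* For every fixed $\epsilon>0$ there is an algorithm which, given a finite set $X\subseteq\mathbb{R}^d$ with $|X|=n$ and positive integers $k\le n$ and $u$ with $ku\ge n$, outputs a feasible solution of the hard-capacitated $k$-means problem on $(X,k,u)$ whose cost is at most $(69+\epsilon)\,\mathrm{OPT}$, where $\mathrm{OPT}$ is the optimal cost, and which runs in time $2^{O(k\log k)}n^{O(1)}$.
   Context: Hard-capacitated $k$-means (HCKM): given a finite set $X\subseteq\mathbb{R}^d$ with $|X|=n$ and positive integers $k\le n$ and $u$, a feasible solution is a family $C=(c_1,\dots,c_k)$ of $k$ points of $\mathbb{R}^d$ (repetitions allowed) together with an assignment $\pi:X\to\{1,\dots,k\}$ such that $|\pi^{-1}(i)|\le u$ for every $i$. Its cost is $\sum_{x\in X}\|x-c_{\pi(x)}\|^2$, where $\|\cdot\|$ is the Euclidean norm. $\mathrm{OPT}$ denotes the minimum cost over all feasible solutions (equivalently, the minimum over all partitions of $X$ into $k$ parts of size at most $u$ of the total within-cluster sum of squared distances to the cluster centroids).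
   Formalization: The running time is proved as 2^{O(k log k)} n^{O(1)} (d+1)^{O(1)} on a unit-cost real RAM; the factor polynomial in d is needed, since merely writing a centre in R^d takes time d, and for fixed d it is absorbed in the constant. *)

theory Defs
  imports Complex_Main "HOL-Library.FuncSet" "HOL-Analysis.L2_Norm" "Jordan_Normal_Form.Matrix"
begin

section \<open>Hard-capacitated k-means\<close>

text \<open>
  Points of \<open>\<real>\<^sup>d\<close> are the real vectors in \<open>carrier_vec d\<close>, so that a statement can quantify over
  the dimension. The \<open>k\<close> centres are indexed by \<open>0, \<dots>, k - 1\<close>.
\<close>

definition eucl_norm :: "real vec \<Rightarrow> real" where
  "eucl_norm v = L2_set (\<lambda>l. v $ l) {..<dim_vec v}"

definition hckm_feasible ::
  "nat \<Rightarrow> real vec set \<Rightarrow> nat \<Rightarrow> nat \<Rightarrow> (nat \<Rightarrow> real vec) \<Rightarrow> (real vec \<Rightarrow> nat) \<Rightarrow> bool" where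
  "hckm_feasible d X k u c \<pi> \<longleftrightarrow>
     (\<forall>i<k. c i \<in> carrier_vec d) \<and>
     (\<forall>x\<in>X. \<pi> x < k) \<and>
     (\<forall>i<k. card {x \<in> X. \<pi> x = i} \<le> u)"

definition hckm_cost :: "real vec set \<Rightarrow> (nat \<Rightarrow> real vec) \<Rightarrow> (real vec \<Rightarrow> nat) \<Rightarrow> real" where
  "hckm_cost X c \<pi> = (\<Sum>x\<in>X. (eucl_norm (x - c (\<pi> x)))\<^sup>2)"

text \<open>The infimum is a minimum on every feasible instance, see \<open>hckm_opt_attained\<close> below.\<close>

definition hckm_opt :: "nat \<Rightarrow> real vec set \<Rightarrow> nat \<Rightarrow> nat \<Rightarrow> real" where
  "hckm_opt d X k u = Inf {hckm_cost X c \<pi> | c \<pi>. hckm_feasible d X k u c \<pi>}"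

lemma hckm_cost_coords:
  assumes "X \<subseteq> carrier_vec d" "hckm_feasible d X k u c \<pi>"
  shows "hckm_cost X c \<pi> = (\<Sum>x\<in>X. \<Sum>l<d. (x $ l - c (\<pi> x) $ l)\<^sup>2)"
  unfolding hckm_cost_def
proof (rule sum.cong[OF refl])
  fix x assume "x \<in> X"
  then have "dim_vec x = d" "dim_vec (c (\<pi> x)) = d"
    using assms by (auto simp: hckm_feasible_def)
  then show "(eucl_norm (x - c (\<pi> x)))\<^sup>2 = (\<Sum>l<d. (x $ l - c (\<pi> x) $ l)\<^sup>2)"
    by (auto simp: eucl_norm_def L2_set_def sum_nonneg intro!: sum.cong)
qed

lemma hckm_feasible_exists:
  assumes "finite X" "u > 0" "card X \<le> k * u"
  shows "\<exists>c \<pi>. hckm_feasible d X k u c \<pi>"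
proof -
  obtain f where f: "bij_betw f X {0..<card X}"
    using ex_bij_betw_finite_nat[OF assms(1)] by blast
  have "card {x \<in> X. f x div u = i} \<le> u" for i
  proof -
    have "f ` {x \<in> X. f x div u = i} \<subseteq> {i * u..<i * u + u}"
    proof
      fix y assume "y \<in> f ` {x \<in> X. f x div u = i}"
      then have "y div u = i" by auto
      then have "y = i * u + y mod u" by (metis div_mult_mod_eq)
      moreover have "y mod u < u" using assms(2) by simp
      ultimately show "y \<in> {i * u..<i * u + u}" unfolding atLeastLessThan_iff by linarith
    qed
    moreover have "inj_on f {x \<in> X. f x div u = i}"
      using f by (auto simp: bij_betw_def inj_on_def)
    ultimately have "card {x \<in> X. f x div u = i} \<le> card {i * u..<i * u + u}"
      by (intro card_inj_on_le[where f = f]) auto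
    then show ?thesis by simp
  qed
  moreover have "f x div u < k" if "x \<in> X" for x
  proof -
    have "f x < card X" using f that by (auto simp: bij_betw_def)
    then show ?thesis using assms(2,3) by (simp add: less_mult_imp_div_less)
  qed
  ultimately have "hckm_feasible d X k u (\<lambda>_. 0\<^sub>v d) (\<lambda>x. f x div u)"
    by (simp add: hckm_feasible_def)
  then show ?thesis by blast
qed

lemma sum_squares_mean_le:
  fixes g :: "'a \<Rightarrow> real"
  assumes "finite A"
  shows "(\<Sum>x\<in>A. (g x - (\<Sum>y\<in>A. g y) / real (card A))\<^sup>2) \<le> (\<Sum>x\<in>A. (g x - m)\<^sup>2)"
proof (cases "A = {}")
  case False
  define N where "N = real (card A)"
  define S where "S = (\<Sum>y\<in>A. g y)"
  have N: "N > 0" using False assms by (simp add: N_def card_gt_0_iff)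
  have expand: "(\<Sum>x\<in>A. (g x - t)\<^sup>2) = (\<Sum>x\<in>A. (g x)\<^sup>2) - 2 * t * S + N * t\<^sup>2" for t
  proof -
    have "(\<Sum>x\<in>A. (g x - t)\<^sup>2) = (\<Sum>x\<in>A. (g x)\<^sup>2 - 2 * t * g x + t\<^sup>2)"
      by (intro sum.cong refl) (simp add: power2_diff)
    then show ?thesis
      by (simp add: sum.distrib sum_subtractf S_def N_def flip: sum_distrib_left)
  qed
  have "0 \<le> (N * m - S)\<^sup>2 / N" using N by simp
  also have "\<dots> = (N * m\<^sup>2 - 2 * m * S) - (N * (S / N)\<^sup>2 - 2 * (S / N) * S)"
    using N by (simp add: field_simps power2_eq_square)
  finally show ?thesis
    unfolding S_def[symmetric] N_def[symmetric] expand by simp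
qed simp

lemma hckm_opt_attained:
  assumes X: "finite X" "X \<subseteq> carrier_vec d" and u: "u > 0" "card X \<le> k * u"
  shows "\<exists>c \<pi>. hckm_feasible d X k u c \<pi> \<and> hckm_cost X c \<pi> = hckm_opt d X k u"
proof -
  define cen :: "(real vec \<Rightarrow> nat) \<Rightarrow> nat \<Rightarrow> real vec" where
    "cen \<pi> i = vec d (\<lambda>l. (\<Sum>y\<in>{x \<in> X. \<pi> x = i}. y $ l) / real (card {x \<in> X. \<pi> x = i}))" for \<pi> i
  define P where "P = {\<pi> \<in> X \<rightarrow>\<^sub>E {..<k}. hckm_feasible d X k u (cen \<pi>) \<pi>}"
  define V where "V = (\<lambda>\<pi>. hckm_cost X (cen \<pi>) \<pi>) ` P"
  have restr: "restrict \<pi> X \<in> P \<and> hckm_cost X (cen (restrict \<pi> X)) (restrict \<pi> X) \<le> hckm_cost X c \<pi>"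
    if F: "hckm_feasible d X k u c \<pi>" for c \<pi>
  proof
    define \<rho> where "\<rho> = restrict \<pi> X"
    have fib: "{x \<in> X. \<rho> x = i} = {x \<in> X. \<pi> x = i}" for i by (auto simp: \<rho>_def)
    have F1: "hckm_feasible d X k u (cen \<rho>) \<rho>"
      using F unfolding hckm_feasible_def fib by (auto simp: cen_def \<rho>_def)
    show "restrict \<pi> X \<in> P"
      using F F1 by (auto simp: P_def \<rho>_def hckm_feasible_def)
    have grp: "(\<Sum>x\<in>X. h x) = (\<Sum>i<k. \<Sum>x\<in>{x \<in> X. \<pi> x = i}. h x)" for h :: "real vec \<Rightarrow> real"
      using F X(1) by (intro sum.group[symmetric]) (auto simp: hckm_feasible_def)
    have "hckm_cost X (cen \<rho>) \<rho> = (\<Sum>l<d. \<Sum>x\<in>X. (x $ l - cen \<rho> (\<pi> x) $ l)\<^sup>2)"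
      unfolding hckm_cost_coords[OF X(2) F1]
      by (subst sum.swap) (auto simp: \<rho>_def intro!: sum.cong)
    also have "\<dots> \<le> (\<Sum>l<d. \<Sum>x\<in>X. (x $ l - c (\<pi> x) $ l)\<^sup>2)"
    proof (rule sum_mono, unfold grp, rule sum_mono)
      fix l i assume l: "l \<in> {..<d}"
      let ?A = "{x \<in> X. \<pi> x = i}"
      have "(\<Sum>x\<in>?A. (x $ l - cen \<rho> (\<pi> x) $ l)\<^sup>2)
          = (\<Sum>x\<in>?A. (x $ l - (\<Sum>y\<in>?A. y $ l) / real (card ?A))\<^sup>2)"
        using l by (intro sum.cong) (auto simp: cen_def fib)
      also have "\<dots> \<le> (\<Sum>x\<in>?A. (x $ l - c i $ l)\<^sup>2)"
        using X(1) by (intro sum_squares_mean_le) auto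
      also have "\<dots> = (\<Sum>x\<in>?A. (x $ l - c (\<pi> x) $ l)\<^sup>2)"
        by (intro sum.cong) auto
      finally show "(\<Sum>x\<in>?A. (x $ l - cen \<rho> (\<pi> x) $ l)\<^sup>2) \<le> (\<Sum>x\<in>?A. (x $ l - c (\<pi> x) $ l)\<^sup>2)" .
    qed
    also have "\<dots> = hckm_cost X c \<pi>"
      unfolding hckm_cost_coords[OF X(2) F] by (rule sum.swap)
    finally show "hckm_cost X (cen (restrict \<pi> X)) (restrict \<pi> X) \<le> hckm_cost X c \<pi>"
      by (simp add: \<rho>_def)
  qed
  have "finite P" unfolding P_def using X(1) by (auto intro!: finite_PiE)
  then have fV: "finite V" by (simp add: V_def)
  obtain c0 \<pi>0 where "hckm_feasible d X k u c0 \<pi>0"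
    using hckm_feasible_exists[OF X(1) u] by blast
  then have "V \<noteq> {}" using restr by (auto simp: V_def)
  then have "Min V \<in> V" using fV by (rule Min_in[rotated])
  then obtain \<pi> where \<pi>: "\<pi> \<in> P" "hckm_cost X (cen \<pi>) \<pi> = Min V" by (auto simp: V_def)
  have "hckm_opt d X k u = Min V" unfolding hckm_opt_def
  proof (rule cInf_eq_minimum)
    show "Min V \<in> {hckm_cost X c \<pi> |c \<pi>. hckm_feasible d X k u c \<pi>}"
      using \<pi> by (auto simp: P_def intro!: exI[of _ "cen \<pi>"] exI[of _ \<pi>])
  next
    fix r assume "r \<in> {hckm_cost X c \<pi> |c \<pi>. hckm_feasible d X k u c \<pi>}"
    then obtain c \<pi> where r: "r = hckm_cost X c \<pi>" "hckm_feasible d X k u c \<pi>" by blast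
    have "Min V \<le> hckm_cost X (cen (restrict \<pi> X)) (restrict \<pi> X)"
      using restr[OF r(2)] fV by (intro Min_le) (auto simp: V_def)
    then show "Min V \<le> r" using restr[OF r(2)] r(1) by linarith
  qed
  then show ?thesis using \<pi> by (auto simp: P_def)
qed

section \<open>Real-RAM programs\<close>

text \<open>
  The computation model is the real RAM: unit-cost exact arithmetic and comparison of reals,
  together with natural numbers for counting and indirect addressing. There is no integer
  multiplication and no conversion from reals to naturals (no floor), so unit cost does not hide
  any super-polynomial computation on integers, and the constants in a program are rational.
  Memory is organised as unbounded arrays; a program names finitely many of them.
\<close>

record state =
  imem :: "string \<Rightarrow> nat \<Rightarrow> nat"
  rmem :: "string \<Rightarrow> nat \<Rightarrow> real"

datatype iexp =
    IConst nat
  | ILoad string iexp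
  | IAdd iexp iexp
  | ISub iexp iexp

datatype rexp =
    RConst rat
  | RLoad string iexp
  | RAdd rexp rexp
  | RSub rexp rexp
  | RMul rexp rexp
  | RDiv rexp rexp

datatype bexp =
    ILess iexp iexp
  | RLess rexp rexp
  | BNot bexp
  | BAnd bexp bexp

datatype com =
    Skip
  | IStore string iexp iexp
  | RStore string iexp rexp
  | Seq com com
  | Cond bexp com com
  | Loop bexp com

primrec ival :: "iexp \<Rightarrow> state \<Rightarrow> nat" where
  "ival (IConst m) s = m"
| "ival (ILoad a e) s = imem s a (ival e s)"
| "ival (IAdd e1 e2) s = ival e1 s + ival e2 s"
| "ival (ISub e1 e2) s = ival e1 s - ival e2 s"

primrec rval :: "rexp \<Rightarrow> state \<Rightarrow> real" where
  "rval (RConst q) s = of_rat q"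
| "rval (RLoad a e) s = rmem s a (ival e s)"
| "rval (RAdd e1 e2) s = rval e1 s + rval e2 s"
| "rval (RSub e1 e2) s = rval e1 s - rval e2 s"
| "rval (RMul e1 e2) s = rval e1 s * rval e2 s"
| "rval (RDiv e1 e2) s = rval e1 s / rval e2 s"

primrec bval :: "bexp \<Rightarrow> state \<Rightarrow> bool" where
  "bval (ILess e1 e2) s = (ival e1 s < ival e2 s)"
| "bval (RLess e1 e2) s = (rval e1 s < rval e2 s)"
| "bval (BNot b) s = (\<not> bval b s)"
| "bval (BAnd b1 b2) s = (bval b1 s \<and> bval b2 s)"

text \<open>Every operation in an expression, including each memory access, costs one step.\<close>

primrec icost :: "iexp \<Rightarrow> nat" where
  "icost (IConst m) = 1"
| "icost (ILoad a e) = 1 + icost e"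
| "icost (IAdd e1 e2) = 1 + icost e1 + icost e2"
| "icost (ISub e1 e2) = 1 + icost e1 + icost e2"

primrec rcost :: "rexp \<Rightarrow> nat" where
  "rcost (RConst q) = 1"
| "rcost (RLoad a e) = 1 + icost e"
| "rcost (RAdd e1 e2) = 1 + rcost e1 + rcost e2"
| "rcost (RSub e1 e2) = 1 + rcost e1 + rcost e2"
| "rcost (RMul e1 e2) = 1 + rcost e1 + rcost e2"
| "rcost (RDiv e1 e2) = 1 + rcost e1 + rcost e2"

primrec bcost :: "bexp \<Rightarrow> nat" where
  "bcost (ILess e1 e2) = 1 + icost e1 + icost e2"
| "bcost (RLess e1 e2) = 1 + rcost e1 + rcost e2"
| "bcost (BNot b) = 1 + bcost b"
| "bcost (BAnd b1 b2) = 1 + bcost b1 + bcost b2"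

definition istore :: "string \<Rightarrow> nat \<Rightarrow> nat \<Rightarrow> state \<Rightarrow> state" where
  "istore a i v s = s\<lparr>imem := (imem s)(a := (imem s a)(i := v))\<rparr>"

definition rstore :: "string \<Rightarrow> nat \<Rightarrow> real \<Rightarrow> state \<Rightarrow> state" where
  "rstore a i v s = s\<lparr>rmem := (rmem s)(a := (rmem s a)(i := v))\<rparr>"

text \<open>\<open>runs p s t s'\<close>: started in \<open>s\<close>, program \<open>p\<close> halts in \<open>s'\<close> after exactly \<open>t\<close> steps.\<close>

inductive runs :: "com \<Rightarrow> state \<Rightarrow> nat \<Rightarrow> state \<Rightarrow> bool" where
  Skip: "runs Skip s 1 s"
| IStore: "runs (IStore a e1 e2) s (1 + icost e1 + icost e2) (istore a (ival e1 s) (ival e2 s) s)"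
| RStore: "runs (RStore a e1 e2) s (1 + icost e1 + rcost e2) (rstore a (ival e1 s) (rval e2 s) s)"
| Seq: "runs p s t s' \<Longrightarrow> runs q s' t' s'' \<Longrightarrow> runs (Seq p q) s (t + t') s''"
| CondTrue: "bval b s \<Longrightarrow> runs p s t s' \<Longrightarrow> runs (Cond b p q) s (1 + bcost b + t) s'"
| CondFalse: "\<not> bval b s \<Longrightarrow> runs q s t s' \<Longrightarrow> runs (Cond b p q) s (1 + bcost b + t) s'"
| LoopFalse: "\<not> bval b s \<Longrightarrow> runs (Loop b p) s (1 + bcost b) s"
| LoopTrue: "bval b s \<Longrightarrow> runs p s t s' \<Longrightarrow> runs (Loop b p) s' t' s'' \<Longrightarrow>
    runs (Loop b p) s (1 + bcost b + t + t') s''"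

inductive_cases runs_elims:
  "runs Skip s t s'"
  "runs (IStore a e1 e2) s t s'"
  "runs (RStore a e1 e2) s t s'"
  "runs (Seq p q) s t s'"
  "runs (Cond b p q) s t s'"
  "runs (Loop b p) s t s'"

lemma runs_deterministic:
  "runs p s t s' \<Longrightarrow> runs p s t' s'' \<Longrightarrow> t' = t \<and> s'' = s'"
proof (induction arbitrary: t' s'' rule: runs.induct)
  case (Seq p s t s1 q t1 s2)
  from Seq.prems show ?case
    by (rule runs_elims(4)) (metis Seq.IH)
next
  case (CondTrue b s p t s1 q)
  from CondTrue.prems show ?case
    by (rule runs_elims(5)) (metis CondTrue.hyps(1) CondTrue.IH plus_1_eq_Suc add_Suc)+
next
  case (CondFalse b s q t s1 p)
  from CondFalse.prems show ?case
    by (rule runs_elims(5)) (metis CondFalse.hyps(1) CondFalse.IH plus_1_eq_Suc add_Suc)+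
next
  case (LoopFalse b s p)
  from LoopFalse.prems show ?case
    by (rule runs_elims(6)) (use LoopFalse.hyps in simp_all)
next
  case (LoopTrue b s p t s1 t1 s2)
  from LoopTrue.prems show ?case
  proof (rule runs_elims(6))
    assume "\<not> bval b s"
    then show ?thesis using LoopTrue.hyps(1) by contradiction
  next
    fix t3 s3 t4
    assume *: "t' = Suc (bcost b + t3 + t4)" "runs p s t3 s3" "runs (Loop b p) s3 t4 s''"
    have "t3 = t" "s3 = s1" using LoopTrue.IH(1)[OF *(2)] by blast+
    moreover from this have "t4 = t1" "s'' = s2" using LoopTrue.IH(2) *(3) by blast+
    ultimately show ?thesis using *(1) by simp
  qed
qed (erule runs_elims, simp)+

section \<open>Input and output conventions\<close>

text \<open>
  The instance is given by \<open>n\<close>, \<open>d\<close>, \<open>k\<close>, \<open>u\<close> and the coordinates of the points of \<open>X\<close>, listed in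
  some order \<open>xs\<close>, point after point; all other memory cells are zero.
\<close>

definition hckm_input :: "nat \<Rightarrow> real vec list \<Rightarrow> nat \<Rightarrow> nat \<Rightarrow> state" where
  "hckm_input d xs k u = \<lparr>
     imem = (\<lambda>a i.
       if i \<noteq> 0 then 0
       else if a = ''n'' then length xs
       else if a = ''d'' then d
       else if a = ''k'' then k
       else if a = ''u'' then u
       else 0),
     rmem = (\<lambda>a i.
       if a = ''X'' \<and> i < length xs * d then xs ! (i div d) $ (i mod d) else 0)\<rparr>"

definition hckm_output ::
  "nat \<Rightarrow> real vec list \<Rightarrow> nat \<Rightarrow> state \<Rightarrow> (nat \<Rightarrow> real vec) \<Rightarrow> (real vec \<Rightarrow> nat) \<Rightarrow> bool" where
  "hckm_output d xs k s c \<pi> \<longleftrightarrow>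
     (\<forall>j<k. c j = vec d (\<lambda>l. rmem s ''C'' (j * d + l))) \<and>
     (\<forall>i<length xs. \<pi> (xs ! i) = imem s ''pi'' i)"

end

theory Submission
  imports Defs "HOL-Library.Transitive_Closure_Table"
begin

text \<open>
  A greedy procedure picks \<open>O(k log n)\<close> points of \<open>X\<close>, each time the one that decreases the sum of squared
  distances to the points chosen so far the most. As long as this sum exceeds \<open>32 n\<^sup>3 OPT\<close>, the next point
  hits a new optimal cluster, so after \<open>k\<close> steps the sum is at most \<open>32 n\<^sup>3 OPT\<close>; from then on its excess
  over \<open>4 OPT\<close> shrinks by the factor \<open>1 - 1/k\<close> in each step, and ends up below \<open>32 OPT\<close>. Moving every optimal
  centre to the nearest chosen point costs at most \<open>12 OPT + 3/2 * 36 OPT = 66 OPT\<close> for the optimal assignment.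
  It remains to try all \<open>k\<close>-tuples of chosen points, of which there are \<open>O(k log n)\<^sup>k\<close>, and to compute an optimal
  capacitated assignment for each of them. The latter is done by successive shortest augmenting paths:
  a simple path in the exchange graph on the \<open>k\<close> centres is a map from centres to centres, so the best
  path is found by enumerating all such maps.
\<close>

section \<open>Total correctness with a time bound\<close>

text \<open>The coordinates are arbitrary reals, so the ratio of the cost after one greedy point to
  \<open>OPT\<close> is not bounded in terms of \<open>n\<close> and \<open>k\<close>. Shrinking the
  excess by \<open>1 - 1/k\<close> from there would take a number of steps that depends on the
  coordinates; the pigeonhole phase over the first \<open>k\<close> steps replaces this ratio by
  \<open>32 n^3\<close>. The value \<open>4 OPT\<close> is the price of restricting centres to
  \<open>X\<close>: the point of a cluster nearest to its centre at most doubles distances. The same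
  restriction makes a table of \<open>n^2\<close> squared distances all that the search needs. The
  number \<open>(log n)^k\<close> of tuples is absorbed by \<open>y^k \<le> k^k exp y\<close>, which
  turns the logarithm into a power of \<open>n\<close>. Paths may be enumerated as maps because
  \<open>k^(k+1)\<close> maps per inserted point are within the allowed time; a map that is no path
  does no harm, since any resulting assignment that respects the capacities is a legitimate
  competitor. Time is tracked only as the number of enumerated objects times a power of a fixed
  \<open>Z\<close>, so the large final exponents merely record how the program is composed.\<close>

definition ok :: "com \<Rightarrow> state \<Rightarrow> nat \<Rightarrow> (state \<Rightarrow> bool) \<Rightarrow> bool" where
  "ok p s T Q \<longleftrightarrow> (\<exists>t s'. runs p s t s' \<and> t \<le> T \<and> Q s')"

text \<open>A syntactic over-approximation of the arrays that a program changes. It is the source of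
  every frame condition: loop invariants mention only what the body writes, and
  \<open>runs_frame\<close> carries everything else along.\<close>

primrec iwrites :: "com \<Rightarrow> string set" where
  "iwrites Skip = {}"
| "iwrites (IStore a e1 e2) = {a}"
| "iwrites (RStore a e1 e2) = {}"
| "iwrites (Seq p q) = iwrites p \<union> iwrites q"
| "iwrites (Cond b p q) = iwrites p \<union> iwrites q"
| "iwrites (Loop b p) = iwrites p"

primrec rwrites :: "com \<Rightarrow> string set" where
  "rwrites Skip = {}"
| "rwrites (IStore a e1 e2) = {}"
| "rwrites (RStore a e1 e2) = {a}"
| "rwrites (Seq p q) = rwrites p \<union> rwrites q"
| "rwrites (Cond b p q) = rwrites p \<union> rwrites q"
| "rwrites (Loop b p) = rwrites p"

definition frame :: "com \<Rightarrow> state \<Rightarrow> state \<Rightarrow> bool" where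
  "frame p s s' \<longleftrightarrow> (\<forall>a. a \<notin> iwrites p \<longrightarrow> imem s' a = imem s a) \<and>
     (\<forall>a. a \<notin> rwrites p \<longrightarrow> rmem s' a = rmem s a)"

lemma imem_istore [simp]:
  "imem (istore a i v s) b = (if b = a then (imem s a)(i := v) else imem s b)"
  by (simp add: istore_def)

lemma rmem_istore [simp]: "rmem (istore a i v s) = rmem s"
  by (simp add: istore_def)

lemma rmem_rstore [simp]:
  "rmem (rstore a i v s) b = (if b = a then (rmem s a)(i := v) else rmem s b)"
  by (simp add: rstore_def)

lemma imem_rstore [simp]: "imem (rstore a i v s) = imem s"
  by (simp add: rstore_def)

lemma frame_refl [simp]: "frame p s s"
  by (simp add: frame_def)

lemma frame_trans: "frame p s s' \<Longrightarrow> frame p s' s'' \<Longrightarrow> frame p s s''"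
  by (simp add: frame_def)

lemma runs_frame: "runs p s t s' \<Longrightarrow> frame p s s'"
  by (induction rule: runs.induct) (auto simp: frame_def)

lemma okE:
  assumes "ok p s T Q"
  obtains t s' where "runs p s t s'" "t \<le> T" "Q s'" "frame p s s'"
  using assms runs_frame unfolding ok_def by blast

lemma ok_conseq:
  assumes "ok p s T Q" "T \<le> T'" "\<And>s'. Q s' \<Longrightarrow> frame p s s' \<Longrightarrow> Q' s'"
  shows "ok p s T' Q'"
proof -
  obtain t s' where "runs p s t s'" "t \<le> T" "Q s'" "frame p s s'" using assms(1) by (rule okE)
  then show ?thesis unfolding ok_def using assms(2,3) by (meson order_trans)
qed

lemma ok_Seq:
  assumes "ok p s T1 R" "\<And>s'. R s' \<Longrightarrow> frame p s s' \<Longrightarrow> ok q s' T2 Q"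
  shows "ok (Seq p q) s (T1 + T2) Q"
proof -
  obtain t s' where 1: "runs p s t s'" "t \<le> T1" "R s'" "frame p s s'" using assms(1) by (rule okE)
  obtain t' s'' where 2: "runs q s' t' s''" "t' \<le> T2" "Q s''"
    using assms(2)[OF 1(3,4)] by (rule okE)
  show ?thesis unfolding ok_def
    using runs.Seq[OF 1(1) 2(1)] 1(2) 2(2,3) by (intro exI[of _ "t + t'"] exI[of _ s'']) auto
qed

lemma ok_Cond:
  assumes "bval b s \<Longrightarrow> ok p s T Q" "\<not> bval b s \<Longrightarrow> ok q s T Q"
  shows "ok (Cond b p q) s (1 + bcost b + T) Q"
proof (cases "bval b s")
  case True
  with assms(1) obtain t s' where 1: "runs p s t s'" "t \<le> T" "Q s'" by (auto elim: okE)
  show ?thesis unfolding ok_def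
    using runs.CondTrue[OF True 1(1), of q] 1(2,3)
    by (intro exI[of _ "1 + bcost b + t"] exI[of _ s']) simp
next
  case False
  with assms(2) obtain t s' where 1: "runs q s t s'" "t \<le> T" "Q s'" by (auto elim: okE)
  show ?thesis unfolding ok_def
    using runs.CondFalse[OF False 1(1), of p] 1(2,3)
    by (intro exI[of _ "1 + bcost b + t"] exI[of _ s']) simp
qed

section \<open>Symbolic execution of loop-free code\<close>

primrec loopfree :: "com \<Rightarrow> bool" where
  "loopfree Skip = True"
| "loopfree (IStore a e1 e2) = True"
| "loopfree (RStore a e1 e2) = True"
| "loopfree (Seq p q) = (loopfree p \<and> loopfree q)"
| "loopfree (Cond b p q) = (loopfree p \<and> loopfree q)"
| "loopfree (Loop b p) = False"

primrec exec :: "com \<Rightarrow> state \<Rightarrow> state" where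
  "exec Skip s = s"
| "exec (IStore a e1 e2) s = istore a (ival e1 s) (ival e2 s) s"
| "exec (RStore a e1 e2) s = rstore a (ival e1 s) (rval e2 s) s"
| "exec (Seq p q) s = exec q (exec p s)"
| "exec (Cond b p q) s = (if bval b s then exec p s else exec q s)"
| "exec (Loop b p) s = s"

primrec steps :: "com \<Rightarrow> nat" where
  "steps Skip = 1"
| "steps (IStore a e1 e2) = 1 + icost e1 + icost e2"
| "steps (RStore a e1 e2) = 1 + icost e1 + rcost e2"
| "steps (Seq p q) = steps p + steps q"
| "steps (Cond b p q) = 1 + bcost b + (steps p + steps q)"
| "steps (Loop b p) = 0"

text \<open>Reduces straight-line code to simplification: \<open>exec\<close> computes the final
  state as a term, and \<open>steps\<close> charges both branches of a conditional, which spares a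
  case distinction in the bound.\<close>

lemma ok_loopfree_exec: "loopfree p \<Longrightarrow> ok p s (steps p) (\<lambda>s'. s' = exec p s)"
proof (induction p arbitrary: s)
  case Skip
  show ?case unfolding ok_def using runs.Skip by fastforce
next
  case (IStore a e1 e2)
  show ?case unfolding ok_def using runs.IStore[of a e1 e2 s] by fastforce
next
  case (RStore a e1 e2)
  show ?case unfolding ok_def using runs.RStore[of a e1 e2 s] by fastforce
next
  case (Seq p q)
  then show ?case by (auto intro!: ok_Seq)
next
  case (Cond b p q)
  show ?case unfolding steps.simps
    by (rule ok_Cond; rule ok_conseq, rule Cond.IH) (use Cond.prems in auto)
qed simp

lemma ok_loopfree: "loopfree p \<Longrightarrow> steps p \<le> T \<Longrightarrow> Q (exec p s) \<Longrightarrow> ok p s T Q"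
  by (rule ok_conseq[OF ok_loopfree_exec]) auto

text \<open>The invariant carries a ghost iteration count \<open>i\<close>. The premise that the
  guard forces \<open>i < N\<close> is at once the termination argument and the bound on the number
  of rounds.\<close>

lemma ok_Loop:
  assumes step: "\<And>i s'. frame p s s' \<Longrightarrow> I i s' \<Longrightarrow> bval b s' \<Longrightarrow> i < N \<and> ok p s' T (I (Suc i))"
    and init: "I 0 s"
  shows "ok (Loop b p) s (Suc N * (1 + bcost b + T)) (\<lambda>s'. \<exists>i\<le>N. I i s' \<and> \<not> bval b s')"
proof -
  have "ok (Loop b p) s' (Suc m * (1 + bcost b + T)) (\<lambda>s'. \<exists>i\<le>N. I i s' \<and> \<not> bval b s')"
    if "I i s'" "frame p s s'" "i + m = N" for m i s'
    using that
  proof (induction m arbitrary: i s')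
    case 0
    have "\<not> bval b s'" using step[OF 0(2,1)] 0(3) by auto
    with 0 show ?case unfolding ok_def
      using runs.LoopFalse[of b s' p] by (intro exI[of _ "1 + bcost b"] exI[of _ s']) auto
  next
    case (Suc m)
    show ?case
    proof (cases "bval b s'")
      case False
      show ?thesis unfolding ok_def
        using runs.LoopFalse[OF False, of p] False Suc.prems
        by (intro exI[of _ "1 + bcost b"] exI[of _ s']) (auto intro!: exI[of _ i])
    next
      case True
      from step[OF Suc.prems(2,1) True] obtain t s1 where
        1: "runs p s' t s1" "t \<le> T" "I (Suc i) s1" "frame p s' s1"
        by (auto elim: okE)
      have "frame p s s1" using Suc.prems(2) 1(4) by (rule frame_trans)
      moreover have "Suc i + m = N" using Suc.prems(3) by simp
      ultimately obtain t' s2 where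
        2: "runs (Loop b p) s1 t' s2" "t' \<le> Suc m * (1 + bcost b + T)" "\<exists>i\<le>N. I i s2 \<and> \<not> bval b s2"
        using Suc.IH[OF 1(3)] unfolding ok_def by blast
      show ?thesis unfolding ok_def
        using runs.LoopTrue[OF True 1(1) 2(1)] 1(2) 2(2,3)
        by (intro exI[of _ "1 + bcost b + t + t'"] exI[of _ s2]) auto
    qed
  qed
  from this[OF init frame_refl, of N] show ?thesis by simp
qed

section \<open>Counting loops\<close>

abbreviation IVar :: "string \<Rightarrow> iexp" where "IVar a \<equiv> ILoad a (IConst 0)"
abbreviation ISet :: "string \<Rightarrow> iexp \<Rightarrow> com" where "ISet a e \<equiv> IStore a (IConst 0) e"
abbreviation RVar :: "string \<Rightarrow> rexp" where "RVar a \<equiv> RLoad a (IConst 0)"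
abbreviation RSet :: "string \<Rightarrow> rexp \<Rightarrow> com" where "RSet a e \<equiv> RStore a (IConst 0) e"
abbreviation IInc :: "iexp \<Rightarrow> iexp" where "IInc e \<equiv> IAdd e (IConst 1)"

definition For :: "string \<Rightarrow> iexp \<Rightarrow> com \<Rightarrow> com" where
  "For v e p = Seq (ISet v (IConst 0)) (Loop (ILess (IVar v) e) (Seq p (ISet v (IInc (IVar v)))))"

lemma writes_For [simp]:
  "iwrites (For v e p) = insert v (iwrites p)" "rwrites (For v e p) = rwrites p"
  by (auto simp: For_def)

text \<open>The invariant is re-established for the state after the counter has been incremented,
  hence the \<open>istore v 0 (Suc i)\<close>. The bound \<open>e\<close> is evaluated anew in every
  round; \<open>stable\<close> holds as soon as \<open>e\<close> reads only arrays that the loop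
  does not write.\<close>

lemma ok_For:
  assumes stable: "\<And>s'. frame (For v e p) s s' \<Longrightarrow> ival e s' = N"
    and v: "v \<notin> iwrites p"
    and step: "\<And>i s'. i < N \<Longrightarrow> frame (For v e p) s s' \<Longrightarrow> imem s' v 0 = i \<Longrightarrow> I i s' \<Longrightarrow>
      ok p s' T (\<lambda>s''. I (Suc i) (istore v 0 (Suc i) s''))"
    and init: "I 0 (istore v 0 0 s)"
  shows "ok (For v e p) s (4 + Suc N * (T + icost e + 10)) (\<lambda>s'. I N s' \<and> imem s' v 0 = N)"
proof -
  let ?body = "Seq p (ISet v (IInc (IVar v)))"
  let ?J = "\<lambda>i s'. i \<le> N \<and> frame (For v e p) s s' \<and> imem s' v 0 = i \<and> I i s'"
  have "ok (Loop (ILess (IVar v) e) ?body) (istore v 0 0 s)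
      (Suc N * (1 + bcost (ILess (IVar v) e) + (T + 6)))
      (\<lambda>s'. \<exists>i\<le>N. ?J i s' \<and> \<not> bval (ILess (IVar v) e) s')"
  proof (rule ok_Loop)
    show "?J 0 (istore v 0 0 s)" using init by (auto simp: frame_def)
  next
    fix i s' assume J: "?J i s'" and b: "bval (ILess (IVar v) e) s'"
    have i: "i < N" using J b stable[of s'] by simp
    have "ok ?body s' (T + 6) (?J (Suc i))"
    proof (rule ok_Seq)
      show "ok p s' T (\<lambda>s''. I (Suc i) (istore v 0 (Suc i) s''))" using step[OF i] J by blast
    next
      fix s'' assume 1: "I (Suc i) (istore v 0 (Suc i) s'')" "frame p s' s''"
      have "imem s'' v 0 = i" using 1(2) v J by (simp add: frame_def)
      moreover have "frame (For v e p) s (istore v 0 (Suc i) s'')"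
        using J 1(2) by (auto simp: frame_def)
      ultimately show "ok (ISet v (IInc (IVar v))) s'' 6 (?J (Suc i))"
        using 1 i by (intro ok_loopfree) auto
    qed
    with i show "i < N \<and> ok ?body s' (T + 6) (?J (Suc i))" by simp
  qed
  then have "ok (Loop (ILess (IVar v) e) ?body) (istore v 0 0 s) (Suc N * (T + icost e + 10))
     (\<lambda>s'. I N s' \<and> imem s' v 0 = N)"
  proof (rule ok_conseq)
    fix s' assume "\<exists>i\<le>N. ?J i s' \<and> \<not> bval (ILess (IVar v) e) s'"
    then obtain i where i: "?J i s'" "\<not> bval (ILess (IVar v) e) s'" by blast
    then have "i = N" using stable[of s'] by simp
    with i show "I N s' \<and> imem s' v 0 = N" by simp
  qed (simp add: algebra_simps)
  moreover have "ok (ISet v (IConst 0)) s 4 (\<lambda>s'. s' = istore v 0 0 s)"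
    by (rule ok_loopfree) auto
  ultimately show ?thesis unfolding For_def by (blast intro: ok_Seq)
qed

text \<open>Bounds by powers of a common large \<open>Z\<close> compose without any arithmetic: exponents simply add.
  The factor \<open>K\<close> accounts for the enumerations.\<close>

locale scale =
  fixes Z :: nat
  assumes Z: "100 \<le> Z"
begin

text \<open>\<open>0 < K\<close> is part of the notion because additive constants are absorbed by
  \<open>K * Z ^ e\<close>, which must then be at least 1.\<close>

definition timed :: "nat \<Rightarrow> nat \<Rightarrow> com \<Rightarrow> state \<Rightarrow> (state \<Rightarrow> bool) \<Rightarrow> bool" where
  "timed K e p s Q \<longleftrightarrow> 0 < K \<and> ok p s (K * Z ^ e) Q"

lemma timed_conseq:
  assumes "timed K a p s R" "K \<le> K'" "a \<le> e" "\<And>s'. R s' \<Longrightarrow> frame p s s' \<Longrightarrow> Q s'"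
  shows "timed K' e p s Q"
  unfolding timed_def
proof
  show "0 < K'" using assms(1,2) by (simp add: timed_def)
  have "Z ^ a \<le> Z ^ e" using Z assms(3) by (intro power_increasing) auto
  then have "K * Z ^ a \<le> K' * Z ^ e" using assms(2) by (rule mult_le_mono[rotated])
  moreover have "ok p s (K * Z ^ a) R" using assms(1) by (simp add: timed_def)
  ultimately show "ok p s (K' * Z ^ e) Q" using ok_conseq assms(4) by blast
qed

lemma timed_loopfree:
  assumes "loopfree p" "steps p \<le> 100" "1 \<le> e" "Q (exec p s)"
  shows "timed 1 e p s Q"
proof (rule timed_conseq)
  show "timed 1 1 p s (\<lambda>s'. s' = exec p s)"
    unfolding timed_def using assms(1,2) Z by (auto intro: ok_loopfree)
qed (use assms in auto)

text \<open>Sums turn into products at the cost of one extra factor \<open>Z\<close>. This wastes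
  exponents, but leaves only linear side conditions on them in the composition rules.\<close>

lemma pow_add_le: "Z ^ a + Z ^ b \<le> Z ^ (a + b + 1)"
proof -
  have "Z ^ a \<le> Z ^ (a + b)" "Z ^ b \<le> Z ^ (a + b)" using Z by (auto intro!: power_increasing)
  moreover have "2 * Z ^ (a + b) \<le> Z * Z ^ (a + b)" using Z by (intro mult_right_mono) auto
  ultimately have "Z ^ a + Z ^ b \<le> Z * Z ^ (a + b)" by linarith
  then show ?thesis by simp
qed

lemma timed_Seq:
  assumes "timed K a p s R" "\<And>s'. R s' \<Longrightarrow> frame p s s' \<Longrightarrow> timed K b q s' Q" "a + b + 1 \<le> e"
  shows "timed K e (Seq p q) s Q"
proof (rule timed_conseq)
  have "ok (Seq p q) s (K * Z ^ a + K * Z ^ b) Q"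
    using assms(1,2) by (intro ok_Seq[where R = R]) (auto simp: timed_def)
  moreover have "K * Z ^ a + K * Z ^ b \<le> K * Z ^ (a + b + 1)"
    using mult_le_mono2[OF pow_add_le, of K] by (simp only: distrib_left)
  ultimately have "ok (Seq p q) s (K * Z ^ (a + b + 1)) Q" by (rule ok_conseq)
  then show "timed K (a + b + 1) (Seq p q) s Q" using assms(1) by (simp only: timed_def)
qed (use assms in auto)

lemma timed_Cond:
  assumes "bcost b \<le> 99" "bval b s \<Longrightarrow> timed K a p s Q" "\<not> bval b s \<Longrightarrow> timed K c q s Q" "a + c + 2 \<le> e"
  shows "timed K e (Cond b p q) s Q"
proof (rule timed_conseq)
  have K: "0 < K" using assms(2,3) unfolding timed_def by blast
  have "ok (Cond b p q) s (1 + bcost b + K * Z ^ (a + c)) Q"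
  proof (rule ok_Cond)
    show "ok p s (K * Z ^ (a + c)) Q" if "bval b s"
      using timed_conseq[OF assms(2)[OF that], of K "a + c" Q] by (simp add: timed_def)
    show "ok q s (K * Z ^ (a + c)) Q" if "\<not> bval b s"
      using timed_conseq[OF assms(3)[OF that], of K "a + c" Q] by (simp add: timed_def)
  qed
  moreover have "1 + bcost b + K * Z ^ (a + c) \<le> K * Z ^ (a + c + 2)"
  proof -
    have "1 + bcost b \<le> 1 * Z" using assms(1) Z by simp
    also have "\<dots> \<le> K * Z" using K by (intro mult_le_mono1) simp
    finally have "1 + bcost b \<le> K * Z ^ 1" by simp
    moreover have "K * Z ^ 1 + K * Z ^ (a + c) \<le> K * Z ^ (1 + (a + c) + 1)"
      using mult_le_mono2[OF pow_add_le, of K] by (simp only: distrib_left)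
    ultimately show ?thesis by (simp add: algebra_simps)
  qed
  ultimately have "ok (Cond b p q) s (K * Z ^ (a + c + 2)) Q" by (rule ok_conseq)
  then show "timed K (a + c + 2) (Cond b p q) s Q" using K by (simp only: timed_def)
qed (use assms in auto)

lemma loop_time_le:
  assumes K: "0 < K" and N: "Suc N \<le> M * Z ^ c" and j: "j \<le> 30"
  shows "4 + Suc N * (K * Z ^ a + j) \<le> (M * K) * Z ^ (a + c + 1)"
proof -
  have a1: "1 \<le> K * Z ^ a" using Z K by simp
  have c1: "1 \<le> M * Z ^ c" using N by linarith
  \<comment> \<open>All summands are bounded by multiples of the same product; the multiples 4, 1
    and 30 add up to 35, which one further factor \<open>Z\<close> swallows.\<close>
  have "4 + Suc N * (K * Z ^ a + j) \<le> 4 * (M * Z ^ c * (K * Z ^ a)) + M * Z ^ c * (K * Z ^ a + 30 * (K * Z ^ a))"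
  proof (intro add_mono mult_mono)
    show "4 \<le> 4 * (M * Z ^ c * (K * Z ^ a))" using mult_le_mono[OF c1 a1] by linarith
    show "j \<le> 30 * (K * Z ^ a)" using a1 j by linarith
  qed (use N in auto)
  also have "\<dots> = 35 * (M * Z ^ c * (K * Z ^ a))" by simp
  also have "\<dots> \<le> Z * (M * Z ^ c * (K * Z ^ a))" using Z by (intro mult_right_mono) auto
  finally show ?thesis by (simp add: power_add mult_ac)
qed

lemma timed_For:
  assumes I: "I 0 (istore v 0 0 s)"
    and step: "\<And>i s'. i < N \<Longrightarrow> frame (For v ex p) s s' \<Longrightarrow> imem s' v 0 = i \<Longrightarrow> I i s' \<Longrightarrow>
      timed K a p s' (\<lambda>s''. I (Suc i) (istore v 0 (Suc i) s''))"
    and K: "0 < K" and N: "Suc N \<le> Z ^ c" and ex: "icost ex \<le> 20" and v: "v \<notin> iwrites p"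
    and stable: "\<And>s'. frame (For v ex p) s s' \<Longrightarrow> ival ex s' = N"
    and e: "a + c + 1 \<le> e"
    and Q: "\<And>s'. I N s' \<Longrightarrow> frame (For v ex p) s s' \<Longrightarrow> imem s' v 0 = N \<Longrightarrow> Q s'"
  shows "timed K e (For v ex p) s Q"
proof (rule timed_conseq[where R = "\<lambda>s'. I N s' \<and> imem s' v 0 = N"])
  have "ok (For v ex p) s (4 + Suc N * (K * Z ^ a + icost ex + 10)) (\<lambda>s'. I N s' \<and> imem s' v 0 = N)"
  proof (rule ok_For[where I = I])
    fix i s' assume "i < N" "frame (For v ex p) s s'" "imem s' v 0 = i" "I i s'"
    then have "timed K a p s' (\<lambda>s''. I (Suc i) (istore v 0 (Suc i) s''))" by (rule step)
    then show "ok p s' (K * Z ^ a) (\<lambda>s''. I (Suc i) (istore v 0 (Suc i) s''))" by (simp add: timed_def)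
  next
    fix s' assume "frame (For v ex p) s s'"
    then show "ival ex s' = N" by (rule stable)
  qed (rule v, rule I)
  moreover have "4 + Suc N * (K * Z ^ a + icost ex + 10) \<le> K * Z ^ (a + c + 1)"
    using loop_time_le[OF K, of N 1 c "icost ex + 10" a] N ex by (simp add: add.assoc)
  ultimately have "ok (For v ex p) s (K * Z ^ (a + c + 1)) (\<lambda>s'. I N s' \<and> imem s' v 0 = N)" by (rule ok_conseq)
  then show "timed K (a + c + 1) (For v ex p) s (\<lambda>s'. I N s' \<and> imem s' v 0 = N)"
    using K by (simp only: timed_def)
qed (use e Q in auto)

end

section \<open>Enumerating all functions with an odometer\<close>

definition digit :: "nat \<Rightarrow> nat \<Rightarrow> nat \<Rightarrow> nat" where
  "digit b N j = N div b ^ j mod b"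

lemma digit_less: "0 < b \<Longrightarrow> digit b N j < b"
  by (simp add: digit_def)

text \<open>This makes counting an exhaustive search: every map from \<open>l\<close> positions to
  \<open>b\<close> values is met as the digit sequence of some number below
  \<open>b ^ l\<close>.\<close>

lemma digit_surj:
  assumes "\<forall>j<l. f j < b"
  shows "\<exists>N<b ^ l. \<forall>j<l. digit b N j = f j"
  using assms
proof (induction l)
  case (Suc l)
  have "\<forall>j<l. f j < b" using Suc.prems by simp
  from Suc.IH[OF this] obtain N where N: "N < b ^ l" "\<forall>j<l. digit b N j = f j" by blast
  have fl: "f l < b" using Suc.prems by simp
  have b0: "0 < b" using fl by simp
  let ?M = "N + f l * b ^ l"
  have "?M < b ^ l + f l * b ^ l" using N(1) by simp
  also have "\<dots> = Suc (f l) * b ^ l" by simp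
  also have "\<dots> \<le> b * b ^ l" using fl by (intro mult_right_mono) auto
  finally have 1: "?M < b ^ Suc l" by simp
  have "digit b ?M j = f j" if "j < Suc l" for j
  proof (cases "j = l")
    case True
    then show ?thesis using N(1) fl b0 by (simp add: digit_def)
  next
    case False
    then have j: "j < l" using that by simp
    then obtain r where r: "l = Suc (j + r)" using less_imp_Suc_add by auto
    have "?M div b ^ j = (N + b ^ j * (f l * b ^ Suc r)) div b ^ j"
      by (simp add: r power_add algebra_simps)
    also have "\<dots> = N div b ^ j + b * (f l * b ^ r)"
      using b0 by (subst div_mult_self2) (auto simp: algebra_simps)
    finally have "digit b ?M j = digit b N j" by (simp add: digit_def)
    then show ?thesis using N(2) j by simp
  qed
  with 1 show ?case by blast
qed simp

text \<open>\<open>Suc N mod b ^ j = 0\<close> says that all digits below position \<open>j\<close>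
  have wrapped around, so that the carry arrives at \<open>j\<close>; the second part passes the
  carry on.\<close>

lemma digit_Suc:
  assumes b: "0 < b"
  shows "digit b (Suc N) j = (if Suc N mod b ^ j = 0 then (if Suc (digit b N j) < b then Suc (digit b N j) else 0)
    else digit b N j)"
    and "Suc N mod b ^ Suc j = 0 \<longleftrightarrow> Suc N mod b ^ j = 0 \<and> \<not> Suc (digit b N j) < b"
proof -
  have d: "Suc N div b ^ j = (if Suc N mod b ^ j = 0 then Suc (N div b ^ j) else N div b ^ j)"
    by (simp add: div_Suc)
  show 1: "digit b (Suc N) j = (if Suc N mod b ^ j = 0 then (if Suc (digit b N j) < b then Suc (digit b N j) else 0)
    else digit b N j)"
  proof -
    have "digit b N j < b" using b by (rule digit_less)
    then show ?thesis unfolding digit_def d by (auto simp: mod_Suc)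
  qed
  have "Suc N mod b ^ Suc j = b ^ j * digit b (Suc N) j + Suc N mod b ^ j"
    using mod_mult2_eq[of "Suc N" "b ^ j" b] by (simp add: digit_def mult.commute[of _ b])
  then show "Suc N mod b ^ Suc j = 0 \<longleftrightarrow> Suc N mod b ^ j = 0 \<and> \<not> Suc (digit b N j) < b"
    using b by (auto simp: 1)
qed

text \<open>The cell \<open>q\<close> holds the carry; the final carry signals that the odometer has wrapped around.\<close>

definition Increment :: "string \<Rightarrow> iexp \<Rightarrow> iexp \<Rightarrow> com" where
  "Increment a l b = Seq (ISet ''q'' (IConst 1)) (For ''j'' l
     (Cond (ILess (IConst 0) (IVar ''q''))
       (Cond (ILess (IInc (ILoad a (IVar ''j''))) b)
         (Seq (IStore a (IVar ''j'') (IInc (ILoad a (IVar ''j'')))) (ISet ''q'' (IConst 0)))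
         (IStore a (IVar ''j'') (IConst 0)))
       Skip))"

definition Enum :: "string \<Rightarrow> iexp \<Rightarrow> iexp \<Rightarrow> com \<Rightarrow> com" where
  "Enum a l b p = Seq (ISet ''q'' (IConst 0))
     (Loop (ILess (IVar ''q'') (IConst 1)) (Seq p (Increment a l b)))"

lemma writes_Increment [simp]:
  "iwrites (Increment a l b) = {a, ''j'', ''q''}" "rwrites (Increment a l b) = {}"
  by (auto simp: Increment_def)

lemma writes_Enum [simp]:
  "iwrites (Enum a l b p) = {a, ''j'', ''q''} \<union> iwrites p" "rwrites (Enum a l b p) = rwrites p"
  by (auto simp: Enum_def)

context scale
begin

lemma timed_Increment:
  assumes len: "Suc len \<le> Z" and cost: "icost l \<le> 20" "icost b \<le> 20"
    and a: "a \<noteq> ''j''" "a \<noteq> ''q''" and B: "0 < B"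
    and l: "\<And>s'. frame (Increment a l b) s s' \<Longrightarrow> ival l s' = len"
    and b: "\<And>s'. frame (Increment a l b) s s' \<Longrightarrow> ival b s' = B"
    and dig: "\<forall>j<len. imem s a j = digit B N j"
  shows "timed 1 5 (Increment a l b) s (\<lambda>s'. (\<forall>j<len. imem s' a j = digit B (Suc N) j) \<and>
    (imem s' ''q'' 0 = (if Suc N mod B ^ len = 0 then 1 else 0)))"
proof -
  let ?body = "Cond (ILess (IConst 0) (IVar ''q''))
       (Cond (ILess (IInc (ILoad a (IVar ''j''))) b)
         (Seq (IStore a (IVar ''j'') (IInc (ILoad a (IVar ''j'')))) (ISet ''q'' (IConst 0)))
         (IStore a (IVar ''j'') (IConst 0)))
       Skip"
  \<comment> \<open>While the carry travels, positions below \<open>i\<close> already show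
    \<open>Suc N\<close> and the others still \<open>N\<close>.\<close>
  let ?I = "\<lambda>i s'. (\<forall>j<len. imem s' a j = digit B (if j < i then Suc N else N) j) \<and>
    (imem s' ''q'' 0 = (if Suc N mod B ^ i = 0 then 1 else 0))"
  show ?thesis
    unfolding Increment_def
  proof (rule timed_Seq[where R = "\<lambda>s'. s' = istore ''q'' 0 1 s" and a = 1 and b = 3])
    show "timed 1 1 (ISet ''q'' (IConst 1)) s (\<lambda>s'. s' = istore ''q'' 0 1 s)"
      by (rule timed_loopfree) auto
  next
    fix s1 assume s1: "s1 = istore ''q'' 0 1 s"
    have fr: "frame (Increment a l b) s s2" if "frame (For ''j'' l ?body) s1 s2" for s2
      using that by (auto simp: frame_def s1)
    show "timed 1 3 (For ''j'' l ?body) s1 (\<lambda>s'. (\<forall>j<len. imem s' a j = digit B (Suc N) j) \<and>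
      (imem s' ''q'' 0 = (if Suc N mod B ^ len = 0 then 1 else 0)))"
    proof (rule timed_For[where I = ?I and a = 1 and c = 1])
      fix s2 assume "frame (For ''j'' l ?body) s1 s2"
      then show "ival l s2 = len" using l fr by blast
    next
      show "?I 0 (istore ''j'' 0 0 s1)" using a dig by (simp add: s1)
    next
      fix i s2 assume i: "i < len" and f: "frame (For ''j'' l ?body) s1 s2" and j: "imem s2 ''j'' 0 = i"
        and I: "?I i s2"
      have bB: "ival b s2 = B" using b fr[OF f] by blast
      have ai: "imem s2 a i = digit B N i" using I i by simp
      show "timed 1 1 ?body s2 (\<lambda>s''. ?I (Suc i) (istore ''j'' 0 (Suc i) s''))"
      proof (rule timed_loopfree)
        show "?I (Suc i) (istore ''j'' 0 (Suc i) (exec ?body s2))"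
          using I i j a ai digit_Suc[OF B, of N i] bB
          by (auto simp: less_Suc_eq simp del: power_Suc)
      qed (use cost in auto)
    qed (use a len cost in auto)
  qed auto
qed

text \<open>The number \<open>N\<close> exists only in the invariant; the machine holds its digits.
  The body may itself contain an \<open>Enum\<close>, since \<open>Increment\<close> sets
  \<open>q\<close> anew before the guard reads it. The array \<open>a\<close> ends as it started,
  all zero, so that an enumeration can be repeated without clearing.\<close>

lemma timed_Enum:
  assumes len: "Suc len \<le> Z" and cost: "icost l \<le> 20" "icost b \<le> 20"
    and a: "a \<noteq> ''j''" "a \<noteq> ''q''" "a \<notin> iwrites p" and B: "0 < B" and K: "0 < K"
    and l: "\<And>s'. frame (Enum a l b p) s s' \<Longrightarrow> ival l s' = len"
    and b: "\<And>s'. frame (Enum a l b p) s s' \<Longrightarrow> ival b s' = B"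
    and zero: "\<forall>j<len. imem s a j = 0"
    and init: "I 0 (istore ''q'' 0 0 s)"
    and step: "\<And>N s'. N < B ^ len \<Longrightarrow> frame (Enum a l b p) s s' \<Longrightarrow>
      \<forall>j<len. imem s' a j = digit B N j \<Longrightarrow> I N s' \<Longrightarrow> timed K e p s' (I (Suc N))"
    and inv: "\<And>N s1 s2. I N s1 \<Longrightarrow> frame (Increment a l b) s1 s2 \<Longrightarrow> I N s2"
    and e: "e + 8 \<le> e'"
    and Q: "\<And>s'. I (B ^ len) s' \<Longrightarrow> frame (Enum a l b p) s s' \<Longrightarrow> \<forall>j<len. imem s' a j = 0 \<Longrightarrow> Q s'"
  shows "timed (B ^ len * K) e' (Enum a l b p) s Q"
proof -
  let ?body = "Seq p (Increment a l b)"
  let ?s = "istore ''q'' 0 0 s"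
  let ?T = "K * Z ^ (e + 6)"
  let ?J = "\<lambda>N s'. N \<le> B ^ len \<and> frame (Enum a l b p) s s' \<and> (\<forall>j<len. imem s' a j = digit B N j) \<and>
    imem s' ''q'' 0 = (if N = B ^ len then 1 else 0) \<and> I N s'"
  have bl: "0 < B ^ len" using B by simp
  have "ok (Loop (ILess (IVar ''q'') (IConst 1)) ?body) ?s
     (Suc (B ^ len) * (1 + bcost (ILess (IVar ''q'') (IConst 1)) + ?T))
     (\<lambda>s'. \<exists>N\<le>B ^ len. ?J N s' \<and> \<not> bval (ILess (IVar ''q'') (IConst 1)) s')"
  proof (rule ok_Loop)
    show "?J 0 ?s" using zero a init bl by (auto simp: frame_def digit_def)
  next
    fix N s1 assume J: "?J N s1" and bv: "bval (ILess (IVar ''q'') (IConst 1)) s1"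
    have N: "N < B ^ len" using J bv by (auto split: if_splits)
    have "timed K (e + 6) ?body s1 (?J (Suc N))"
    proof (rule timed_Seq)
      show "timed K e p s1 (I (Suc N))" using step[OF N] J by blast
    next
      fix s2 assume s2: "I (Suc N) s2" "frame p s1 s2"
      have dig: "\<forall>j<len. imem s2 a j = digit B N j" using J s2(2) a(3) by (simp add: frame_def)
      have fr2: "frame (Enum a l b p) s s2" using J s2(2) by (auto simp: frame_def)
      have fr: "frame (Enum a l b p) s s3" if "frame (Increment a l b) s2 s3" for s3
        using fr2 that by (auto simp: frame_def)
      have "timed 1 5 (Increment a l b) s2 (\<lambda>s'. (\<forall>j<len. imem s' a j = digit B (Suc N) j) \<and>
          (imem s' ''q'' 0 = (if Suc N mod B ^ len = 0 then 1 else 0)))"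
        using fr l b by (intro timed_Increment[OF len cost a(1,2) B _ _ dig]) auto
      then show "timed K 5 (Increment a l b) s2 (?J (Suc N))"
      proof (rule timed_conseq)
        fix s3 assume 3: "(\<forall>j<len. imem s3 a j = digit B (Suc N) j) \<and>
          (imem s3 ''q'' 0 = (if Suc N mod B ^ len = 0 then 1 else 0))" "frame (Increment a l b) s2 s3"
        have "Suc N mod B ^ len = 0 \<longleftrightarrow> Suc N = B ^ len"
          using N by (cases "Suc N = B ^ len") auto
        then show "?J (Suc N) s3" using 3 fr inv[OF s2(1) 3(2)] N by simp
      qed (use K in auto)
    qed simp
    with N show "N < B ^ len \<and> ok ?body s1 ?T (?J (Suc N))" by (simp add: timed_def)
  qed
  then have 1: "ok (Loop (ILess (IVar ''q'') (IConst 1)) ?body) ?s (Suc (B ^ len) * (?T + 5))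
    (\<lambda>s'. I (B ^ len) s' \<and> (\<forall>j<len. imem s' a j = 0))"
  proof (rule ok_conseq)
    fix s' assume "\<exists>N\<le>B ^ len. ?J N s' \<and> \<not> bval (ILess (IVar ''q'') (IConst 1)) s'"
    then obtain N where N: "?J N s'" "\<not> bval (ILess (IVar ''q'') (IConst 1)) s'" by blast
    then have NB: "N = B ^ len" by (auto split: if_splits)
    have "digit B (B ^ len) j = 0" if j: "j < len" for j
    proof -
      obtain r where "len = Suc (j + r)" using j less_imp_Suc_add by auto
      then have "B ^ len = B ^ j * (B * B ^ r)" by (simp add: power_add)
      then show ?thesis using B by (simp add: digit_def)
    qed
    then show "I (B ^ len) s' \<and> (\<forall>j<len. imem s' a j = 0)" using N NB by simp
  qed (simp add: algebra_simps)
  have "ok (ISet ''q'' (IConst 0)) s 4 (\<lambda>s'. s' = istore ''q'' 0 0 s)"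
    by (rule ok_loopfree) auto
  then have "ok (Enum a l b p) s (4 + Suc (B ^ len) * (?T + 5))
      (\<lambda>s'. I (B ^ len) s' \<and> (\<forall>j<len. imem s' a j = 0))"
    unfolding Enum_def using 1 by (blast intro: ok_Seq)
  moreover have "4 + Suc (B ^ len) * (?T + 5) \<le> (B ^ len * K) * Z ^ (e + 6 + 1 + 1)"
  proof (rule loop_time_le[OF K])
    have "Suc (B ^ len) \<le> B ^ len * 2" using bl by linarith
    also have "\<dots> \<le> B ^ len * Z" using Z by (intro mult_le_mono2) simp
    finally show "Suc (B ^ len) \<le> B ^ len * Z ^ 1" by simp
  qed simp
  ultimately have "ok (Enum a l b p) s ((B ^ len * K) * Z ^ (e + 6 + 1 + 1))
      (\<lambda>s'. I (B ^ len) s' \<and> (\<forall>j<len. imem s' a j = 0))" by (rule ok_conseq)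
  then have "timed (B ^ len * K) (e + 6 + 1 + 1) (Enum a l b p) s
      (\<lambda>s'. I (B ^ len) s' \<and> (\<forall>j<len. imem s' a j = 0))"
    unfolding timed_def using bl K by auto
  then show ?thesis by (rule timed_conseq) (use e Q in auto)
qed

end

section \<open>Capacitated assignment by augmenting paths\<close>

definition cap_feasible :: "nat \<Rightarrow> nat \<Rightarrow> nat \<Rightarrow> (nat \<Rightarrow> nat) \<Rightarrow> bool" where
  "cap_feasible k u t A \<longleftrightarrow> (\<forall>y<t. A y < k) \<and> (\<forall>i<k. card {y. y < t \<and> A y = i} \<le> u)"

definition assign_cost :: "(nat \<Rightarrow> nat \<Rightarrow> real) \<Rightarrow> nat \<Rightarrow> (nat \<Rightarrow> nat) \<Rightarrow> real" where
  "assign_cost w t A = (\<Sum>y<t. w y (A y))"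

definition cap_optimal :: "(nat \<Rightarrow> nat \<Rightarrow> real) \<Rightarrow> nat \<Rightarrow> nat \<Rightarrow> nat \<Rightarrow> (nat \<Rightarrow> nat) \<Rightarrow> bool" where
  "cap_optimal w k u t A \<longleftrightarrow> cap_feasible k u t A \<and>
     (\<forall>B. cap_feasible k u t B \<longrightarrow> assign_cost w t A \<le> assign_cost w t B)"

text \<open>A map \<open>g\<close> on classes encodes an augmenting path: in each class
  \<open>c\<close>, one point that is cheapest to transfer from \<open>c\<close> to
  \<open>g c\<close> is transferred, and \<open>g c = c\<close> leaves the class alone. The
  selection \<sigma> is existential because ties may be broken in any way.\<close>

definition class_move :: "(nat \<Rightarrow> nat \<Rightarrow> real) \<Rightarrow> nat \<Rightarrow> (nat \<Rightarrow> nat) \<Rightarrow> (nat \<Rightarrow> nat) \<Rightarrow> (nat \<Rightarrow> nat) \<Rightarrow> bool" where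
  "class_move w t A g B \<longleftrightarrow> (\<exists>\<sigma>.
     (\<forall>y<t. \<sigma> (A y) < t \<and> A (\<sigma> (A y)) = A y \<and>
        w (\<sigma> (A y)) (g (A y)) - w (\<sigma> (A y)) (A y) \<le> w y (g (A y)) - w y (A y)) \<and>
     (\<forall>y<t. B y = (if \<sigma> (A y) = y then g (A y) else A y)))"

text \<open>With class sizes as sums of indicators, one identity about sums covers both sizes and
  costs.\<close>

lemma card_as_sum: "real (card {y. y < (t::nat) \<and> A y = i}) = (\<Sum>y<t. of_bool (A y = (i::nat)))"
proof -
  have "(\<Sum>y<t. of_bool (A y = i)) = (\<Sum>y\<in>{y \<in> {..<t}. A y = i}. (1::real))"
    by (intro sum.mono_neutral_cong_right) auto
  then show ?thesis by simp
qed

lemma sum_update_on: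
  fixes \<phi> :: "nat \<Rightarrow> nat \<Rightarrow> real"
  assumes "D \<subseteq> {..<t}"
  shows "(\<Sum>y<t. \<phi> y (if y \<in> D then A y else B y)) = (\<Sum>y<t. \<phi> y (B y)) + (\<Sum>y\<in>D. \<phi> y (A y) - \<phi> y (B y))"
proof -
  have "(\<Sum>y<t. \<phi> y (if y \<in> D then A y else B y)) = (\<Sum>y<t. \<phi> y (B y) + (if y \<in> D then \<phi> y (A y) - \<phi> y (B y) else 0))"
    by (intro sum.cong) auto
  also have "\<dots> = (\<Sum>y<t. \<phi> y (B y)) + (\<Sum>y\<in>{..<t} \<inter> D. \<phi> y (A y) - \<phi> y (B y))"
    by (simp add: sum.distrib sum.inter_restrict)
  also have "{..<t} \<inter> D = D" using assms by blast
  finally show ?thesis .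
qed

text \<open>Pick one point for each edge of the path. Distinct vertices make the sources
  \<open>A y\<close> distinct, and the sum telescopes to the two endpoints: rerouting the picked
  points moves one unit of load from \<open>i\<close> to \<open>j\<close>.\<close>

lemma distinct_path_exchange:
  fixes A A' :: "nat \<Rightarrow> nat"
  assumes "rtrancl_path (\<lambda>i j. \<exists>y<t. A y = i \<and> A' y = j) i ps j" "distinct (i # ps)"
  shows "\<exists>D \<subseteq> {..<t}. inj_on A D \<and> A ` D \<subseteq> set (i # ps) \<and> j \<notin> A ` D \<and>
    (\<forall>c. (\<Sum>y\<in>D. of_bool (A' y = c) - of_bool (A y = c)) = (of_bool (j = c) - of_bool (i = c) :: real))"
  using assms
proof (induction rule: rtrancl_path.induct)
  case (base x)
  show ?case by (rule exI[of _ "{}"]) auto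
next
  case (step x y ys z)
  then obtain D where D: "D \<subseteq> {..<t}" "inj_on A D" "A ` D \<subseteq> set (y # ys)" "z \<notin> A ` D"
    "\<And>c. (\<Sum>y\<in>D. of_bool (A' y = c) - of_bool (A y = c)) = (of_bool (z = c) - of_bool (y = c) :: real)"
    by auto
  from step.hyps(1) obtain p where p: "p < t" "A p = x" "A' p = y" by blast
  have pD: "p \<notin> D" and xD: "x \<notin> A ` D" using D(3) step.prems p by auto
  have fD: "finite D" using D(1) finite_subset by blast
  \<comment> \<open>The last vertex \<open>z\<close> lies on the tail of the path, so it differs
    from the new head \<open>x\<close>.\<close>
  have zx: "z \<in> set (y # ys)"
    using step.hyps(2) by (induction rule: rtrancl_path.induct) auto
  show ?case
    by (rule exI[of _ "insert p D"]) (use D p pD xD fD zx step.prems in auto)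
qed

text \<open>One step of the successive shortest path method. If all centres reachable from \<open>A' t\<close> in the
  exchange graph were saturated by \<open>A\<close>, then \<open>A'\<close> would overfill them; hence there is an augmenting
  path, and the cost of any augmenting path taken from \<open>A'\<close> is at most what \<open>A'\<close> pays over \<open>A\<close>.\<close>

lemma class_move_optimal:
  assumes opt: "cap_optimal w k u t A" and At: "A t = k" and A': "cap_feasible k u (Suc t) A'"
  shows "\<exists>g. (\<forall>i\<le>k. g i < k) \<and> (\<forall>B. class_move w (Suc t) A g B \<longrightarrow>
    cap_feasible k u (Suc t) B \<and> assign_cost w (Suc t) B \<le> assign_cost w (Suc t) A')"
proof -
  define R where "R = (\<lambda>i j. \<exists>y<t. A y = i \<and> A' y = j)"
  define i0 where "i0 = A' t"
  have Ak: "A y < k" if "y < t" for y using opt that by (auto simp: cap_optimal_def cap_feasible_def)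
  have A'k: "A' y < k" if "y \<le> t" for y using A' that by (auto simp: cap_feasible_def)
  define W where "W = {j. R\<^sup>*\<^sup>* i0 j}"
  have Wk: "W \<subseteq> {..<k}"
  proof
    fix j assume "j \<in> W"
    then have "R\<^sup>*\<^sup>* i0 j" by (simp add: W_def)
    then show "j \<in> {..<k}"
      by (cases rule: rtranclp.cases) (auto simp: i0_def A'k R_def)
  qed
  have finW: "finite W" using Wk finite_subset by blast
  have clsum: "(\<Sum>i\<in>W. card {y. y < s \<and> F y = i}) = card {y. y < s \<and> F y \<in> W}" for s and F :: "nat \<Rightarrow> nat"
  proof -
    have "{y. y < s \<and> F y \<in> W} = (\<Union>i\<in>W. {y. y < s \<and> F y = i})" by auto
    moreover have "card \<dots> = (\<Sum>i\<in>W. card {y. y < s \<and> F y = i})"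
      using finW by (intro card_UN_disjoint) auto
    ultimately show ?thesis by simp
  qed
  have "\<exists>j\<in>W. card {y. y < t \<and> A y = j} < u"
  proof (rule ccontr)
    assume "\<not> ?thesis"
    then have "(\<Sum>i\<in>W. u) \<le> (\<Sum>i\<in>W. card {y. y < t \<and> A y = i})"
      by (intro sum_mono) (auto simp: not_less)
    then have 1: "card W * u \<le> card {y. y < t \<and> A y \<in> W}" by (simp add: clsum)
    \<comment> \<open>\<open>W\<close> is closed under exchange edges, so \<open>A'\<close> keeps in
      \<open>W\<close> every point that \<open>A\<close> has there, and adds the new point
      \<open>t\<close>.\<close>
    have "insert t {y. y < t \<and> A y \<in> W} \<subseteq> {y. y < Suc t \<and> A' y \<in> W}"
      by (auto simp: W_def i0_def R_def intro: rtranclp.rtrancl_into_rtrancl)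
    from card_mono[OF _ this] have "Suc (card {y. y < t \<and> A y \<in> W}) \<le> card {y. y < Suc t \<and> A' y \<in> W}"
      by simp
    also have "\<dots> \<le> card W * u"
      unfolding clsum[symmetric]
      using sum_bounded_above[of W "\<lambda>i. card {y. y < Suc t \<and> A' y = i}" u] A' Wk
      by (auto simp: cap_feasible_def)
    finally show False using 1 by simp
  qed
  then obtain j where j: "R\<^sup>*\<^sup>* i0 j" "card {y. y < t \<and> A y = j} < u" by (auto simp: W_def)
  then obtain ps where "rtrancl_path R i0 ps j" "distinct (i0 # ps)"
    by (metis rtranclp_eq_rtrancl_path rtrancl_path_distinct)
  from distinct_path_exchange[OF this[unfolded R_def]] obtain D where D: "D \<subseteq> {..<t}" "inj_on A D"
    and Dc: "\<And>c. (\<Sum>y\<in>D. of_bool (A' y = c) - of_bool (A y = c)) = (of_bool (j = c) - of_bool (i0 = c) :: real)"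
    by metis
  have finD: "finite D" using D(1) finite_subset by blast
  \<comment> \<open>Centres on the path go to their successors; the dummy class \<open>k\<close>,
    which holds only the new point, goes to the start of the path; all other centres are
    fixed.\<close>
  define g where "g i = (if i = k then i0 else if i \<in> A ` D then A' (inv_into D A i) else if i < k then i else 0)" for i
  have k0: "0 < k" using A'k[of t] by auto
  have gk: "\<forall>i\<le>k. g i < k"
    using D(1) by (auto simp: g_def i0_def A'k k0)
      (metis A'k D(1) imageI inv_into_into lessThan_iff less_imp_le_nat subsetD)
  have gD: "g (A y) = A' y" if "y \<in> D" for y
    using that D Ak[of y] by (auto simp: g_def)
  have gnD: "g i = i" if "i < k" "i \<notin> A ` D" for i using that by (simp add: g_def)
  have gA: "g k = i0" by (simp add: g_def)
  have "cap_feasible k u (Suc t) B \<and> assign_cost w (Suc t) B \<le> assign_cost w (Suc t) A'"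
    if "class_move w (Suc t) A g B" for B
  proof -
    from that obtain \<sigma> where \<sigma>: "\<And>y. y \<le> t \<Longrightarrow> \<sigma> (A y) \<le> t \<and> A (\<sigma> (A y)) = A y \<and>
        w (\<sigma> (A y)) (g (A y)) - w (\<sigma> (A y)) (A y) \<le> w y (g (A y)) - w y (A y)"
      and B: "\<And>y. y \<le> t \<Longrightarrow> B y = (if \<sigma> (A y) = y then g (A y) else A y)"
      by (auto simp: class_move_def less_Suc_eq_le)
    have \<sigma>k: "\<sigma> k = t"
      using \<sigma>[of t] Ak[of "\<sigma> k"] At by force
    have Bt: "B t = i0" using B[of t] At \<sigma>k gA by simp
    have \<sigma>t: "\<sigma> (A y) < t" "A (\<sigma> (A y)) = A y" if "y < t" for y
      using \<sigma>[of y] Ak[OF that] that At by (metis less_imp_le_nat nat_less_le)+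
    \<comment> \<open>A class move need not use the points of \<open>D\<close>, but it selects
      exactly one point in each class that \<open>D\<close> touches; \<open>M\<close> collects
      these.\<close>
    define M where "M = (\<lambda>y. \<sigma> (A y)) ` D"
    have injM: "inj_on (\<lambda>y. \<sigma> (A y)) D"
      using D \<sigma>t(2) by (smt (verit) inj_on_def lessThan_iff subsetD)
    have Mt: "M \<subseteq> {..<t}" using D(1) \<sigma>t(1) by (auto simp: M_def)
    have BM: "B y = (if y \<in> M then g (A y) else A y)" if "y < t" for y
    proof (cases "A y \<in> A ` D")
      case True
      then obtain z where z: "z \<in> D" "A z = A y" by auto
      have "y \<in> M \<longleftrightarrow> \<sigma> (A y) = y"
        using z D \<sigma>t(2) unfolding M_def by (smt (verit) imageE image_eqI lessThan_iff subsetD)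
      then show ?thesis using B[of y] that by simp
    next
      case False
      then show ?thesis using B[of y] that gnD[of "A y"] Ak[of y] by auto
    qed
    have sumB: "(\<Sum>y<Suc t. \<phi> y (B y)) = (\<Sum>y<t. \<phi> y (A y)) + \<phi> t i0
        + (\<Sum>y\<in>D. \<phi> (\<sigma> (A y)) (A' y) - \<phi> (\<sigma> (A y)) (A y))" for \<phi> :: "nat \<Rightarrow> nat \<Rightarrow> real"
    proof -
      have "(\<Sum>y<t. \<phi> y (B y)) = (\<Sum>y<t. \<phi> y (if y \<in> M then g (A y) else A y))"
        by (intro sum.cong) (auto simp: BM)
      also have "\<dots> = (\<Sum>y<t. \<phi> y (A y)) + (\<Sum>y\<in>M. \<phi> y (g (A y)) - \<phi> y (A y))"
        by (rule sum_update_on[OF Mt])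
      also have "(\<Sum>y\<in>M. \<phi> y (g (A y)) - \<phi> y (A y))
          = (\<Sum>y\<in>D. \<phi> (\<sigma> (A y)) (g (A (\<sigma> (A y)))) - \<phi> (\<sigma> (A y)) (A (\<sigma> (A y))))"
        unfolding M_def by (simp add: sum.reindex[OF injM])
      also have "\<dots> = (\<Sum>y\<in>D. \<phi> (\<sigma> (A y)) (A' y) - \<phi> (\<sigma> (A y)) (A y))"
        using D(1) \<sigma>t(2) gD by (intro sum.cong) (auto simp: subset_iff)
      finally show ?thesis using Bt by simp
    qed
    have "card {y. y < Suc t \<and> B y = c} \<le> u" if "c < k" for c
    proof -
      \<comment> \<open>The unit that the new point adds at \<open>i0\<close> cancels against the
        unit that the path takes from there; only the end \<open>j\<close> of the path, which had
        room, grows.\<close>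
      have "real (card {y. y < Suc t \<and> B y = c}) = real (card {y. y < t \<and> A y = c}) + of_bool (j = c)"
        unfolding card_as_sum sumB[of "\<lambda>_ b. of_bool (b = c)"] using Dc[of c] by simp
      then show ?thesis using j(2) opt that
        by (cases "j = c") (auto simp: cap_optimal_def cap_feasible_def)
    qed
    moreover have "B y < k" if "y < Suc t" for y
      using B[of y] that gk Ak[of y] At \<sigma>k by (cases "y = t") auto
    ultimately have feas: "cap_feasible k u (Suc t) B" by (auto simp: cap_feasible_def)
    \<comment> \<open>The reverse exchange: \<open>A'\<close> without the new point and with the
      path undone. It is feasible for \<open>t\<close> points, so \<open>A\<close> costs no more;
      this is where optimality of \<open>A\<close> enters.\<close>
    define A2 where "A2 y = (if y \<in> D then A y else A' y)" for y
    have sum2: "(\<Sum>y<t. \<phi> y (A2 y)) = (\<Sum>y<t. \<phi> y (A' y)) + (\<Sum>y\<in>D. \<phi> y (A y) - \<phi> y (A' y))"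
      for \<phi> :: "nat \<Rightarrow> nat \<Rightarrow> real"
      unfolding A2_def by (rule sum_update_on[OF D(1)])
    have "card {y. y < t \<and> A2 y = c} \<le> u" if "c < k" for c
    proof -
      have "(\<Sum>y\<in>D. of_bool (A y = c) - of_bool (A' y = c)) = (of_bool (i0 = c) - of_bool (j = c) :: real)"
        using Dc[of c] by (simp add: sum_subtractf)
      then have "real (card {y. y < t \<and> A2 y = c}) = real (card {y. y < Suc t \<and> A' y = c}) - of_bool (j = c)"
        unfolding card_as_sum sum2[of "\<lambda>_ b. of_bool (b = c)"] by (simp add: i0_def)
      also have "\<dots> \<le> real u" using A' that by (auto simp: cap_feasible_def)
      finally show ?thesis by simp
    qed
    moreover have "A2 y < k" if "y < t" for y using Ak A'k that by (auto simp: A2_def)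
    ultimately have "cap_feasible k u t A2" by (auto simp: cap_feasible_def)
    then have le: "assign_cost w t A \<le> assign_cost w t A2" using opt by (auto simp: cap_optimal_def)
    \<comment> \<open>In each class the selected point is at least as cheap to transfer as the point
      of \<open>D\<close>.\<close>
    have "(\<Sum>y\<in>D. w (\<sigma> (A y)) (A' y) - w (\<sigma> (A y)) (A y)) \<le> (\<Sum>y\<in>D. w y (A' y) - w y (A y))"
      using \<sigma> D(1) gD by (intro sum_mono) (metis lessThan_iff less_imp_le_nat subsetD)
    then have "assign_cost w (Suc t) B \<le> assign_cost w t A + w t i0 + (\<Sum>y\<in>D. w y (A' y) - w y (A y))"
      unfolding assign_cost_def sumB[of w] by simp
    also have "\<dots> \<le> assign_cost w t A2 + w t i0 + (\<Sum>y\<in>D. w y (A' y) - w y (A y))" using le by simp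
    also have "\<dots> = assign_cost w (Suc t) A'"
      unfolding assign_cost_def sum2[of w] by (simp add: i0_def sum_subtractf)
    finally show ?thesis using feas by simp
  qed
  then show ?thesis using gk by blast
qed

section \<open>Euclidean distance of vectors\<close>

definition vdist :: "real vec \<Rightarrow> real vec \<Rightarrow> real" where
  "vdist v w = eucl_norm (v - w)"

lemma vdist_coords:
  assumes "v \<in> carrier_vec d" "w \<in> carrier_vec d"
  shows "vdist v w = L2_set (\<lambda>l. v $ l - w $ l) {..<d}"
  using assms by (auto simp: vdist_def eucl_norm_def intro!: L2_set_cong)

lemma vdist_sq:
  assumes "v \<in> carrier_vec d" "w \<in> carrier_vec d"
  shows "(vdist v w)\<^sup>2 = (\<Sum>l<d. (v $ l - w $ l)\<^sup>2)"
  unfolding vdist_coords[OF assms] by (simp add: L2_set_def sum_nonneg)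

lemma vdist_nonneg [simp]: "0 \<le> vdist v w"
  by (simp add: vdist_def eucl_norm_def)

lemma vdist_commute:
  assumes "v \<in> carrier_vec d" "w \<in> carrier_vec d"
  shows "vdist v w = vdist w v"
  unfolding vdist_coords[OF assms] vdist_coords[OF assms(2,1)]
  by (simp add: L2_set_def power2_commute)

lemma vdist_triangle:
  assumes "u \<in> carrier_vec d" "v \<in> carrier_vec d" "w \<in> carrier_vec d"
  shows "vdist u w \<le> vdist u v + vdist v w"
proof -
  have "vdist u w = L2_set (\<lambda>l. (u $ l - v $ l) + (v $ l - w $ l)) {..<d}"
    unfolding vdist_coords[OF assms(1,3)] by (rule L2_set_cong) auto
  also have "\<dots> \<le> vdist u v + vdist v w"
    unfolding vdist_coords[OF assms(1,2)] vdist_coords[OF assms(2,3)] by (rule L2_set_triangle_ineq)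
  finally show ?thesis .
qed

lemma power2_sum_le: "(a + b)\<^sup>2 \<le> 2 * a\<^sup>2 + 2 * (b::real)\<^sup>2"
  using zero_le_power2[of "a - b"] by (simp add: power2_eq_square algebra_simps)

section \<open>Greedy choice of candidate centres\<close>

text \<open>The squared distance from \<open>x\<close> to the nearest of \<open>S 0\<close>, ...,
  \<open>S t\<close> when \<open>D\<close> holds squared distances. The recursion mirrors the update
  of the array \<open>N\<close>.\<close>

primrec near :: "('a \<Rightarrow> 'b \<Rightarrow> real) \<Rightarrow> (nat \<Rightarrow> 'b) \<Rightarrow> nat \<Rightarrow> 'a \<Rightarrow> real" where
  "near D S 0 x = D x (S 0)"
| "near D S (Suc t) x = min (near D S t x) (D x (S (Suc t)))"

lemma near_cong: "(\<And>j. j \<le> t \<Longrightarrow> S j = S' j) \<Longrightarrow> near D S t x = near D S' t x"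
  by (induction t) auto

lemma near_le: "j \<le> t \<Longrightarrow> near D S t x \<le> D x (S j)"
  by (induction t) (auto simp: le_Suc_eq min.coboundedI1)

lemma near_attained: "\<exists>j\<le>t. near D S t x = D x (S j)"
proof (induction t)
  case (Suc t)
  then obtain j where "j \<le> t" "near D S t x = D x (S j)" by blast
  then show ?case
    by (intro exI[of _ "if near D S t x \<le> D x (S (Suc t)) then j else Suc t"]) (auto simp: min_def)
qed auto

definition greedy :: "nat \<Rightarrow> (nat \<Rightarrow> nat \<Rightarrow> real) \<Rightarrow> (nat \<Rightarrow> nat) \<Rightarrow> nat \<Rightarrow> bool" where
  "greedy n D S m \<longleftrightarrow> (\<forall>j\<le>m. S j < n) \<and>
     (\<forall>j<m. \<forall>y<n. (\<Sum>x<n. near D S (Suc j) x) \<le> (\<Sum>x<n. min (near D S j x) (D x y)))"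

text \<open>A comparison solution that stays fixed during the analysis; it is instantiated with an
  optimal solution of the capacitated problem.\<close>

locale clustering =
  fixes d :: nat and pts :: "nat \<Rightarrow> real vec" and n k :: nat
    and c :: "nat \<Rightarrow> real vec" and \<pi> :: "nat \<Rightarrow> nat"
  assumes pts: "\<And>x. x < n \<Longrightarrow> pts x \<in> carrier_vec d"
    and c: "\<And>i. i < k \<Longrightarrow> c i \<in> carrier_vec d"
    and \<pi>: "\<And>x. x < n \<Longrightarrow> \<pi> x < k"
    and k: "0 < k" "k \<le> n"
begin

definition D :: "nat \<Rightarrow> nat \<Rightarrow> real" where
  "D x y = (vdist (pts x) (pts y))\<^sup>2"

definition total :: real where
  "total = (\<Sum>x<n. (vdist (pts x) (c (\<pi> x)))\<^sup>2)"

lemma D_nonneg [simp]: "0 \<le> D x y"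
  by (simp add: D_def)

lemma total_nonneg: "0 \<le> total"
  by (simp add: total_def sum_nonneg)

lemma centre_sq_le_total: "x < n \<Longrightarrow> (vdist (pts x) (c (\<pi> x)))\<^sup>2 \<le> total"
  unfolding total_def by (rule member_le_sum) auto

lemma near_nonneg: "0 \<le> near D S t x"
  by (induction t) auto

text \<open>Both points are within the square root of \<open>total\<close> of their common centre.
  Bounding a single summand by \<open>total\<close> is crude, but the loss only enters the
  polynomial factor of the starting phase.\<close>

lemma same_cluster_le:
  assumes "x < n" "y < n" "\<pi> x = \<pi> y"
  shows "D x y \<le> 4 * total"
proof -
  have "vdist (pts x) (pts y) \<le> vdist (pts x) (c (\<pi> x)) + vdist (pts y) (c (\<pi> y))"
    using vdist_triangle[OF pts[OF assms(1)] c[OF \<pi>[OF assms(1)]] pts[OF assms(2)]]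
      vdist_commute[OF pts[OF assms(2)] c[OF \<pi>[OF assms(2)]]] assms(3) by simp
  then have "D x y \<le> (vdist (pts x) (c (\<pi> x)) + vdist (pts y) (c (\<pi> y)))\<^sup>2"
    unfolding D_def by (intro power_mono) auto
  also have "\<dots> \<le> 2 * total + 2 * total"
    using power2_sum_le centre_sq_le_total[OF assms(1)] centre_sq_le_total[OF assms(2)]
    by (smt (verit))
  finally show ?thesis by simp
qed

text \<open>The point of a cluster nearest to its centre is no farther from the centre than
  \<open>x\<close>, so distances at most double and their squares grow by at most 4. This is the
  source of \<open>4 * total\<close>.\<close>

lemma cluster_representative:
  obtains r where "\<And>x. x < n \<Longrightarrow> r (\<pi> x) < n" "\<And>x. x < n \<Longrightarrow> D x (r (\<pi> x)) \<le> 4 * (vdist (pts x) (c (\<pi> x)))\<^sup>2"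
proof -
  define r where "r i = arg_min_on (\<lambda>x. vdist (pts x) (c i)) {x. x < n \<and> \<pi> x = i}" for i
  have r: "r (\<pi> x) < n" "\<pi> (r (\<pi> x)) = \<pi> x"
    "vdist (pts (r (\<pi> x))) (c (\<pi> x)) \<le> vdist (pts x) (c (\<pi> x))" if "x < n" for x
  proof -
    have fin: "finite {y. y < n \<and> \<pi> y = \<pi> x}" and ne: "{y. y < n \<and> \<pi> y = \<pi> x} \<noteq> {}" using that by auto
    show "r (\<pi> x) < n" "\<pi> (r (\<pi> x)) = \<pi> x"
      using arg_min_if_finite(1)[OF fin ne, of "\<lambda>y. vdist (pts y) (c (\<pi> x))"] by (auto simp: r_def)
    show "vdist (pts (r (\<pi> x))) (c (\<pi> x)) \<le> vdist (pts x) (c (\<pi> x))"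
      unfolding r_def by (rule arg_min_least[OF fin ne]) (use that in simp)
  qed
  have "D x (r (\<pi> x)) \<le> 4 * (vdist (pts x) (c (\<pi> x)))\<^sup>2" if x: "x < n" for x
  proof -
    have "vdist (pts x) (pts (r (\<pi> x))) \<le> vdist (pts x) (c (\<pi> x)) + vdist (pts (r (\<pi> x))) (c (\<pi> x))"
      using vdist_triangle[OF pts[OF x] c[OF \<pi>[OF x]] pts[OF r(1)[OF x]]]
        vdist_commute[OF pts[OF r(1)[OF x]] c[OF \<pi>[OF x]]] by simp
    also have "\<dots> \<le> 2 * vdist (pts x) (c (\<pi> x))" using r(3)[OF x] by simp
    finally have "D x (r (\<pi> x)) \<le> (2 * vdist (pts x) (c (\<pi> x)))\<^sup>2"
      unfolding D_def by (intro power_mono) auto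
    then show ?thesis by (simp add: power_mult_distrib)
  qed
  with r(1) show ?thesis by (rule that)
qed

section \<open>Decrease of the greedy cost\<close>

context
  fixes S :: "nat \<Rightarrow> nat" and m :: nat
  assumes greedy: "greedy n D S m"
begin

definition f :: "nat \<Rightarrow> real" where
  "f t = (\<Sum>x<n. near D S t x)"

lemma S_less: "j \<le> m \<Longrightarrow> S j < n"
  using greedy by (simp add: greedy_def)

lemma f_Suc_le: "f (Suc t) \<le> f t"
  unfolding f_def by (intro sum_mono) simp

lemma f_antimono: "s \<le> t \<Longrightarrow> f t \<le> f s"
  by (rule lift_Suc_antimono_le[of f]) (rule f_Suc_le)

text \<open>Adding the representatives of all \<open>k\<close> clusters would bring the cost down to \<open>4 * total\<close>;
  by supermodularity one of them achieves a \<open>k\<close>-th of this.\<close>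

lemma greedy_progress:
  assumes t: "t < m"
  shows "real k * (f t - f (Suc t)) \<ge> f t - 4 * total"
proof -
  obtain r where r: "\<And>x. x < n \<Longrightarrow> r (\<pi> x) < n" "\<And>x. x < n \<Longrightarrow> D x (r (\<pi> x)) \<le> 4 * (vdist (pts x) (c (\<pi> x)))\<^sup>2"
    using cluster_representative by blast
  let ?gain = "\<lambda>x. near D S t x - 4 * (vdist (pts x) (c (\<pi> x)))\<^sup>2"
  have gain: "(\<Sum>x\<in>{x \<in> {..<n}. \<pi> x = i}. ?gain x) \<le> f t - f (Suc t)" for i
  proof (cases "{x \<in> {..<n}. \<pi> x = i} = {}")
    case True
    have "0 \<le> f t - f (Suc t)" using f_Suc_le[of t] by simp
    then show ?thesis unfolding True by simp
  next
    case False
    then obtain z where "z < n" "\<pi> z = i" by auto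
    then have "r i < n" using r(1) by blast
    then have "f (Suc t) \<le> (\<Sum>x<n. min (near D S t x) (D x (r i)))"
      using greedy t unfolding f_def greedy_def by blast
    \<comment> \<open>A minimum is bounded by either argument: the representative is used inside
      cluster \<open>i\<close>, the old nearest point elsewhere.\<close>
    also have "\<dots> \<le> (\<Sum>x<n. near D S t x - (if \<pi> x = i then ?gain x else 0))"
      using r(2) by (intro sum_mono) (auto simp: min_def; force)
    also have "\<dots> = f t - (\<Sum>x\<in>{x \<in> {..<n}. \<pi> x = i}. ?gain x)"
      by (subst sum_subtractf) (simp only: f_def sum.inter_filter[OF finite_lessThan])
    finally show ?thesis by simp
  qed
  have "f t - 4 * total = (\<Sum>x<n. ?gain x)"
    by (simp add: f_def total_def sum_subtractf sum_distrib_left)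
  also have "\<dots> = (\<Sum>i<k. \<Sum>x\<in>{x \<in> {..<n}. \<pi> x = i}. ?gain x)"
    using \<pi> by (intro sum.group[symmetric]) auto
  also have "\<dots> \<le> (\<Sum>i<k. f t - f (Suc t))" by (intro sum_mono gain)
  also have "\<dots> = real k * (f t - f (Suc t))" by simp
  finally show ?thesis .
qed

text \<open>A new point close to an old one cannot help much, yet \<open>greedy_progress\<close>
  demands a gain of a \<open>k\<close>-th of the excess. Both together are possible only if
  \<open>f t\<close> is already at most polynomial in \<open>n\<close> times
  \<open>total\<close>.\<close>

lemma greedy_same_cluster:
  assumes t: "t < m" and j: "j \<le> t" "\<pi> (S j) = \<pi> (S (Suc t))"
  shows "f t \<le> 32 * real n ^ 3 * total"
proof -
  let ?y = "S (Suc t)" and ?\<delta> = "D (S (Suc t)) (S j)"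
  have y: "?y < n" and z: "S j < n" using S_less t j by auto
  have k1: "real k \<ge> 1" using k by simp
  have \<delta>: "?\<delta> \<le> 4 * total" using same_cluster_le[OF y z] j by simp
  have drop: "near D S t x - near D S (Suc t) x \<le> near D S t x / (2 * k) + (2 * k + 1) * ?\<delta>" if x: "x < n" for x
  proof (cases "near D S t x \<le> D x ?y")
    case True
    then show ?thesis using near_nonneg[of S t x] k1 by (simp add: min_absorb1)
  next
    case False
    let ?a = "vdist (pts x) (pts ?y)" and ?e = "vdist (pts ?y) (pts (S j))"
    have "near D S t x \<le> D x (S j)" by (rule near_le[OF j(1)])
    also have "\<dots> \<le> (?a + ?e)\<^sup>2"
      unfolding D_def using vdist_triangle[OF pts[OF x] pts[OF y] pts[OF z]] by (intro power_mono) auto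
    also have "\<dots> = ?a\<^sup>2 + 2 * (?a * ?e) + ?e\<^sup>2" by (simp add: power2_sum)
    \<comment> \<open>Weighted inequality of arithmetic and geometric means. The weight
      \<open>2 * k\<close> is chosen so that the resulting share of \<open>f t\<close>, multiplied
      by \<open>k\<close> below, amounts to one half and can be absorbed on the left.\<close>
    also have "2 * (?a * ?e) \<le> ?a\<^sup>2 / (2 * k) + 2 * k * ?e\<^sup>2"
    proof -
      have "0 \<le> (?a - 2 * k * ?e)\<^sup>2 / (2 * k)" using k1 by simp
      also have "\<dots> = ?a\<^sup>2 / (2 * k) + 2 * k * ?e\<^sup>2 - 2 * (?a * ?e)"
        using k1 by (simp add: power2_diff field_simps power2_eq_square)
      finally show ?thesis by simp
    qed
    finally have "near D S t x - ?a\<^sup>2 \<le> ?a\<^sup>2 / (2 * k) + (2 * k + 1) * ?e\<^sup>2"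
      by (simp add: algebra_simps)
    also have "?a\<^sup>2 / (2 * k) \<le> near D S t x / (2 * k)"
      using False k1 unfolding D_def by (intro divide_right_mono) auto
    finally show ?thesis using False by (simp add: min_absorb2 D_def)
  qed
  have "f t - f (Suc t) \<le> (\<Sum>x<n. near D S t x / (2 * k) + (2 * k + 1) * ?\<delta>)"
    unfolding f_def sum_subtractf[symmetric] by (intro sum_mono drop) simp
  also have "\<dots> = f t / (2 * k) + n * ((2 * k + 1) * ?\<delta>)"
    by (simp add: sum.distrib f_def sum_divide_distrib)
  also have "\<dots> \<le> f t / (2 * k) + n * ((2 * k + 1) * (4 * total))"
    using \<delta> by (intro add_left_mono mult_left_mono) auto
  finally have "real k * (f t - f (Suc t)) \<le> real k * (f t / (2 * k) + n * ((2 * k + 1) * (4 * total)))"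
    using k1 by (intro mult_left_mono) auto
  with greedy_progress[OF t] have "f t - 4 * total \<le> real k * (f t / (2 * k) + n * ((2 * k + 1) * (4 * total)))"
    by simp
  also have "\<dots> = f t / 2 + 4 * (real n * (real k * (2 * real k + 1))) * total"
    using k1 by (simp add: field_simps)
  finally have "f t \<le> (8 + 8 * (real n * (real k * (2 * real k + 1)))) * total" by (simp add: algebra_simps)
  \<comment> \<open>32 is 8 + 8 * 3, with 1 and \<open>k * (2 * k + 1)\<close> rounded up to
    \<open>n ^ 3\<close> and \<open>3 * n ^ 2\<close>.\<close>
  also have "\<dots> \<le> (32 * real n ^ 3) * total"
  proof (rule mult_right_mono[OF _ total_nonneg])
    have nk: "real k \<le> real n" "1 \<le> real n" using k by auto
    have "real k * (2 * real k + 1) \<le> real n * (3 * real n)"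
      using nk k1 by (intro mult_mono) auto
    then have "real n * (real k * (2 * real k + 1)) \<le> real n * (real n * (3 * real n))"
      by (intro mult_left_mono) auto
    then have "real n * (real k * (2 * real k + 1)) \<le> 3 * real n ^ 3" by (simp add: power3_eq_cube)
    moreover have "1 \<le> real n ^ 3" using nk by simp
    ultimately show "8 + 8 * (real n * (real k * (2 * real k + 1))) \<le> 32 * real n ^ 3" by linarith
  qed
  finally show ?thesis by simp
qed

text \<open>As long as the cost is large, every greedy point lies in a cluster not hit before.\<close>

lemma greedy_start:
  assumes "k \<le> m"
  shows "f k \<le> 32 * real n ^ 3 * total"
proof (rule ccontr)
  let ?B = "32 * real n ^ 3 * total"
  assume neg: "\<not> ?thesis"
  have inj: "\<pi> (S i) \<noteq> \<pi> (S j)" if "i < j" "j \<le> k" for i j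
  proof
    assume eq: "\<pi> (S i) = \<pi> (S j)"
    obtain t where t: "j = Suc t" using \<open>i < j\<close> by (cases j) auto
    have "f t \<le> ?B" using greedy_same_cluster[of t i] that assms eq t by auto
    moreover have "f k \<le> f t" using that t by (intro f_antimono) auto
    ultimately show False using neg by simp
  qed
  \<comment> \<open>\<open>S 0\<close>, ..., \<open>S k\<close> would be \<open>k + 1\<close> points
    in pairwise different clusters, of which there are only \<open>k\<close>.\<close>
  have "inj_on (\<lambda>j. \<pi> (S j)) {..k}"
    by (rule inj_onI) (metis inj atMost_iff linorder_neqE_nat)
  moreover have "(\<lambda>j. \<pi> (S j)) ` {..k} \<subseteq> {..<k}" using \<pi> S_less assms by auto
  ultimately have "card {..k} \<le> card {..<k}" by (intro card_inj_on_le) auto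
  then show False by simp
qed

lemma greedy_contraction:
  assumes "k + t \<le> m"
  shows "f (k + t) - 4 * total \<le> (1 - 1 / k) ^ t * (32 * real n ^ 3 * total)"
  using assms
proof (induction t)
  case 0
  then show ?case using greedy_start total_nonneg by simp
next
  case (Suc t)
  have "f (k + Suc t) - 4 * total \<le> (1 - 1 / k) * (f (k + t) - 4 * total)"
    using greedy_progress[of "k + t"] Suc.prems k by (simp add: field_simps)
  also have "\<dots> \<le> (1 - 1 / k) * ((1 - 1 / k) ^ t * (32 * real n ^ 3 * total))"
    using Suc k by (intro mult_left_mono) auto
  finally show ?case by (simp add: mult.assoc)
qed

text \<open>Each block of \<open>k\<close> steps at least halves the bound on the excess, since
  \<open>(1 - 1/k) ^ k\<close> is at most \<open>1/e\<close>. The \<open>3 * L\<close> blocks after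
  the start divide it by at least \<open>n ^ 3\<close>, leaving at most \<open>32 * total\<close>
  above \<open>4 * total\<close>.\<close>

lemma greedy_final:
  assumes m: "m = k + 3 * (k * L)" and L: "n \<le> 2 ^ L"
  shows "f m \<le> 36 * total"
proof -
  have "(1 - 1 / real k) ^ k \<le> exp (- (1 / real k)) ^ k"
    using k exp_ge_add_one_self[of "- (1 / real k)"] by (intro power_mono) auto
  also have "\<dots> = exp (- 1)" using k by (simp flip: exp_of_nat_mult)
  also have "\<dots> \<le> 1 / 2" using exp_ge_add_one_self[of 1] by (simp add: exp_minus field_simps)
  finally have "((1 - 1 / real k) ^ k) ^ (3 * L) \<le> (1 / 2) ^ (3 * L)"
    using k by (intro power_mono) auto
  then have "(1 - 1 / real k) ^ (3 * (k * L)) \<le> (1 / 2) ^ (3 * L)"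
    by (simp add: power_mult[symmetric] mult.left_commute)
  then have "(1 - 1 / real k) ^ (3 * (k * L)) * (32 * real n ^ 3 * total) \<le> (1 / 2) ^ (3 * L) * (32 * real n ^ 3 * total)"
    using total_nonneg by (intro mult_right_mono) auto
  also have "\<dots> = 32 * total * (real n / 2 ^ L) ^ 3"
    by (simp add: power_divide power_mult mult.commute[of 3])
  also have "\<dots> \<le> 32 * total * 1 ^ 3"
  proof -
    have "real n \<le> 2 ^ L" using L by (metis of_nat_le_iff of_nat_numeral of_nat_power)
    then show ?thesis using total_nonneg by (intro mult_left_mono power_mono) auto
  qed
  finally show ?thesis using greedy_contraction[of "3 * (k * L)"] m by simp
qed

lemma candidate_tuple:
  obtains \<tau> where "\<And>i. i < k \<Longrightarrow> \<tau> i < Suc m" "(\<Sum>x<n. D x (S (\<tau> (\<pi> x)))) \<le> 12 * total + 3 / 2 * f m"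
proof -
  \<comment> \<open>The candidate is chosen per centre and not per point, so the assignment \<pi>
    can be kept, and with it the capacities.\<close>
  define \<tau> where "\<tau> i = arg_min_on (\<lambda>j. vdist (c i) (pts (S j))) {..m}" for i
  have \<tau>m: "\<tau> i \<le> m" for i
    using arg_min_if_finite(1)[of "{..m}" "\<lambda>j. vdist (c i) (pts (S j))"] by (auto simp: \<tau>_def)
  have \<tau>min: "vdist (c i) (pts (S (\<tau> i))) \<le> vdist (c i) (pts (S j))" if "j \<le> m" for i j
    unfolding \<tau>_def by (rule arg_min_least) (use that in auto)
  have "D x (S (\<tau> (\<pi> x))) \<le> 12 * (vdist (pts x) (c (\<pi> x)))\<^sup>2 + 3 / 2 * near D S m x" if x: "x < n" for x
  proof -
    obtain j where j: "j \<le> m" "near D S m x = D x (S j)" using near_attained[of m D S x] by blast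
    let ?a = "vdist (pts x) (c (\<pi> x))" and ?b = "vdist (pts x) (pts (S j))"
    have C: "c (\<pi> x) \<in> carrier_vec d" using c \<pi> x by blast
    have Sj: "pts (S j) \<in> carrier_vec d" "pts (S (\<tau> (\<pi> x))) \<in> carrier_vec d"
      using pts S_less j(1) \<tau>m by auto
    have "vdist (pts x) (pts (S (\<tau> (\<pi> x)))) \<le> ?a + vdist (c (\<pi> x)) (pts (S (\<tau> (\<pi> x))))"
      by (rule vdist_triangle[OF pts[OF x] C Sj(2)])
    also have "\<dots> \<le> ?a + vdist (c (\<pi> x)) (pts (S j))" using \<tau>min[OF j(1)] by simp
    also have "\<dots> \<le> 2 * ?a + ?b"
      using vdist_triangle[OF C pts[OF x] Sj(1)] vdist_commute[OF pts[OF x] C] by simp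
    finally have "D x (S (\<tau> (\<pi> x))) \<le> (2 * ?a + ?b)\<^sup>2" unfolding D_def by (intro power_mono) auto
    \<comment> \<open>Equivalent to \<open>0 \<le> (4 a - b)^2\<close>. The weights trade the two
      terms against each other: together with \<open>f m \<le> 36 * total\<close> they give 12 +
      54.\<close>
    also have "\<dots> \<le> 12 * ?a\<^sup>2 + 3 / 2 * ?b\<^sup>2"
      using zero_le_power2[of "4 * ?a - ?b"] by (simp add: power2_eq_square algebra_simps)
    finally show ?thesis using j(2) by (simp add: D_def)
  qed
  then have "(\<Sum>x<n. D x (S (\<tau> (\<pi> x)))) \<le> (\<Sum>x<n. 12 * (vdist (pts x) (c (\<pi> x)))\<^sup>2 + 3 / 2 * near D S m x)"
    by (intro sum_mono) simp
  also have "\<dots> = 12 * total + 3 / 2 * f m"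
    by (simp only: sum.distrib total_def f_def sum_distrib_left)
  finally show ?thesis using \<tau>m by (intro that[of \<tau>]) (auto simp: less_Suc_eq_le)
qed

end

end

section \<open>Distance matrix\<close>

abbreviation Dist :: "iexp \<Rightarrow> iexp \<Rightarrow> rexp" where
  "Dist x y \<equiv> RLoad ''D'' (IAdd (ILoad ''RN'' x) y)"

text \<open>The machine has no integer multiplication, so the row offsets \<open>y * n\<close> and
  \<open>y * d\<close> are tabulated by repeated addition.\<close>

definition rows_prog :: com where
  "rows_prog = For ''y'' (IVar ''n'')
     (Seq (IStore ''RN'' (IInc (IVar ''y'')) (IAdd (ILoad ''RN'' (IVar ''y'')) (IVar ''n'')))
          (IStore ''RD'' (IInc (IVar ''y'')) (IAdd (ILoad ''RD'' (IVar ''y'')) (IVar ''d''))))"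

abbreviation coord_diff :: rexp where
  "coord_diff \<equiv> RSub (RLoad ''X'' (IAdd (ILoad ''RD'' (IVar ''y'')) (IVar ''l'')))
     (RLoad ''X'' (IAdd (ILoad ''RD'' (IVar ''z'')) (IVar ''l'')))"

definition entry_prog :: com where
  "entry_prog = Seq (RSet ''a'' (RConst 0))
     (For ''l'' (IVar ''d'') (RSet ''a'' (RAdd (RVar ''a'') (RMul coord_diff coord_diff))))"

definition matrix_prog :: com where
  "matrix_prog = For ''y'' (IVar ''n'') (For ''z'' (IVar ''n'')
     (Seq entry_prog (RStore ''D'' (IAdd (ILoad ''RN'' (IVar ''y'')) (IVar ''z'')) (RVar ''a''))))"

text \<open>Afterwards \<open>m = 1 + k + 3 k L\<close>, where \<open>L\<close> is the least number with \<open>n \<le> 2 ^ L\<close>.\<close>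

definition size_prog :: com where
  "size_prog = Seq (Seq (ISet ''p'' (IConst 1)) (ISet ''m'' (IInc (IVar ''k''))))
     (Loop (ILess (IVar ''p'') (IVar ''n''))
       (Seq (ISet ''p'' (IAdd (IVar ''p'') (IVar ''p'')))
            (ISet ''m'' (IAdd (IVar ''m'') (IAdd (IVar ''k'') (IAdd (IVar ''k'') (IVar ''k'')))))))"

definition eval_prog :: com where
  "eval_prog = Seq (RSet ''a'' (RConst 0)) (For ''x'' (IVar ''n'')
     (Cond (RLess (RLoad ''N'' (IVar ''x'')) (Dist (IVar ''x'') (IVar ''y'')))
        (RSet ''a'' (RAdd (RVar ''a'') (RLoad ''N'' (IVar ''x''))))
        (RSet ''a'' (RAdd (RVar ''a'') (Dist (IVar ''x'') (IVar ''y''))))))"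

text \<open>The test \<open>0 < y\<close> replaces an infinite initial value of \<open>b\<close>:
  the point at position 0 is always accepted.\<close>

definition pick_prog :: com where
  "pick_prog = For ''y'' (IVar ''n'') (Seq eval_prog
     (Cond (BAnd (ILess (IConst 0) (IVar ''y'')) (BNot (RLess (RVar ''a'') (RVar ''b''))))
        Skip
        (Seq (ISet ''r'' (IVar ''y'')) (RSet ''b'' (RVar ''a'')))))"

definition update_prog :: com where
  "update_prog = Seq (IStore ''S'' (IInc (IVar ''t'')) (IVar ''r''))
     (For ''x'' (IVar ''n'')
       (Cond (RLess (Dist (IVar ''x'') (IVar ''r'')) (RLoad ''N'' (IVar ''x'')))
          (RStore ''N'' (IVar ''x'') (Dist (IVar ''x'') (IVar ''r''))) Skip))"

text \<open>The start \<open>S 0\<close> is the zero left in memory, that is, the point at position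
  0. The cell \<open>m\<close> counts the candidates including this one, hence \<open>m - 1\<close>
  rounds.\<close>

definition greedy_prog :: com where
  "greedy_prog = Seq (For ''x'' (IVar ''n'') (RStore ''N'' (IVar ''x'') (Dist (IVar ''x'') (IConst 0))))
     (For ''t'' (ISub (IVar ''m'') (IConst 1)) (Seq pick_prog update_prog))"

lemma writes_rows [simp]: "iwrites rows_prog = {''y'', ''RN'', ''RD''}" "rwrites rows_prog = {}"
  by (auto simp: rows_prog_def)

lemma writes_entry [simp]: "iwrites entry_prog = {''l''}" "rwrites entry_prog = {''a''}"
  by (auto simp: entry_prog_def)

lemma writes_matrix [simp]: "iwrites matrix_prog = {''y'', ''z'', ''l''}" "rwrites matrix_prog = {''a'', ''D''}"
  by (auto simp: matrix_prog_def)

lemma writes_size [simp]: "iwrites size_prog = {''p'', ''m''}" "rwrites size_prog = {}"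
  by (auto simp: size_prog_def)

lemma writes_eval [simp]: "iwrites eval_prog = {''x''}" "rwrites eval_prog = {''a''}"
  by (auto simp: eval_prog_def)

lemma writes_pick [simp]: "iwrites pick_prog = {''y'', ''x'', ''r''}" "rwrites pick_prog = {''a'', ''b''}"
  by (auto simp: pick_prog_def)

lemma writes_update [simp]: "iwrites update_prog = {''S'', ''x''}" "rwrites update_prog = {''N''}"
  by (auto simp: update_prog_def)

lemma writes_greedy [simp]:
  "iwrites greedy_prog = {''t'', ''y'', ''x'', ''r'', ''S''}" "rwrites greedy_prog = {''a'', ''b'', ''N''}"
  by (auto simp: greedy_prog_def)

section \<open>Correctness and running time of the preprocessing\<close>

locale hckm_instance = scale +
  fixes d k u :: nat and xs :: "real vec list"
  assumes xs: "set xs \<subseteq> carrier_vec d" and k: "0 < k" "k \<le> length xs"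
    and Z_def: "Z = length xs + d + 100"
begin

abbreviation n :: nat where "n \<equiv> length xs"

definition dst :: "nat \<Rightarrow> nat \<Rightarrow> real" where
  "dst x y = (vdist (xs ! x) (xs ! y))\<^sup>2"

text \<open>\<open>inp\<close>, \<open>rows\<close> and \<open>mat\<close> describe ever more of the
  memory. None of it is overwritten once computed, so each later stage receives its predicate
  through the corresponding frame lemma.\<close>

definition inp :: "state \<Rightarrow> bool" where
  "inp s \<longleftrightarrow> imem s ''n'' 0 = n \<and> imem s ''d'' 0 = d \<and> imem s ''k'' 0 = k \<and> imem s ''u'' 0 = u \<and>
     (\<forall>y<n. \<forall>l<d. rmem s ''X'' (y * d + l) = xs ! y $ l)"

definition rows :: "state \<Rightarrow> bool" where
  "rows s \<longleftrightarrow> inp s \<and> (\<forall>y\<le>n. imem s ''RN'' y = y * n \<and> imem s ''RD'' y = y * d)"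

definition mat :: "state \<Rightarrow> bool" where
  "mat s \<longleftrightarrow> rows s \<and> (\<forall>y<n. \<forall>z<n. rmem s ''D'' (y * n + z) = dst y z)"

lemma inp_frame:
  assumes "inp s" "frame p s s'" "iwrites p \<inter> {''n'', ''d'', ''k'', ''u''} = {}" "''X'' \<notin> rwrites p"
  shows "inp s'"
  using assms by (auto simp: inp_def frame_def)

lemma rows_frame:
  assumes "rows s" "frame p s s'" "iwrites p \<inter> {''n'', ''d'', ''k'', ''u'', ''RN'', ''RD''} = {}" "''X'' \<notin> rwrites p"
  shows "rows s'"
  using assms by (auto simp: rows_def inp_def frame_def)

lemma mat_frame:
  assumes "mat s" "frame p s s'" "iwrites p \<inter> {''n'', ''d'', ''k'', ''u'', ''RN'', ''RD''} = {}"
    "rwrites p \<inter> {''X'', ''D''} = {}"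
  shows "mat s'"
  using assms by (auto simp: mat_def rows_def inp_def frame_def)

lemma mat_D: "mat s \<Longrightarrow> x < n \<Longrightarrow> y < n \<Longrightarrow> rmem s ''D'' (imem s ''RN'' x + y) = dst x y"
  by (simp add: mat_def rows_def)

lemma mat_n: "mat s \<Longrightarrow> imem s ''n'' 0 = n"
  by (simp add: mat_def rows_def inp_def)

lemma Suc_n_le: "Suc n \<le> Z ^ 1"
  by (simp add: Z_def)

lemma Suc_d_le: "Suc d \<le> Z ^ 1"
  by (simp add: Z_def)

lemma n_pos: "0 < n"
  using k by linarith

lemma timed_rows:
  assumes s: "inp s" "imem s ''RN'' 0 = 0" "imem s ''RD'' 0 = 0"
  shows "timed 1 3 rows_prog s rows"
  unfolding rows_prog_def
proof (rule timed_For[where N = n and a = 1 and c = 1 and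
    I = "\<lambda>i s'. \<forall>y\<le>i. imem s' ''RN'' y = y * n \<and> imem s' ''RD'' y = y * d"], goal_cases)
  case (2 i s')
  have "inp s'" using inp_frame[OF s(1) 2(2)] by simp
  then show ?case using 2 by (intro timed_loopfree) (auto simp: inp_def le_Suc_eq)
next
  case (7 s')
  have "inp s'" using inp_frame[OF s(1) 7] by simp
  then show ?case by (simp add: inp_def)
next
  case (9 s')
  have "inp s'" using inp_frame[OF s(1) 9(2)] by simp
  then show ?case using 9 by (simp add: rows_def)
qed (use s Suc_n_le in auto)

lemma timed_entry:
  assumes s: "rows s" and y: "imem s ''y'' 0 = y" "y < n" and z: "imem s ''z'' 0 = z" "z < n"
  shows "timed 1 5 entry_prog s (\<lambda>s'. rmem s' ''a'' 0 = dst y z)"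
  unfolding entry_prog_def
proof (rule timed_Seq[where R = "\<lambda>s'. rmem s' ''a'' 0 = 0" and a = 1 and b = 3], goal_cases)
  case 1
  show ?case by (rule timed_loopfree) auto
next
  case (2 s1)
  have s1: "rows s1" "imem s1 ''y'' 0 = y" "imem s1 ''z'' 0 = z"
    using rows_frame[OF s 2(2)] 2(2) y z by (auto simp: frame_def)
  have carr: "xs ! y \<in> carrier_vec d" "xs ! z \<in> carrier_vec d" using xs y z nth_mem by blast+
  show ?case
  proof (rule timed_For[where N = d and a = 1 and c = 1 and
      I = "\<lambda>i s'. rmem s' ''a'' 0 = (\<Sum>l<i. (xs ! y $ l - xs ! z $ l)\<^sup>2)"], goal_cases)
    case (2 i s')
    have "rows s'" "imem s' ''y'' 0 = y" "imem s' ''z'' 0 = z"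
      using rows_frame[OF s1(1) 2(2)] 2(2) s1 by (auto simp: frame_def)
    then show ?case using 2 y z
      by (intro timed_loopfree) (auto simp: rows_def inp_def power2_eq_square)
  next
    case (7 s')
    have "rows s'" using rows_frame[OF s1(1) 7] by simp
    then show ?case by (simp add: rows_def inp_def)
  next
    case (9 s')
    then show ?case by (simp add: dst_def vdist_sq[OF carr])
  qed (use 2 Suc_d_le in auto)
qed simp

text \<open>Row-major addresses do not collide, so storing one entry preserves those already
  stored.\<close>

lemma index_eq_iff:
  fixes z z' :: nat
  assumes "z < b" "z' < b"
  shows "y * b + z = y' * b + z' \<longleftrightarrow> y = y' \<and> z = z'"
proof
  assume eq: "y * b + z = y' * b + z'"
  have "(y * b + z) div b = y" "(y' * b + z') div b = y'" using assms by auto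
  with eq show "y = y' \<and> z = z'" by auto
qed auto

lemma timed_matrix:
  assumes s: "rows s"
  shows "timed 1 11 matrix_prog s mat"
  unfolding matrix_prog_def
proof (rule timed_For[where N = n and a = 9 and c = 1 and
    I = "\<lambda>i s'. \<forall>y<i. \<forall>z<n. rmem s' ''D'' (y * n + z) = dst y z"], goal_cases)
  case (2 i s')
  have s': "rows s'" using rows_frame[OF s 2(2)] by simp
  show ?case
  proof (rule timed_For[where N = n and a = 7 and c = 1 and
      I = "\<lambda>j s'. (\<forall>y<i. \<forall>z<n. rmem s' ''D'' (y * n + z) = dst y z) \<and>
         (\<forall>z<j. rmem s' ''D'' (i * n + z) = dst i z)"], goal_cases)
    case (2 j s2)
    have s2: "rows s2" "imem s2 ''y'' 0 = i"
      using rows_frame[OF s' 2(2)] 2(2) \<open>imem s' ''y'' 0 = i\<close> by (auto simp: frame_def)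
    show ?case
    proof (rule timed_Seq[OF timed_entry[OF s2 \<open>i < n\<close> 2(3,1)], where b = 1], goal_cases)
      case (1 s3)
      have s3: "rows s3" "imem s3 ''y'' 0 = i" "imem s3 ''z'' 0 = j" "rmem s3 ''D'' = rmem s2 ''D''"
        using rows_frame[OF s2(1) 1(2)] 1(2) s2 2(3) by (auto simp: frame_def)
      have old: "y * n + z \<noteq> i * n + j" if "y < i" "z < n" for y z
        using index_eq_iff[of z n j y i] that 2(1) by auto
      show ?case
      proof (rule timed_loopfree[where e = 1], goal_cases)
        case 4
        have RN: "imem s3 ''RN'' i = i * n" using s3(1) \<open>i < n\<close> by (simp add: rows_def)
        show ?case using s3(2-4) 2(4) 1(1) old by (auto simp: RN less_Suc_eq)
      qed auto
    qed simp
  next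
    case (7 s2)
    have "rows s2" using rows_frame[OF s' 7] by simp
    then show ?case by (simp add: rows_def inp_def)
  next
    case (9 s2)
    then show ?case by (auto simp: less_Suc_eq)
  qed (use 2 Suc_n_le in auto)
next
  case (7 s')
  have "rows s'" using rows_frame[OF s 7] by simp
  then show ?case by (simp add: rows_def inp_def)
next
  case (9 s')
  have "rows s'" using rows_frame[OF s 9(2)] by simp
  then show ?case using 9 by (simp add: mat_def)
qed (use Suc_n_le in auto)

text \<open>\<open>L\<close> itself is not stored. The bound \<open>n \<le> 2 ^ L\<close> feeds the
  cost analysis, the bound \<open>2 ^ L \<le> 2 * n\<close> the running time.\<close>

lemma timed_size:
  assumes s: "mat s"
  shows "timed 1 4 size_prog s (\<lambda>s'. \<exists>L. n \<le> 2 ^ L \<and> 2 ^ L \<le> 2 * n \<and> imem s' ''m'' 0 = Suc (k + 3 * (k * L)))"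
  unfolding size_prog_def
proof (rule timed_Seq[where R = "\<lambda>s'. imem s' ''p'' 0 = 1 \<and> imem s' ''m'' 0 = Suc k" and a = 1 and b = 2], goal_cases)
  case 1
  show ?case using s by (intro timed_loopfree) (auto simp: mat_def rows_def inp_def)
next
  case (2 s1)
  have s1: "mat s1" using mat_frame[OF s 2(2)] by simp
  let ?b = "ILess (IVar ''p'') (IVar ''n'')"
  let ?p = "Seq (ISet ''p'' (IAdd (IVar ''p'') (IVar ''p'')))
            (ISet ''m'' (IAdd (IVar ''m'') (IAdd (IVar ''k'') (IAdd (IVar ''k'') (IVar ''k'')))))"
  let ?I = "\<lambda>i s'. imem s' ''p'' 0 = 2 ^ i \<and> 2 ^ i \<le> 2 * n \<and> imem s' ''m'' 0 = Suc (k + 3 * (k * i))"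
  have "ok (Loop ?b ?p) s1 (Suc n * (1 + bcost ?b + 30)) (\<lambda>s'. \<exists>i\<le>n. ?I i s' \<and> \<not> bval ?b s')"
  proof (rule ok_Loop)
    have "1 \<le> 2 * n" using n_pos by linarith
    then show "?I 0 s1" using 2(1) by simp
  next
    fix i s' assume f: "frame ?p s1 s'" and I: "?I i s'" and b: "bval ?b s'"
    have s': "mat s'" using mat_frame[OF s1 f] by simp
    have "2 ^ i < n" using I b mat_n[OF s'] by simp
    moreover have "i < 2 ^ i" by simp
    ultimately have "i < n" by linarith
    moreover have "ok ?p s' 30 (?I (Suc i))"
      using I s' \<open>2 ^ i < n\<close> by (intro ok_loopfree) (auto simp: mat_def rows_def inp_def)
    ultimately show "i < n \<and> ok ?p s' 30 (?I (Suc i))" by simp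
  qed
  then have "ok (Loop ?b ?p) s1 (1 * Z ^ 2) (\<lambda>s'. \<exists>i\<le>n. ?I i s' \<and> \<not> bval ?b s')"
  proof (rule ok_conseq)
    have "Suc n * (1 + bcost ?b + 30) \<le> Z * Z" by (intro mult_le_mono) (auto simp: Z_def)
    then show "Suc n * (1 + bcost ?b + 30) \<le> 1 * Z ^ 2" by (simp add: power2_eq_square)
  qed
  then have "timed 1 2 (Loop ?b ?p) s1 (\<lambda>s'. \<exists>i\<le>n. ?I i s' \<and> \<not> bval ?b s')" by (simp add: timed_def)
  then show ?case
  proof (rule timed_conseq)
    fix s' assume "\<exists>i\<le>n. ?I i s' \<and> \<not> bval ?b s'" "frame (Loop ?b ?p) s1 s'"
    moreover from this have "mat s'" using mat_frame[OF s1, of "Loop ?b ?p" s'] by simp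
    ultimately show "\<exists>L. n \<le> 2 ^ L \<and> 2 ^ L \<le> 2 * n \<and> imem s' ''m'' 0 = Suc (k + 3 * (k * L))"
      using mat_n by (auto simp: not_less)
  qed auto
qed simp

lemma timed_eval:
  assumes s: "mat s" and y: "imem s ''y'' 0 = y" "y < n"
  shows "timed 1 5 eval_prog s (\<lambda>s'. rmem s' ''a'' 0 = (\<Sum>x<n. min (rmem s ''N'' x) (dst x y)))"
  unfolding eval_prog_def
proof (rule timed_Seq[where R = "\<lambda>s'. rmem s' ''a'' 0 = 0" and a = 1 and b = 3], goal_cases)
  case 1
  show ?case by (rule timed_loopfree) auto
next
  case (2 s1)
  have s1: "mat s1" "imem s1 ''y'' 0 = y" "rmem s1 ''N'' = rmem s ''N''"
    using mat_frame[OF s 2(2)] 2(2) y by (auto simp: frame_def)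
  show ?case
  proof (rule timed_For[where N = n and a = 1 and c = 1 and
      I = "\<lambda>i s'. rmem s' ''a'' 0 = (\<Sum>x<i. min (rmem s ''N'' x) (dst x y))"], goal_cases)
    case (2 i s')
    have s': "mat s'" "imem s' ''y'' 0 = y" "rmem s' ''N'' = rmem s ''N''"
      using mat_frame[OF s1(1) 2(2)] 2(2) s1 by (auto simp: frame_def)
    then show ?case using 2 y mat_D[OF s'(1) 2(1) y(2)]
      by (intro timed_loopfree) auto
  next
    case (7 s')
    have "mat s'" using mat_frame[OF s1(1) 7] by simp
    then show ?case by (simp add: mat_n)
  qed (use 2 Suc_n_le in auto)
qed simp

lemma timed_pick:
  assumes s: "mat s"
  defines "F \<equiv> \<lambda>y. \<Sum>x<n. min (rmem s ''N'' x) (dst x y)"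
  shows "timed 1 9 pick_prog s (\<lambda>s'. imem s' ''r'' 0 < n \<and> (\<forall>y<n. F (imem s' ''r'' 0) \<le> F y))"
  unfolding pick_prog_def
proof (rule timed_For[where N = n and a = 7 and c = 1 and
    I = "\<lambda>i s'. 0 < i \<longrightarrow> imem s' ''r'' 0 < i \<and> rmem s' ''b'' 0 = F (imem s' ''r'' 0) \<and>
      (\<forall>y<i. F (imem s' ''r'' 0) \<le> F y)"], goal_cases)
  case (2 i s')
  have s': "mat s'" "rmem s' ''N'' = rmem s ''N''"
    using mat_frame[OF s 2(2)] 2(2) by (auto simp: frame_def)
  show ?case
  proof (rule timed_Seq[OF timed_eval[OF s'(1) 2(3) 2(1)], where b = 1], goal_cases)
    case (1 s2)
    then have s2: "rmem s2 ''a'' 0 = F i" "imem s2 ''y'' 0 = i" "imem s2 ''r'' = imem s' ''r''"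
      "rmem s2 ''b'' = rmem s' ''b''"
      using 2(3) s'(2) by (auto simp: F_def frame_def)
    show ?case
    proof (rule timed_loopfree[where e = 1], goal_cases)
      case 4
      show ?case
      proof (cases "0 < i \<and> \<not> F i < rmem s' ''b'' 0")
        case True
        then show ?thesis using 2(4) s2 by (auto simp: less_Suc_eq)
      next
        case False
        then show ?thesis using 2(4) s2 by (auto simp: less_Suc_eq)
      qed
    qed auto
  qed simp
next
  case (7 s')
  have "mat s'" using mat_frame[OF s 7] by simp
  then show ?case by (simp add: mat_n)
qed (use n_pos Suc_n_le in auto)

definition greedy_inv :: "nat \<Rightarrow> state \<Rightarrow> bool" where
  "greedy_inv t s \<longleftrightarrow> greedy n dst (imem s ''S'') t \<and> (\<forall>x<n. rmem s ''N'' x = near dst (imem s ''S'') t x)"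

lemma timed_update:
  assumes s: "mat s" and t: "imem s ''t'' 0 = t" and inv: "greedy_inv t s"
    and r: "imem s ''r'' 0 < n"
    and best: "\<forall>y<n. (\<Sum>x<n. min (rmem s ''N'' x) (dst x (imem s ''r'' 0))) \<le> (\<Sum>x<n. min (rmem s ''N'' x) (dst x y))"
  shows "timed 1 5 update_prog s (greedy_inv (Suc t))"
  unfolding update_prog_def
proof (rule timed_Seq[where R = "\<lambda>s'. s' = istore ''S'' (Suc t) (imem s ''r'' 0) s" and a = 1 and b = 3], goal_cases)
  case 1
  show ?case using t by (intro timed_loopfree) auto
next
  case (2 s1)
  let ?r = "imem s ''r'' 0" and ?S = "(imem s ''S'')(Suc t := imem s ''r'' 0)"
  have near: "near dst ?S j x = near dst (imem s ''S'') j x" if "j \<le> t" for j x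
    using that by (intro near_cong) auto
  have s1: "mat s1" using mat_frame[OF s 2(2)] by simp
  show ?case
  \<comment> \<open>During the pass the first \<open>i\<close> entries of \<open>N\<close> already
    account for the new point.\<close>
  proof (rule timed_For[where N = n and a = 1 and c = 1 and
      I = "\<lambda>i s'. \<forall>x<n. rmem s' ''N'' x = near dst ?S (if x < i then Suc t else t) x"], goal_cases)
    case 1
    then show ?case using inv near by (auto simp: greedy_inv_def 2(1))
  next
    case (2 i s')
    have s': "mat s'" "imem s' ''r'' 0 = ?r"
      using mat_frame[OF s1 2(2)] 2(2) \<open>s1 = _\<close> by (auto simp: frame_def)
    have N: "rmem s' ''N'' i = near dst ?S t i" using 2 by simp
    show ?case
    proof (rule timed_loopfree[where e = 1], goal_cases)
      case 4
      show ?case using 2(3,4) s'(2) mat_D[OF s'(1) 2(1) r] N by (auto simp: min_def less_Suc_eq)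
    qed auto
  next
    case (7 s')
    have "mat s'" using mat_frame[OF s1 7] by simp
    then show ?case by (simp add: mat_n)
  next
    case (9 s')
    have S: "imem s' ''S'' = ?S" using 9(2) \<open>s1 = _\<close> by (auto simp: frame_def)
    have Nt: "near dst (imem s ''S'') t x = rmem s ''N'' x" if "x < n" for x
      using inv that by (simp add: greedy_inv_def)
    have "greedy n dst ?S (Suc t)"
      unfolding greedy_def
    proof (intro conjI allI impI)
      fix j assume "j \<le> Suc t"
      then show "?S j < n" using inv r by (auto simp: greedy_inv_def greedy_def le_Suc_eq)
    next
      fix j y assume j: "j < Suc t" and y: "y < n"
      show "(\<Sum>x<n. near dst ?S (Suc j) x) \<le> (\<Sum>x<n. min (near dst ?S j x) (dst x y))"
      proof (cases "j = t")
        case True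
        have "(\<Sum>x<n. near dst ?S (Suc t) x) = (\<Sum>x<n. min (rmem s ''N'' x) (dst x ?r))"
          by (intro sum.cong) (auto simp: near Nt)
        also have "\<dots> \<le> (\<Sum>x<n. min (rmem s ''N'' x) (dst x y))" using best y by blast
        also have "\<dots> = (\<Sum>x<n. min (near dst ?S t x) (dst x y))"
          by (intro sum.cong) (auto simp: near Nt)
        finally show ?thesis using True by simp
      next
        case False
        then have "Suc j \<le> t" using j by simp
        then show ?thesis using inv y near[of "Suc j"] near[of j]
          by (simp add: greedy_inv_def greedy_def del: near.simps)
      qed
    qed
    then show ?case using 9(1) S by (simp add: greedy_inv_def del: near.simps)
  qed (use Suc_n_le in auto)
qed simp

lemma timed_greedy:
  assumes s: "mat s" "imem s ''S'' 0 = 0" "imem s ''m'' 0 = Suc m" "Suc m \<le> Z ^ 3"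
  shows "timed 1 23 greedy_prog s (\<lambda>s'. greedy n dst (imem s' ''S'') m)"
  unfolding greedy_prog_def
proof (rule timed_Seq[where R = "greedy_inv 0" and a = 3 and b = 19], goal_cases)
  case 1
  show ?case
  proof (rule timed_For[where N = n and a = 1 and c = 1 and
      I = "\<lambda>i s'. \<forall>x<i. rmem s' ''N'' x = dst x 0"], goal_cases)
    case (2 i s')
    have "mat s'" using mat_frame[OF s(1) 2(2)] by simp
    then show ?case using 2 mat_D[OF _ 2(1) n_pos] by (intro timed_loopfree) (auto simp: less_Suc_eq)
  next
    case (7 s')
    have "mat s'" using mat_frame[OF s(1) 7] by simp
    then show ?case by (simp add: mat_n)
  next
    case (9 s')
    have "imem s' ''S'' 0 = 0" using 9(2) s(2) by (simp add: frame_def)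
    then show ?case using 9 n_pos by (simp add: greedy_inv_def greedy_def)
  qed (use Suc_n_le in auto)
next
  case (2 s1)
  have s1: "mat s1" "imem s1 ''m'' 0 = Suc m"
    using mat_frame[OF s(1) 2(2)] 2(2) s(3) by (auto simp: frame_def)
  show ?case
  proof (rule timed_For[where N = m and a = 15 and c = 3 and I = greedy_inv], goal_cases)
    case 1
    then show ?case using 2(1) by (simp add: greedy_inv_def)
  next
    case (2 i s')
    have s': "mat s'" using mat_frame[OF s1(1) 2(2)] by simp
    show ?case
    proof (rule timed_Seq[OF timed_pick[OF s'], where b = 5], goal_cases)
      case (1 s2)
      have s2: "mat s2" "imem s2 ''t'' 0 = i" "greedy_inv i s2" "rmem s2 ''N'' = rmem s' ''N''"
        using mat_frame[OF s' 1(2)] 1(2) 2(3,4) by (auto simp: frame_def greedy_inv_def)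
      have "timed 1 5 update_prog s2 (greedy_inv (Suc i))"
        using 1(1) s2 by (intro timed_update) auto
      then show ?case by (rule timed_conseq) (auto simp: greedy_inv_def)
    qed simp
  next
    case (7 s')
    have "imem s' ''m'' 0 = Suc m" using 7 s1 by (simp add: frame_def)
    then show ?case by simp
  next
    case (9 s')
    then show ?case by (simp add: greedy_inv_def)
  qed (use s(4) in auto)
qed simp

end

section \<open>Optimal assignment to a given tuple of centres\<close>

text \<open>Two indirections: centre \<open>i\<close> of the current tuple is candidate number
  \<open>T[i]\<close>, which is the input point at position \<open>S[T[i]]\<close>.\<close>

definition Wt :: "iexp \<Rightarrow> iexp \<Rightarrow> rexp" where
  "Wt y i = RLoad ''D'' (IAdd (ILoad ''RN'' y) (ILoad ''S'' (ILoad ''T'' i)))"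

definition Gain :: "iexp \<Rightarrow> iexp \<Rightarrow> rexp" where
  "Gain y c = RSub (Wt y (ILoad ''G'' c)) (Wt y c)"

definition clear_prog :: com where
  "clear_prog = For ''i'' (IInc (IVar ''k''))
     (Seq (IStore ''s'' (IVar ''i'') (IConst 0)) (IStore ''c'' (IVar ''i'') (IConst 0)))"

abbreviation Ay :: iexp where "Ay \<equiv> ILoad ''A'' (IVar ''y'')"
abbreviation By :: iexp where "By \<equiv> ILoad ''B'' (IVar ''y'')"

text \<open>\<open>s[c]\<close> is one more than the point selected in class \<open>c\<close>, and \<open>0\<close> if there is none.\<close>

definition select_prog :: com where
  "select_prog = For ''y'' (IInc (IVar ''t''))
     (Cond (BAnd (ILess (IConst 0) (ILoad ''s'' Ay))
         (BNot (RLess (Gain (IVar ''y'') Ay) (Gain (ISub (ILoad ''s'' Ay) (IConst 1)) Ay))))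
       Skip (IStore ''s'' Ay (IInc (IVar ''y''))))"

text \<open>\<open>o\<close> records whether some class has ever exceeded its capacity; testing the
  class just increased suffices. Equality of naturals is expressed by two negated
  comparisons.\<close>

definition build_prog :: com where
  "build_prog = Seq (Seq (ISet ''o'' (IConst 0)) (RSet ''w'' (RConst 0)))
     (For ''y'' (IInc (IVar ''t''))
       (Seq (Cond (BAnd (BNot (ILess (ILoad ''s'' Ay) (IInc (IVar ''y'')))) (BNot (ILess (IInc (IVar ''y'')) (ILoad ''s'' Ay))))
              (IStore ''B'' (IVar ''y'') (ILoad ''G'' Ay)) (IStore ''B'' (IVar ''y'') Ay))
       (Seq (IStore ''c'' By (IInc (ILoad ''c'' By)))
       (Seq (Cond (ILess (IVar ''u'') (ILoad ''c'' By)) (ISet ''o'' (IConst 1)) Skip)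
            (RSet ''w'' (RAdd (RVar ''w'') (Wt (IVar ''y'') By)))))))"

text \<open>\<open>h\<close> tells whether \<open>E\<close> and \<open>v\<close> hold a candidate
  yet, in place of an infinite initial cost.\<close>

definition commit_prog :: com where
  "commit_prog = Cond (BAnd (ILess (IVar ''o'') (IConst 1))
       (BNot (BAnd (ILess (IConst 0) (IVar ''h'')) (BNot (RLess (RVar ''w'') (RVar ''v''))))))
     (Seq (Seq (ISet ''h'' (IConst 1)) (RSet ''v'' (RVar ''w'')))
        (For ''y'' (IInc (IVar ''t'')) (IStore ''E'' (IVar ''y'') By)))
     Skip"

definition move_prog :: com where
  "move_prog = Seq clear_prog (Seq select_prog (Seq build_prog commit_prog))"

text \<open>The new point enters as the sole member of an extra class \<open>k\<close>, so that its
  centre is the value of the enumerated map at \<open>k\<close>. This class has no centre of its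
  own: \<open>Gain\<close> reads some unrelated table entry for it, but with a single member there
  is nothing to compare.\<close>

definition insert_prog :: com where
  "insert_prog = Seq (Seq (IStore ''A'' (IVar ''t'') (IVar ''k'')) (ISet ''h'' (IConst 0)))
     (Seq (Enum ''G'' (IInc (IVar ''k'')) (IVar ''k'') move_prog)
        (For ''y'' (IInc (IVar ''t'')) (IStore ''A'' (IVar ''y'') (ILoad ''E'' (IVar ''y'')))))"

lemma rval_Wt [simp]: "rval (Wt y i) s =
    rmem s ''D'' (imem s ''RN'' (ival y s) + imem s ''S'' (imem s ''T'' (ival i s)))"
  and rcost_Wt [simp]: "rcost (Wt y i) = 5 + icost y + icost i"
  by (simp_all add: Wt_def)

lemma rval_Gain [simp]: "rval (Gain y c) s = rval (Wt y (ILoad ''G'' c)) s - rval (Wt y c) s"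
  and rcost_Gain [simp]: "rcost (Gain y c) = 12 + 2 * icost y + 2 * icost c"
  by (simp_all add: Gain_def)

lemma writes_clear [simp]: "iwrites clear_prog = {''i'', ''s'', ''c''}" "rwrites clear_prog = {}"
  by (auto simp: clear_prog_def)

lemma writes_select [simp]: "iwrites select_prog = {''y'', ''s''}" "rwrites select_prog = {}"
  by (auto simp: select_prog_def)

lemma writes_build [simp]: "iwrites build_prog = {''y'', ''o'', ''B'', ''c''}" "rwrites build_prog = {''w''}"
  by (auto simp: build_prog_def)

lemma writes_commit [simp]: "iwrites commit_prog = {''y'', ''h'', ''E''}" "rwrites commit_prog = {''v''}"
  by (auto simp: commit_prog_def)

lemma writes_move [simp]:
  "iwrites move_prog = {''i'', ''s'', ''c'', ''y'', ''o'', ''B'', ''h'', ''E''}" "rwrites move_prog = {''w'', ''v''}"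
  by (auto simp: move_prog_def)

lemma writes_insert [simp]:
  "iwrites insert_prog = {''i'', ''s'', ''c'', ''y'', ''o'', ''B'', ''h'', ''E'', ''A'', ''G'', ''j'', ''q''}"
  "rwrites insert_prog = {''w'', ''v''}"
  by (auto simp: insert_prog_def)

definition wt :: "state \<Rightarrow> nat \<Rightarrow> nat \<Rightarrow> real" where
  "wt s y i = rmem s ''D'' (imem s ''RN'' y + imem s ''S'' (imem s ''T'' i))"

lemma wt_frame:
  assumes "frame p s s'" "iwrites p \<inter> {''RN'', ''S'', ''T''} = {}" "''D'' \<notin> rwrites p"
  shows "wt s' = wt s"
  using assms by (auto simp: wt_def frame_def fun_eq_iff)

definition argmin_upto :: "(nat \<Rightarrow> nat) \<Rightarrow> (nat \<Rightarrow> nat \<Rightarrow> real) \<Rightarrow> nat \<Rightarrow> nat \<Rightarrow> nat \<Rightarrow> bool" where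
  "argmin_upto A g i c r \<longleftrightarrow> (r = 0 \<longrightarrow> (\<forall>y<i. A y \<noteq> c)) \<and>
     (0 < r \<longrightarrow> r - 1 < i \<and> A (r - 1) = c \<and> (\<forall>y<i. A y = c \<longrightarrow> g (r - 1) c \<le> g y c))"

lemma argmin_upto_Suc:
  assumes "argmin_upto A g i c r"
  shows "argmin_upto A g (Suc i) c (if A i = c \<and> \<not> (0 < r \<and> \<not> g i c < g (r - 1) c) then Suc i else r)"
proof (cases "r = 0")
  case True
  then show ?thesis using assms by (auto simp: argmin_upto_def less_Suc_eq)
next
  case False
  then have r: "r - 1 < i" "A (r - 1) = c" "\<And>y. y < i \<Longrightarrow> A y = c \<Longrightarrow> g (r - 1) c \<le> g y c"
    using assms by (auto simp: argmin_upto_def)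
  show ?thesis
  proof (cases "A i = c \<and> g i c < g (r - 1) c")
    case True
    then have "g i c \<le> g y c" if "y < Suc i" "A y = c" for y
      using r(3)[of y] that by (cases "y = i") auto
    then show ?thesis using True False by (auto simp: argmin_upto_def)
  next
    case F: False
    then have "g (r - 1) c \<le> g y c" if "y < Suc i" "A y = c" for y
      using r(3)[of y] that by (cases "y = i") auto
    then show ?thesis using F False r by (auto simp: argmin_upto_def)
  qed
qed

text \<open>Only the values of \<open>g\<close> on occupied classes matter; this lets the digits
  held in memory stand for \<open>g\<close>.\<close>

lemma class_move_cong:
  assumes "\<And>y. y < t \<Longrightarrow> g (A y) = g' (A y)" "class_move w t A g B"
  shows "class_move w t A g' B"
proof -
  obtain \<sigma> where 1: "\<forall>y<t. \<sigma> (A y) < t \<and> A (\<sigma> (A y)) = A y \<and>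
        w (\<sigma> (A y)) (g (A y)) - w (\<sigma> (A y)) (A y) \<le> w y (g (A y)) - w y (A y)"
     "\<forall>y<t. B y = (if \<sigma> (A y) = y then g (A y) else A y)"
    using assms(2) unfolding class_move_def by blast
  show ?thesis unfolding class_move_def by (rule exI[of _ \<sigma>]) (use 1 assms(1) in auto)
qed

lemma cap_feasible_cong:
  assumes "\<And>y. y < t \<Longrightarrow> A y = B y"
  shows "cap_feasible k u t A = cap_feasible k u t B"
proof -
  have "{y. y < t \<and> A y = i} = {y. y < t \<and> B y = i}" for i using assms by auto
  then show ?thesis using assms by (simp add: cap_feasible_def)
qed

lemma assign_cost_cong: "(\<And>y. y < t \<Longrightarrow> A y = B y) \<Longrightarrow> assign_cost w t A = assign_cost w t B"
  unfolding assign_cost_def by (intro sum.cong) auto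

text \<open>The overflow flag covers all classes up to \<open>k\<close>. The only member of class
  \<open>k\<close> is always selected and leaves it, so that class is empty in \<open>B\<close> and
  the check amounts to feasibility.\<close>

lemma class_move_feasible_iff:
  assumes move: "class_move w (Suc t) A g B" and A: "\<And>y. y < t \<Longrightarrow> A y < k" "A t = k"
    and g: "\<And>i. i \<le> k \<Longrightarrow> g i < k"
  shows "cap_feasible k u (Suc t) B \<longleftrightarrow> (\<forall>c\<le>k. card {y. y < Suc t \<and> B y = c} \<le> u)"
proof -
  obtain \<sigma> where \<sigma>: "\<And>y. y \<le> t \<Longrightarrow> \<sigma> (A y) \<le> t \<and> A (\<sigma> (A y)) = A y"
    and B: "\<And>y. y \<le> t \<Longrightarrow> B y = (if \<sigma> (A y) = y then g (A y) else A y)"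
    using move by (auto simp: class_move_def less_Suc_eq_le)
  have "\<sigma> k = t" using \<sigma>[of t] A(1)[of "\<sigma> k"] A(2) by force
  then have Bk: "B y < k" if "y < Suc t" for y
    using B[of y] that g A(1)[of y] A(2) by (cases "y = t") auto
  then have "{y. y < Suc t \<and> B y = k} = {}" by auto
  then have "card {y. y < Suc t \<and> B y = k} \<le> u" by (simp only: card.empty zero_le)
  then show ?thesis using Bk unfolding cap_feasible_def by (metis le_neq_implies_less less_imp_le)
qed

text \<open>Blocks of \<open>u\<close> consecutive indices. Existence guarantees that the search
  over maps finds something to store.\<close>

lemma cap_feasible_exists:
  assumes "0 < u" "t \<le> k * u"
  shows "\<exists>A. cap_feasible k u t A"
proof -
  have "card {y. y < t \<and> y div u = i} \<le> u" for i
  proof -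
    have "{y. y < t \<and> y div u = i} \<subseteq> {i * u..<i * u + u}"
    proof
      fix y assume "y \<in> {y. y < t \<and> y div u = i}"
      then have "y = i * u + y mod u" by (metis (mono_tags) div_mult_mod_eq mem_Collect_eq)
      moreover have "y mod u < u" using assms(1) by simp
      ultimately show "y \<in> {i * u..<i * u + u}" unfolding atLeastLessThan_iff by linarith
    qed
    from card_mono[OF _ this] show ?thesis by simp
  qed
  then have "cap_feasible k u t (\<lambda>y. y div u)"
    using assms by (auto simp: cap_feasible_def less_mult_imp_div_less)
  then show ?thesis by blast
qed

section \<open>Correctness and running time of inserting one point\<close>

context hckm_instance
begin

lemma timed_clear:
  assumes s: "imem s ''k'' 0 = k"
  shows "timed 1 3 clear_prog s (\<lambda>s'. \<forall>i\<le>k. imem s' ''s'' i = 0 \<and> imem s' ''c'' i = 0)"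
  unfolding clear_prog_def
proof (rule timed_For[where N = "Suc k" and a = 1 and c = 1 and
    I = "\<lambda>i s'. \<forall>c<i. imem s' ''s'' c = 0 \<and> imem s' ''c'' c = 0"], goal_cases)
  case (2 i s')
  then show ?case by (intro timed_loopfree) (auto simp: less_Suc_eq)
next
  case (7 s')
  then show ?case using s by (simp add: frame_def)
qed (use k in \<open>auto simp: Z_def\<close>)

context
  fixes s0 :: state and t :: nat
  assumes s0: "imem s0 ''t'' 0 = t" "t < n" "imem s0 ''u'' 0 = u"
    and A0: "\<And>y. y \<le> t \<Longrightarrow> imem s0 ''A'' y \<le> k" and G0: "\<And>i. i \<le> k \<Longrightarrow> imem s0 ''G'' i \<le> k"
begin

abbreviation "A \<equiv> imem s0 ''A''"
abbreviation "G \<equiv> imem s0 ''G''"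
abbreviation "w \<equiv> wt s0"

definition gain :: "nat \<Rightarrow> nat \<Rightarrow> real" where
  "gain y c = w y (G c) - w y c"

text \<open>\<open>A\<close>, \<open>G\<close> and the weights are frozen at the state in which a
  move starts, so that all stages of the move speak about the same functions.\<close>

definition same :: "state \<Rightarrow> bool" where
  "same s \<longleftrightarrow> imem s ''t'' 0 = t \<and> imem s ''u'' 0 = u \<and> imem s ''A'' = A \<and> imem s ''G'' = G \<and> wt s = w"

lemma same_frame:
  assumes "same s" "frame p s s'" "iwrites p \<inter> {''t'', ''u'', ''A'', ''G'', ''RN'', ''S'', ''T''} = {}" "''D'' \<notin> rwrites p"
  shows "same s'"
  using assms wt_frame[OF assms(2)] by (auto simp: same_def frame_def)

lemma Suc_t_le: "Suc (Suc t) \<le> Z ^ 1"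
  using s0(2) by (simp add: Z_def)

lemma timed_select:
  assumes s: "same s" and zero: "\<forall>i\<le>k. imem s ''s'' i = 0"
  shows "timed 1 3 select_prog s (\<lambda>s'. \<forall>c\<le>k. argmin_upto A gain (Suc t) c (imem s' ''s'' c))"
  unfolding select_prog_def
proof (rule timed_For[where N = "Suc t" and a = 1 and c = 1 and
    I = "\<lambda>i s'. \<forall>c\<le>k. argmin_upto A gain i c (imem s' ''s'' c)"], goal_cases)
  case 1
  then show ?case using zero by (simp add: argmin_upto_def)
next
  case (2 i s')
  have s': "same s'" using same_frame[OF s 2(2)] by simp
  have Ai: "A i \<le> k" using A0 2(1) by simp
  have W: "rmem s' ''D'' (imem s' ''RN'' y + imem s' ''S'' (imem s' ''T'' c)) = w y c" for y c
    using s' by (auto simp: same_def wt_def fun_eq_iff)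
  let ?p = "Cond (BAnd (ILess (IConst 0) (ILoad ''s'' Ay))
         (BNot (RLess (Gain (IVar ''y'') Ay) (Gain (ISub (ILoad ''s'' Ay) (IConst 1)) Ay))))
       Skip (IStore ''s'' Ay (IInc (IVar ''y'')))"
  show ?case
  proof (rule timed_loopfree, goal_cases)
    case 4
    have "argmin_upto A gain (Suc i) c (if A i = c \<and> \<not> (0 < imem s' ''s'' c \<and>
        \<not> gain i c < gain (imem s' ''s'' c - 1) c) then Suc i else imem s' ''s'' c)" if "c \<le> k" for c
      using argmin_upto_Suc 2(4) that by blast
    moreover have "imem (istore ''y'' 0 (Suc i) (exec ?p s')) ''s'' c = (if A i = c \<and> \<not> (0 < imem s' ''s'' c \<and>
        \<not> gain i c < gain (imem s' ''s'' c - 1) c) then Suc i else imem s' ''s'' c)" for c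
      using s' 2(3) by (auto simp: same_def W gain_def)
    ultimately show ?case by simp
  qed auto
next
  case (7 s')
  have "same s'" using same_frame[OF s 7] by simp
  then show ?case by (simp add: same_def)
qed (use Suc_t_le in auto)

lemma timed_build:
  assumes s: "same s" and zero: "\<forall>i\<le>k. imem s ''c'' i = 0"
  defines "B \<equiv> \<lambda>y. if imem s ''s'' (A y) = Suc y then G (A y) else A y"
  shows "timed 1 5 build_prog s (\<lambda>s'. (\<forall>y\<le>t. imem s' ''B'' y = B y) \<and>
    (imem s' ''o'' 0 = 0 \<longleftrightarrow> (\<forall>c\<le>k. card {y. y < Suc t \<and> B y = c} \<le> u)) \<and>
    rmem s' ''w'' 0 = assign_cost w (Suc t) B)"
  unfolding build_prog_def
proof (rule timed_Seq[where R = "\<lambda>s'. imem s' ''o'' 0 = 0 \<and> rmem s' ''w'' 0 = 0" and a = 1 and b = 3], goal_cases)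
  case 1
  show ?case by (rule timed_loopfree) auto
next
  case (2 s1)
  have s1: "same s1" "imem s1 ''s'' = imem s ''s''" "imem s1 ''c'' = imem s ''c''"
    using same_frame[OF s 2(2)] 2(2) by (auto simp: frame_def)
  have Bk: "B y \<le> k" if "y \<le> t" for y using that A0 G0 by (auto simp: B_def)
  have card_Suc: "card {y. y < Suc i \<and> B y = c} = card {y. y < i \<and> B y = c} + (if B i = c then 1 else 0)" for i c
  proof -
    have "{y. y < Suc i \<and> B y = c} = (if B i = c then insert i {y. y < i \<and> B y = c} else {y. y < i \<and> B y = c})"
      by (auto simp: less_Suc_eq)
    then show ?thesis by simp
  qed
  show ?case
  proof (rule timed_For[where N = "Suc t" and a = 1 and c = 1 and
      I = "\<lambda>i s'. (\<forall>y<i. imem s' ''B'' y = B y) \<and>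
        (\<forall>c\<le>k. imem s' ''c'' c = card {y. y < i \<and> B y = c}) \<and>
        (imem s' ''o'' 0 = 0 \<longleftrightarrow> (\<forall>c\<le>k. card {y. y < i \<and> B y = c} \<le> u)) \<and>
        rmem s' ''w'' 0 = assign_cost w i B"], goal_cases)
    case 1
    then show ?case using 2(1) zero s1(3) by (simp add: assign_cost_def)
  next
    case (2 i s')
    have s': "same s'" "imem s' ''s'' = imem s ''s''"
      using same_frame[OF s1(1) 2(2)] s1(2) 2(2) by (auto simp: frame_def)
    have W: "rmem s' ''D'' (imem s' ''RN'' y + imem s' ''S'' (imem s' ''T'' c)) = w y c" for y c
      using s' by (auto simp: same_def wt_def fun_eq_iff)
    note inv = 2(3,4)
    have i: "i \<le> t" using 2(1) by simp
    \<comment> \<open>Passing to \<open>Suc i\<close> changes only the count of class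
      \<open>B i\<close>, so one test keeps the flag exact.\<close>
    have viol: "(\<forall>c\<le>k. card {y. y < Suc i \<and> B y = c} \<le> u) \<longleftrightarrow>
        (\<forall>c\<le>k. card {y. y < i \<and> B y = c} \<le> u) \<and> Suc (card {y. y < i \<and> B y = B i}) \<le> u"
    proof
      assume L: "\<forall>c\<le>k. card {y. y < Suc i \<and> B y = c} \<le> u"
      have "card {y. y < i \<and> B y = c} \<le> u" if "c \<le> k" for c
        using L[rule_format, OF that] unfolding card_Suc by linarith
      moreover have "Suc (card {y. y < i \<and> B y = B i}) \<le> u"
        using L[rule_format, OF Bk[OF i]] unfolding card_Suc by simp
      ultimately show "(\<forall>c\<le>k. card {y. y < i \<and> B y = c} \<le> u) \<and> Suc (card {y. y < i \<and> B y = B i}) \<le> u"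
        by blast
    next
      assume R: "(\<forall>c\<le>k. card {y. y < i \<and> B y = c} \<le> u) \<and> Suc (card {y. y < i \<and> B y = B i}) \<le> u"
      show "\<forall>c\<le>k. card {y. y < Suc i \<and> B y = c} \<le> u"
      proof (intro allI impI)
        fix c assume "c \<le> k"
        then show "card {y. y < Suc i \<and> B y = c} \<le> u"
          using R unfolding card_Suc by (cases "B i = c") auto
      qed
    qed
    show ?case
    proof (rule timed_loopfree, goal_cases)
      case 4
      have Bi: "(if imem s ''s'' (A i) = Suc i then G (A i) else A i) = B i" by (simp add: B_def)
      have eq: "\<not> imem s ''s'' (A i) < Suc i \<and> \<not> Suc i < imem s ''s'' (A i) \<longleftrightarrow> imem s ''s'' (A i) = Suc i" by auto
      let ?p = "Cond (BAnd (BNot (ILess (ILoad ''s'' Ay) (IInc (IVar ''y'')))) (BNot (ILess (IInc (IVar ''y'')) (ILoad ''s'' Ay))))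
              (IStore ''B'' (IVar ''y'') (ILoad ''G'' Ay)) (IStore ''B'' (IVar ''y'') Ay)"
      have ex: "exec ?p s' = istore ''B'' i (B i) s'"
        using s' 2(3) eq Bi by (auto simp: same_def)
      have cB: "imem s' ''c'' (B i) = card {y. y < i \<and> B y = B i}" using 2(4) Bk[OF i] by blast
      show ?case
        unfolding exec.simps(4) ex viol
      proof (intro conjI, goal_cases)
        case 1
        show ?case using inv by (auto simp: less_Suc_eq)
      next
        case 2
        show ?case using inv by (auto simp: card_Suc)
      next
        case 3
        show ?case using inv s' by (auto simp: cB same_def)
      next
        case 4
        show ?case using inv s' by (simp add: W assign_cost_def)
      qed
    qed auto
  next
    case (7 s')
    have "same s'" using same_frame[OF s1(1) 7] by simp
    then show ?case by (simp add: same_def)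
  next
    case (9 s')
    then show ?case by (auto simp: less_Suc_eq_le)
  qed (use Suc_t_le in auto)
qed simp

lemma timed_commit:
  assumes s: "same s"
  shows "timed 1 7 commit_prog s (\<lambda>s'. if imem s ''o'' 0 = 0 \<and> \<not> (0 < imem s ''h'' 0 \<and> rmem s ''v'' 0 \<le> rmem s ''w'' 0)
    then imem s' ''h'' 0 = 1 \<and> rmem s' ''v'' 0 = rmem s ''w'' 0 \<and> (\<forall>y\<le>t. imem s' ''E'' y = imem s ''B'' y)
    else imem s' ''h'' 0 = imem s ''h'' 0 \<and> rmem s' ''v'' 0 = rmem s ''v'' 0 \<and> imem s' ''E'' = imem s ''E'')"
  (is "timed _ _ _ _ ?Q")
  unfolding commit_prog_def
proof (rule timed_Cond[where a = 5 and c = 0], goal_cases)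
  case 2
  show ?case
  proof (rule timed_Seq[where R = "\<lambda>s'. imem s' ''h'' 0 = 1 \<and> rmem s' ''v'' 0 = rmem s ''w'' 0" and a = 1 and b = 3], goal_cases)
    case 1
    show ?case by (rule timed_loopfree) auto
  next
    case (2 s1)
    have s1: "same s1" "imem s1 ''B'' = imem s ''B''"
      using same_frame[OF s 2(2)] 2(2) by (auto simp: frame_def)
    show ?case
    proof (rule timed_For[where N = "Suc t" and a = 1 and c = 1 and
        I = "\<lambda>i s'. \<forall>y<i. imem s' ''E'' y = imem s ''B'' y"], goal_cases)
      case (2 i s')
      have "imem s' ''B'' = imem s ''B''" using 2(2) s1(2) by (simp add: frame_def)
      then show ?case using 2 by (intro timed_loopfree) (auto simp: less_Suc_eq)
    next
      case (7 s')
      have "same s'" using same_frame[OF s1(1) 7] by simp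
      then show ?case by (simp add: same_def)
    next
      case (9 s')
      have "imem s' ''h'' 0 = 1" "rmem s' ''v'' 0 = rmem s ''w'' 0" using 9(2) 2(1) by (auto simp: frame_def)
      then show ?case using 9(1) \<open>bval _ s\<close> by (auto simp: less_Suc_eq_le)
    qed (use Suc_t_le in auto)
  qed simp
next
  case 3
  then have "?Q s" by auto
  then have "ok Skip s (1 * Z ^ 0) ?Q" by (intro ok_loopfree) (auto simp only: exec.simps loopfree.simps steps.simps power_0 mult_1)
  then show ?case by (simp only: timed_def zero_less_one simp_thms)
qed auto

lemma timed_move:
  assumes s: "imem s0 ''k'' 0 = k"
  shows "timed 1 21 move_prog s0 (\<lambda>s'. \<exists>B. class_move w (Suc t) A G B \<and>
    (if (\<forall>c\<le>k. card {y. y < Suc t \<and> B y = c} \<le> u) \<and>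
        \<not> (0 < imem s0 ''h'' 0 \<and> rmem s0 ''v'' 0 \<le> assign_cost w (Suc t) B)
     then imem s' ''h'' 0 = 1 \<and> rmem s' ''v'' 0 = assign_cost w (Suc t) B \<and> (\<forall>y\<le>t. imem s' ''E'' y = B y)
     else imem s' ''h'' 0 = imem s0 ''h'' 0 \<and> rmem s' ''v'' 0 = rmem s0 ''v'' 0 \<and> imem s' ''E'' = imem s0 ''E''))"
  unfolding move_prog_def
proof (rule timed_Seq[OF timed_clear[OF s], where b = 17], goal_cases)
  case (1 s1)
  have same0: "same s0" using s0 by (simp add: same_def)
  have s1: "same s1" "imem s1 ''h'' = imem s0 ''h''" "imem s1 ''E'' = imem s0 ''E''" "rmem s1 ''v'' = rmem s0 ''v''"
    using same_frame[OF same0 1(2)] 1(2) by (auto simp: frame_def)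
  have z1: "\<forall>i\<le>k. imem s1 ''s'' i = 0" "\<forall>i\<le>k. imem s1 ''c'' i = 0" using 1(1) by auto
  show ?case
  proof (rule timed_Seq[OF timed_select[OF s1(1) z1(1)], where b = 13], goal_cases)
    case (1 s2)
    have s2: "same s2" "imem s2 ''h'' = imem s0 ''h''" "imem s2 ''E'' = imem s0 ''E''" "rmem s2 ''v'' = rmem s0 ''v''"
      "imem s2 ''c'' = imem s1 ''c''"
      using same_frame[OF s1(1) 1(2)] 1(2) s1 by (auto simp: frame_def)
    define B where "B = (\<lambda>y. if imem s2 ''s'' (A y) = Suc y then G (A y) else A y)"
    have move: "class_move w (Suc t) A G B"
      unfolding class_move_def
    \<comment> \<open>Every class that contains a point has a positive entry in \<open>s\<close>, so
      the shift by one recovers its selected point.\<close>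
    proof (intro exI[of _ "\<lambda>c. imem s2 ''s'' c - 1"] conjI allI impI)
      fix y assume y: "y < Suc t"
      then have am: "argmin_upto A gain (Suc t) (A y) (imem s2 ''s'' (A y))" using 1(1) A0 by simp
      then have pos: "0 < imem s2 ''s'' (A y)" using y by (auto simp: argmin_upto_def)
      show "imem s2 ''s'' (A y) - 1 < Suc t" "A (imem s2 ''s'' (A y) - 1) = A y"
        "w (imem s2 ''s'' (A y) - 1) (G (A y)) - w (imem s2 ''s'' (A y) - 1) (A y) \<le> w y (G (A y)) - w y (A y)"
        using am pos y unfolding argmin_upto_def gain_def by blast+
      show "B y = (if imem s2 ''s'' (A y) - 1 = y then G (A y) else A y)" using pos by (auto simp: B_def)
    qed
    have z2: "\<forall>i\<le>k. imem s2 ''c'' i = 0" using z1(2) s2(5) by simp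
    show ?case
    proof (rule timed_Seq[OF timed_build[OF s2(1) z2], where b = 7], goal_cases)
      case (1 s3)
      have s3: "same s3" "imem s3 ''h'' = imem s0 ''h''" "imem s3 ''E'' = imem s0 ''E''" "rmem s3 ''v'' = rmem s0 ''v''"
        using same_frame[OF s2(1) 1(2)] 1(2) s2 by (auto simp: frame_def)
      have b3: "\<forall>y\<le>t. imem s3 ''B'' y = B y"
        "imem s3 ''o'' 0 = 0 \<longleftrightarrow> (\<forall>c\<le>k. card {y. y < Suc t \<and> B y = c} \<le> u)"
        "rmem s3 ''w'' 0 = assign_cost w (Suc t) B"
        using 1(1) unfolding B_def by auto
      show ?case
      proof (rule timed_conseq[OF timed_commit[OF s3(1)]], goal_cases)
        case (3 s4)
        show ?case
          using 3(1) b3 unfolding s3(2-4) b3(2,3) by (intro exI[of _ B] conjI move) (auto split: if_splits)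
      qed auto
    qed simp
  qed simp
qed simp

end

lemma timed_insert:
  assumes s: "inp s" and t: "imem s ''t'' 0 = t" "t < n" and u: "0 < u" "n \<le> k * u"
    and opt: "cap_optimal (wt s) k u t (imem s ''A'')" and G: "\<forall>j<Suc k. imem s ''G'' j = 0"
  shows "timed (k ^ Suc k) 35 insert_prog s (\<lambda>s'. cap_optimal (wt s) k u (Suc t) (imem s' ''A'') \<and>
    rmem s' ''v'' 0 = assign_cost (wt s) (Suc t) (imem s' ''A'') \<and> (\<forall>j<Suc k. imem s' ''G'' j = 0))"
  unfolding insert_prog_def
proof (rule timed_Seq[where R = "\<lambda>s'. imem s' ''A'' = (imem s ''A'')(t := k) \<and> imem s' ''h'' 0 = 0"
      and a = 1 and b = 33], goal_cases)
  case 1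
  have K: "1 \<le> k ^ Suc k" using k by simp
  have "timed 1 1 (Seq (IStore ''A'' (IVar ''t'') (IVar ''k'')) (ISet ''h'' (IConst 0))) s
      (\<lambda>s'. imem s' ''A'' = (imem s ''A'')(t := k) \<and> imem s' ''h'' 0 = 0)"
    using s t by (intro timed_loopfree) (auto simp: inp_def)
  then show ?case by (rule timed_conseq) (use K in auto)
next
  case (2 s1)
  define w where "w = wt s"
  define A where "A = (imem s ''A'')(t := k)"
  let ?E = "Enum ''G'' (IInc (IVar ''k'')) (IVar ''k'') move_prog"
  have s1: "inp s1" "imem s1 ''t'' 0 = t" "wt s1 = w" "imem s1 ''A'' = A" "\<forall>j<Suc k. imem s1 ''G'' j = 0"
    "imem s1 ''h'' 0 = 0"
    using inp_frame[OF s 2(2)] wt_frame[OF 2(2)] 2 t G by (auto simp: frame_def w_def A_def)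
  have At: "A t = k" by (simp add: A_def)
  have Alt: "A y < k" if "y < t" for y
    using opt that by (auto simp: A_def cap_optimal_def cap_feasible_def)
  have Ale: "A y \<le> k" if "y \<le> t" for y using Alt[of y] At that by (cases "y = t") auto
  have optA: "cap_optimal w k u t A"
  proof -
    have "cap_feasible k u t A = cap_feasible k u t (imem s ''A'')" by (intro cap_feasible_cong) (simp add: A_def)
    moreover have "assign_cost w t A = assign_cost w t (imem s ''A'')" by (intro assign_cost_cong) (simp add: A_def)
    ultimately show ?thesis using opt by (simp add: cap_optimal_def w_def)
  qed
  \<comment> \<open>Besides the feasible record in \<open>E\<close>, every map tried so far has a
    class move that the record matches or beats if that move is feasible. One move per map suffices,
    because \<open>class_move_optimal\<close> holds for every way of breaking ties.\<close>
  define I where "I N s' \<longleftrightarrow> (0 < imem s' ''h'' 0 \<longrightarrow> cap_feasible k u (Suc t) (imem s' ''E'') \<and>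
      rmem s' ''v'' 0 = assign_cost w (Suc t) (imem s' ''E'')) \<and>
    (\<forall>M<N. \<exists>B. class_move w (Suc t) A (digit k M) B \<and>
      (cap_feasible k u (Suc t) B \<longrightarrow> 0 < imem s' ''h'' 0 \<and> rmem s' ''v'' 0 \<le> assign_cost w (Suc t) B))" for N and s' :: state
  have "timed (k ^ Suc k * 1) 29 ?E s1 (\<lambda>s'. I (k ^ Suc k) s' \<and> (\<forall>j<Suc k. imem s' ''G'' j = 0))"
  proof (rule timed_Enum[where I = I and e = 21], goal_cases)
    case (9 s')
    then show ?case using s1(1) by (simp add: frame_def inp_def)
  next
    case (10 s')
    then show ?case using s1(1) by (simp add: frame_def inp_def)
  next
    case 12
    show ?case using s1(6) by (simp add: I_def)
  next
    case (13 N s')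
    have s': "inp s'" "imem s' ''t'' 0 = t" "wt s' = w" "imem s' ''A'' = A"
      using inp_frame[OF s1(1) 13(2)] wt_frame[OF 13(2)] 13(2) s1 by (auto simp: frame_def)
    have G: "imem s' ''G'' i = digit k N i" if "i \<le> k" for i using 13(3) that by simp
    have dk: "digit k N i < k" for i using k by (simp add: digit_less)
    have "timed 1 21 move_prog s' (\<lambda>s''. \<exists>B. class_move (wt s') (Suc t) (imem s' ''A'') (imem s' ''G'') B \<and>
      (if (\<forall>c\<le>k. card {y. y < Suc t \<and> B y = c} \<le> u) \<and>
          \<not> (0 < imem s' ''h'' 0 \<and> rmem s' ''v'' 0 \<le> assign_cost (wt s') (Suc t) B)
       then imem s'' ''h'' 0 = 1 \<and> rmem s'' ''v'' 0 = assign_cost (wt s') (Suc t) B \<and> (\<forall>y\<le>t. imem s'' ''E'' y = B y)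
       else imem s'' ''h'' 0 = imem s' ''h'' 0 \<and> rmem s'' ''v'' 0 = rmem s' ''v'' 0 \<and> imem s'' ''E'' = imem s' ''E''))"
      using s' t(2) Ale G dk by (intro timed_move) (auto simp: inp_def less_imp_le)
    then show ?case
    proof (rule timed_conseq, goal_cases)
      case (3 s'')
      then obtain B where B: "class_move w (Suc t) A (imem s' ''G'') B"
        and upd: "if (\<forall>c\<le>k. card {y. y < Suc t \<and> B y = c} \<le> u) \<and>
          \<not> (0 < imem s' ''h'' 0 \<and> rmem s' ''v'' 0 \<le> assign_cost w (Suc t) B)
       then imem s'' ''h'' 0 = 1 \<and> rmem s'' ''v'' 0 = assign_cost w (Suc t) B \<and> (\<forall>y\<le>t. imem s'' ''E'' y = B y)
       else imem s'' ''h'' 0 = imem s' ''h'' 0 \<and> rmem s'' ''v'' 0 = rmem s' ''v'' 0 \<and> imem s'' ''E'' = imem s' ''E''"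
        unfolding s'(3,4) by blast
      have Bd: "class_move w (Suc t) A (digit k N) B"
        by (rule class_move_cong[OF _ B]) (use G Ale in auto)
      have fe: "cap_feasible k u (Suc t) B \<longleftrightarrow> (\<forall>c\<le>k. card {y. y < Suc t \<and> B y = c} \<le> u)"
        using dk by (intro class_move_feasible_iff[OF Bd Alt At])
      show ?case
      proof (cases "cap_feasible k u (Suc t) B \<and> \<not> (0 < imem s' ''h'' 0 \<and> rmem s' ''v'' 0 \<le> assign_cost w (Suc t) B)")
        case True
        then have new: "imem s'' ''h'' 0 = 1" "rmem s'' ''v'' 0 = assign_cost w (Suc t) B" "\<forall>y\<le>t. imem s'' ''E'' y = B y"
          using upd fe by auto
        have "cap_feasible k u (Suc t) (imem s'' ''E'')" "assign_cost w (Suc t) (imem s'' ''E'') = assign_cost w (Suc t) B"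
          using True new(3) cap_feasible_cong[of "Suc t" "imem s'' ''E''" B k u] assign_cost_cong[of "Suc t" "imem s'' ''E''" B w]
          by auto
        moreover have "\<exists>B'. class_move w (Suc t) A (digit k M) B' \<and>
            (cap_feasible k u (Suc t) B' \<longrightarrow> 0 < imem s'' ''h'' 0 \<and> rmem s'' ''v'' 0 \<le> assign_cost w (Suc t) B')"
          if M: "M < Suc N" for M
        proof (cases "M = N")
          case True
          then show ?thesis using Bd new by auto
        next
          case False
          then obtain B' where B': "class_move w (Suc t) A (digit k M) B'"
            "cap_feasible k u (Suc t) B' \<longrightarrow> 0 < imem s' ''h'' 0 \<and> rmem s' ''v'' 0 \<le> assign_cost w (Suc t) B'"
            using 13(4) M unfolding I_def by (metis less_SucE)
          then show ?thesis using new True by (intro exI[of _ B']) auto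
        qed
        ultimately show ?thesis unfolding I_def using new by simp
      next
        case False
        then have old: "imem s'' ''h'' 0 = imem s' ''h'' 0" "rmem s'' ''v'' 0 = rmem s' ''v'' 0" "imem s'' ''E'' = imem s' ''E''"
          using upd fe by (auto split: if_splits)
        show ?thesis unfolding I_def old
          using 13(4) False Bd unfolding I_def by (metis less_SucE)
      qed
    qed auto
  next
    case (14 N s1 s2)
    then show ?case by (simp add: I_def frame_def)
  next
    case (16 s')
    then show ?case by simp
  qed (use s1(5) k in \<open>auto simp: Z_def\<close>)
  then have E: "timed (k ^ Suc k) 29 ?E s1 (\<lambda>s'. I (k ^ Suc k) s' \<and> (\<forall>j<Suc k. imem s' ''G'' j = 0))" by simp
  show ?case
  proof (rule timed_Seq[OF E, where b = 3], goal_cases)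
    case (1 s2)
    \<comment> \<open>The augmenting map for \<open>A'\<close> occurs among the digit sequences, up
      to arguments beyond \<open>k\<close>. Its move is feasible and costs at most as much as
      \<open>A'\<close>, so the record does too.\<close>
    have le: "0 < imem s2 ''h'' 0 \<and> rmem s2 ''v'' 0 \<le> assign_cost w (Suc t) A'" if A': "cap_feasible k u (Suc t) A'" for A'
    proof -
      obtain g where g: "\<forall>i\<le>k. g i < k" "\<And>B. class_move w (Suc t) A g B \<Longrightarrow>
          cap_feasible k u (Suc t) B \<and> assign_cost w (Suc t) B \<le> assign_cost w (Suc t) A'"
        using class_move_optimal[OF optA At A'] by blast
      then obtain M where M: "M < k ^ Suc k" "\<forall>j<Suc k. digit k M j = g j"
        using digit_surj[of "Suc k" g k] by auto
      then obtain B where B: "class_move w (Suc t) A (digit k M) B"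
        "cap_feasible k u (Suc t) B \<longrightarrow> 0 < imem s2 ''h'' 0 \<and> rmem s2 ''v'' 0 \<le> assign_cost w (Suc t) B"
        using 1(1) unfolding I_def by blast
      have "class_move w (Suc t) A g B"
        by (rule class_move_cong[OF _ B(1)]) (use M(2) Ale in \<open>auto simp: less_Suc_eq_le\<close>)
      from g(2)[OF this] B(2) show ?thesis by linarith
    qed
    have "\<exists>A'. cap_feasible k u (Suc t) A'" using u t(2) by (intro cap_feasible_exists) auto
    then have h: "0 < imem s2 ''h'' 0" using le by blast
    then have E2: "cap_feasible k u (Suc t) (imem s2 ''E'')" "rmem s2 ''v'' 0 = assign_cost w (Suc t) (imem s2 ''E'')"
      using 1(1) by (auto simp: I_def)
    have s2: "imem s2 ''t'' 0 = t" using 1(2) s1(2) by (simp add: frame_def)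
    have "timed 1 3 (For ''y'' (IInc (IVar ''t'')) (IStore ''A'' (IVar ''y'') (ILoad ''E'' (IVar ''y'')))) s2
      (\<lambda>s'. cap_optimal (wt s) k u (Suc t) (imem s' ''A'') \<and>
        rmem s' ''v'' 0 = assign_cost (wt s) (Suc t) (imem s' ''A'') \<and> (\<forall>j<Suc k. imem s' ''G'' j = 0))"
    proof (rule timed_For[where N = "Suc t" and a = 1 and c = 1 and
        I = "\<lambda>i s'. \<forall>y<i. imem s' ''A'' y = imem s2 ''E'' y"], goal_cases)
      case (2 i s')
      then show ?case by (intro timed_loopfree) (auto simp: less_Suc_eq frame_def)
    next
      case (7 s')
      then show ?case using s2 by (simp add: frame_def)
    next
      case (9 s')
      have "cap_feasible k u (Suc t) (imem s' ''A'') = cap_feasible k u (Suc t) (imem s2 ''E'')"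
        "assign_cost w (Suc t) (imem s' ''A'') = assign_cost w (Suc t) (imem s2 ''E'')"
        using 9(1) by (auto intro!: cap_feasible_cong assign_cost_cong)
      moreover have "rmem s' ''v'' = rmem s2 ''v''" "imem s' ''G'' = imem s2 ''G''" using 9(2) by (auto simp: frame_def)
      ultimately show ?case using E2 le 1(1) by (auto simp: cap_optimal_def w_def)
    qed (use t(2) in \<open>auto simp: Z_def\<close>)
    then show ?case by (rule timed_conseq) (use k in auto)
  qed simp
qed simp

end

section \<open>The complete program\<close>

definition output_prog :: com where
  "output_prog = Cond (BAnd (ILess (IConst 0) (IVar ''H'')) (BNot (RLess (RVar ''v'') (RVar ''V''))))
     Skip
     (Seq (Seq (ISet ''H'' (IConst 1)) (RSet ''V'' (RVar ''v'')))
     (Seq (For ''y'' (IVar ''n'') (IStore ''pi'' (IVar ''y'') Ay))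
          (For ''i'' (IVar ''k'') (For ''l'' (IVar ''d'')
             (RStore ''C'' (IAdd (ILoad ''RD'' (IVar ''i'')) (IVar ''l''))
                (RLoad ''X'' (IAdd (ILoad ''RD'' (ILoad ''S'' (ILoad ''T'' (IVar ''i'')))) (IVar ''l''))))))))"

definition tuple_prog :: com where
  "tuple_prog = Seq (For ''t'' (IVar ''n'') insert_prog) output_prog"

definition main_prog :: com where
  "main_prog = Seq rows_prog (Seq matrix_prog (Seq size_prog (Seq greedy_prog
     (Enum ''T'' (IVar ''k'') (IVar ''m'') tuple_prog))))"

lemma writes_output [simp]: "iwrites output_prog = {''H'', ''y'', ''pi'', ''i'', ''l''}" "rwrites output_prog = {''V'', ''C''}"
  by (auto simp: output_prog_def)

lemma writes_tuple [simp]: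
  "iwrites tuple_prog = {''t'', ''i'', ''s'', ''c'', ''y'', ''o'', ''B'', ''h'', ''E'', ''A'', ''G'', ''j'', ''q'',
     ''H'', ''pi'', ''l''}"
  "rwrites tuple_prog = {''w'', ''v'', ''V'', ''C''}"
  by (auto simp: tuple_prog_def)

section \<open>Output and the outer enumeration over tuples of candidates\<close>

context hckm_instance
begin

lemma timed_copy_centres:
  assumes s: "mat s" and T: "\<And>j. j < k \<Longrightarrow> imem s ''S'' (imem s ''T'' j) < n"
  shows "timed 1 5 (For ''i'' (IVar ''k'') (For ''l'' (IVar ''d'')
             (RStore ''C'' (IAdd (ILoad ''RD'' (IVar ''i'')) (IVar ''l''))
                (RLoad ''X'' (IAdd (ILoad ''RD'' (ILoad ''S'' (ILoad ''T'' (IVar ''i'')))) (IVar ''l''))))))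
    s (\<lambda>s'. \<forall>j<k. \<forall>l<d. rmem s' ''C'' (j * d + l) = xs ! imem s ''S'' (imem s ''T'' j) $ l)"
proof (rule timed_For[where N = k and a = 3 and c = 1 and
    I = "\<lambda>i s'. \<forall>j<i. \<forall>l<d. rmem s' ''C'' (j * d + l) = xs ! imem s ''S'' (imem s ''T'' j) $ l"], goal_cases)
  case (2 i s')
  note inv = 2(4)
  have s': "mat s'" "imem s' ''S'' = imem s ''S''" "imem s' ''T'' = imem s ''T''"
    using mat_frame[OF s 2(2)] 2(2) by (auto simp: frame_def)
  show ?case
  proof (rule timed_For[where N = d and a = 1 and c = 1 and
      I = "\<lambda>r s'. (\<forall>j<i. \<forall>l<d. rmem s' ''C'' (j * d + l) = xs ! imem s ''S'' (imem s ''T'' j) $ l) \<and>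
        (\<forall>l<r. rmem s' ''C'' (i * d + l) = xs ! imem s ''S'' (imem s ''T'' i) $ l)"], goal_cases)
    case (2 r s2)
    have s2: "mat s2" "imem s2 ''S'' = imem s ''S''" "imem s2 ''T'' = imem s ''T''" "imem s2 ''i'' 0 = i"
      using mat_frame[OF s'(1) 2(2)] 2(2) s' \<open>imem s' ''i'' 0 = i\<close> by (auto simp: frame_def)
    let ?\<sigma> = "imem s ''S'' (imem s ''T'' i)"
    have \<sigma>: "?\<sigma> < n" using T \<open>i < k\<close> by blast
    have rd: "imem s2 ''RD'' i = i * d" "imem s2 ''RD'' ?\<sigma> = ?\<sigma> * d" "rmem s2 ''X'' (?\<sigma> * d + r) = xs ! ?\<sigma> $ r"
      using s2(1) \<sigma> \<open>i < k\<close> k 2(1) by (auto simp: mat_def rows_def inp_def)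
    have old: "j * d + l \<noteq> i * d + r" if "j < i" "l < d" for j l
      using index_eq_iff[of l d r j i] that 2(1) by auto
    show ?case
    proof (rule timed_loopfree, goal_cases)
      case 4
      show ?case using s2(2-4) 2(3,4) rd old by (auto simp: less_Suc_eq)
    qed auto
  next
    case (7 s2)
    have "mat s2" using mat_frame[OF s'(1) 7] by simp
    then show ?case by (simp add: mat_def rows_def inp_def)
  next
    case (9 s2)
    then show ?case by (auto simp: less_Suc_eq)
  qed (use inv Suc_d_le in auto)
next
  case (7 s')
  have "mat s'" using mat_frame[OF s 7] by simp
  then show ?case by (simp add: mat_def rows_def inp_def)
qed (use k in \<open>auto simp: Z_def\<close>)

text \<open>What the output arrays contain once \<open>H\<close> is set: input points as centres, an
  assignment within the capacities, and in \<open>V\<close> the cost of this pair.\<close>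

definition solution :: "state \<Rightarrow> bool" where
  "solution s \<longleftrightarrow> (\<exists>\<sigma>. (\<forall>j<k. \<sigma> j < n \<and> (\<forall>l<d. rmem s ''C'' (j * d + l) = xs ! \<sigma> j $ l)) \<and>
     cap_feasible k u n (imem s ''pi'') \<and> rmem s ''V'' 0 = (\<Sum>y<n. dst y (\<sigma> (imem s ''pi'' y))))"

lemma wt_dst:
  assumes "mat s" "y < n" "imem s ''S'' (imem s ''T'' i) < n"
  shows "wt s y i = dst y (imem s ''S'' (imem s ''T'' i))"
  using mat_D[OF assms] by (simp add: wt_def)

lemma timed_output:
  assumes s: "mat s" and T: "\<And>j. j < k \<Longrightarrow> imem s ''S'' (imem s ''T'' j) < n"
    and A: "cap_feasible k u n (imem s ''A'')" "rmem s ''v'' 0 = assign_cost (wt s) n (imem s ''A'')"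
    and H: "0 < imem s ''H'' 0 \<Longrightarrow> solution s"
  shows "timed 1 14 output_prog s (\<lambda>s'. 0 < imem s' ''H'' 0 \<and> solution s' \<and> rmem s' ''V'' 0 \<le> rmem s ''v'' 0 \<and>
    (0 < imem s ''H'' 0 \<longrightarrow> rmem s' ''V'' 0 \<le> rmem s ''V'' 0))"
  (is "timed _ _ _ _ ?Q")
  unfolding output_prog_def
proof (rule timed_Cond[where a = 1 and c = 11], goal_cases)
  case 2
  then have "?Q s" using H by auto
  then show ?case by (intro timed_loopfree) (auto simp only: exec.simps loopfree.simps steps.simps)
next
  case 3
  show ?case
  proof (rule timed_Seq[where R = "\<lambda>s'. imem s' ''H'' 0 = 1 \<and> rmem s' ''V'' 0 = rmem s ''v'' 0" and a = 1 and b = 9], goal_cases)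
    case 1
    show ?case by (rule timed_loopfree) auto
  next
    case (2 s1)
    have s1: "mat s1" "imem s1 ''A'' = imem s ''A''" "imem s1 ''S'' = imem s ''S''" "imem s1 ''T'' = imem s ''T''"
      using mat_frame[OF s 2(2)] 2(2) by (auto simp: frame_def)
    show ?case
    proof (rule timed_Seq[where R = "\<lambda>s'. \<forall>y<n. imem s' ''pi'' y = imem s ''A'' y" and a = 3 and b = 5], goal_cases)
      case 1
      show ?case
      proof (rule timed_For[where N = n and a = 1 and c = 1 and
          I = "\<lambda>i s'. \<forall>y<i. imem s' ''pi'' y = imem s ''A'' y"], goal_cases)
        case (2 i s')
        have "imem s' ''A'' = imem s ''A''" using 2(2) s1(2) by (simp add: frame_def)
        then show ?case using 2 by (intro timed_loopfree) (auto simp: less_Suc_eq)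
      next
        case (7 s')
        have "mat s'" using mat_frame[OF s1(1) 7] by simp
        then show ?case by (simp add: mat_n)
      qed (use Suc_n_le in auto)
    next
      case pi: (2 s2)
      have s2: "mat s2" "imem s2 ''S'' = imem s ''S''" "imem s2 ''T'' = imem s ''T''"
        "imem s2 ''H'' 0 = 1" "rmem s2 ''V'' 0 = rmem s ''v'' 0"
        using mat_frame[OF s1(1) pi(2)] pi(2) s1 2(1) by (auto simp: frame_def)
      have T2: "imem s2 ''S'' (imem s2 ''T'' j) < n" if "j < k" for j using T that s2 by simp
      show ?case
      proof (rule timed_conseq[OF timed_copy_centres[OF s2(1) T2]], goal_cases)
        case (4 s3)
        have s3: "imem s3 ''pi'' = imem s2 ''pi''" "imem s3 ''H'' 0 = 1" "rmem s3 ''V'' 0 = rmem s ''v'' 0"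
          using 4(2) s2 by (auto simp: frame_def)
        have piA: "\<And>y. y < n \<Longrightarrow> imem s3 ''pi'' y = imem s ''A'' y" using pi(1) s3(1) by simp
        have Ak: "\<And>y. y < n \<Longrightarrow> imem s ''A'' y < k" using A(1) by (simp add: cap_feasible_def)
        have "solution s3"
          unfolding solution_def
        proof (intro exI[of _ "\<lambda>j. imem s ''S'' (imem s ''T'' j)"] conjI)
          show "\<forall>j<k. imem s ''S'' (imem s ''T'' j) < n \<and>
              (\<forall>l<d. rmem s3 ''C'' (j * d + l) = xs ! imem s ''S'' (imem s ''T'' j) $ l)"
            using 4(1) T s2(2,3) by simp
          show "cap_feasible k u n (imem s3 ''pi'')"
            using A(1) cap_feasible_cong[of n "imem s3 ''pi''" "imem s ''A''" k u, OF piA] by blast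
          show "rmem s3 ''V'' 0 = (\<Sum>y<n. dst y (imem s ''S'' (imem s ''T'' (imem s3 ''pi'' y))))"
            unfolding s3(3) A(2) assign_cost_def
            by (intro sum.cong) (use piA Ak T in \<open>auto simp: wt_dst[OF s]\<close>)
        qed
        then show ?case using s3 3 by auto
      qed auto
    qed simp
  qed simp
qed auto

lemma timed_tuple:
  assumes s: "mat s" and T: "\<And>j. j < k \<Longrightarrow> imem s ''S'' (imem s ''T'' j) < n"
    and G: "\<forall>j<Suc k. imem s ''G'' j = 0" and u: "0 < u" "n \<le> k * u"
    and H: "0 < imem s ''H'' 0 \<Longrightarrow> solution s"
  shows "timed (k ^ Suc k) 52 tuple_prog s (\<lambda>s'. (\<forall>j<Suc k. imem s' ''G'' j = 0) \<and>
    0 < imem s' ''H'' 0 \<and> solution s' \<and>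
    (\<forall>A. cap_feasible k u n A \<longrightarrow> rmem s' ''V'' 0 \<le> (\<Sum>y<n. dst y (imem s ''S'' (imem s ''T'' (A y))))) \<and>
    (0 < imem s ''H'' 0 \<longrightarrow> rmem s' ''V'' 0 \<le> rmem s ''V'' 0))"
  unfolding tuple_prog_def
proof (rule timed_Seq[where R = "\<lambda>s'. cap_optimal (wt s) k u n (imem s' ''A'') \<and>
      rmem s' ''v'' 0 = assign_cost (wt s) n (imem s' ''A'') \<and> (\<forall>j<Suc k. imem s' ''G'' j = 0)"
      and a = 37 and b = 14], goal_cases)
  case 1
  show ?case
  \<comment> \<open>\<open>v\<close> gets its meaning from the first insertion, hence the condition
    \<open>0 < i\<close>; it is discharged at the end because \<open>n\<close> is positive.\<close>
  proof (rule timed_For[where N = n and a = 35 and c = 1 and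
      I = "\<lambda>i s'. cap_optimal (wt s) k u i (imem s' ''A'') \<and>
        (0 < i \<longrightarrow> rmem s' ''v'' 0 = assign_cost (wt s) i (imem s' ''A'')) \<and> (\<forall>j<Suc k. imem s' ''G'' j = 0)"], goal_cases)
    case 1
    then show ?case using G by (simp add: cap_optimal_def cap_feasible_def assign_cost_def)
  next
    case (2 i s')
    have s': "mat s'" "wt s' = wt s" using mat_frame[OF s 2(2)] wt_frame[OF 2(2)] by auto
    have "timed (k ^ Suc k) 35 insert_prog s' (\<lambda>s''. cap_optimal (wt s') k u (Suc i) (imem s'' ''A'') \<and>
        rmem s'' ''v'' 0 = assign_cost (wt s') (Suc i) (imem s'' ''A'') \<and> (\<forall>j<Suc k. imem s'' ''G'' j = 0))"
      using s' 2 u by (intro timed_insert) (auto simp: mat_def rows_def)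
    then show ?case by (rule timed_conseq) (auto simp: s'(2))
  next
    case (7 s')
    have "mat s'" using mat_frame[OF s 7] by simp
    then show ?case by (simp add: mat_n)
  next
    case (9 s')
    then show ?case using n_pos by simp
  qed (use k Suc_n_le in auto)
next
  case (2 s1)
  have s1: "mat s1" "wt s1 = wt s" "imem s1 ''S'' = imem s ''S''" "imem s1 ''T'' = imem s ''T''"
    "imem s1 ''H'' = imem s ''H''" "rmem s1 ''V'' = rmem s ''V''" "imem s1 ''pi'' = imem s ''pi''" "rmem s1 ''C'' = rmem s ''C''"
    using mat_frame[OF s 2(2)] wt_frame[OF 2(2)] 2(2) by (auto simp: frame_def)
  have sol: "solution s1" if "0 < imem s1 ''H'' 0" using H that s1 by (simp add: solution_def)
  have "timed 1 14 output_prog s1 (\<lambda>s'. 0 < imem s' ''H'' 0 \<and> solution s' \<and> rmem s' ''V'' 0 \<le> rmem s1 ''v'' 0 \<and>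
    (0 < imem s1 ''H'' 0 \<longrightarrow> rmem s' ''V'' 0 \<le> rmem s1 ''V'' 0))"
    using 2(1) s1 T sol by (intro timed_output) (auto simp: cap_optimal_def)
  then show ?case
  proof (rule timed_conseq, goal_cases)
    case (3 s')
    have "rmem s' ''V'' 0 \<le> (\<Sum>y<n. dst y (imem s ''S'' (imem s ''T'' (A y))))" if A: "cap_feasible k u n A" for A
    proof -
      have "rmem s' ''V'' 0 \<le> assign_cost (wt s) n (imem s1 ''A'')" using 3(1) 2(1) by simp
      also have "\<dots> \<le> assign_cost (wt s) n A" using 2(1) A by (simp add: cap_optimal_def)
      also have "\<dots> = (\<Sum>y<n. dst y (imem s ''S'' (imem s ''T'' (A y))))"
        unfolding assign_cost_def using A T by (intro sum.cong) (auto simp: wt_dst[OF s] cap_feasible_def)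
      finally show ?thesis .
    qed
    moreover have "imem s' ''G'' = imem s1 ''G''" using 3(2) by (simp add: frame_def)
    ultimately show ?case using 3(1) 2(1) s1 by auto
  qed (use k in auto)
qed simp

text \<open>Once \<open>H\<close> is set, \<open>V\<close> never increases, so the bound obtained
  for one tuple persists through all later ones.\<close>

lemma timed_enumeration:
  assumes s: "mat s" "imem s ''m'' 0 = m" "0 < m" and S: "\<And>j. j < m \<Longrightarrow> imem s ''S'' j < n"
    and G: "\<forall>j<Suc k. imem s ''G'' j = 0" and T: "\<forall>j<k. imem s ''T'' j = 0"
    and H: "imem s ''H'' 0 = 0" and u: "0 < u" "n \<le> k * u"
  shows "timed (m ^ k * k ^ Suc k) 60 (Enum ''T'' (IVar ''k'') (IVar ''m'') tuple_prog) s
    (\<lambda>s'. solution s' \<and> (\<forall>\<tau> A. (\<forall>i<k. \<tau> i < m) \<and> cap_feasible k u n A \<longrightarrow>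
      rmem s' ''V'' 0 \<le> (\<Sum>y<n. dst y (imem s ''S'' (\<tau> (A y))))))"
proof (rule timed_Enum[where e = 52 and I = "\<lambda>N s'. (\<forall>j<Suc k. imem s' ''G'' j = 0) \<and>
      (0 < N \<longrightarrow> 0 < imem s' ''H'' 0) \<and> (0 < imem s' ''H'' 0 \<longrightarrow> solution s') \<and>
      (\<forall>M<N. \<forall>A. cap_feasible k u n A \<longrightarrow> rmem s' ''V'' 0 \<le> (\<Sum>y<n. dst y (imem s ''S'' (digit m M (A y)))))"],
    goal_cases)
  case (9 s')
  have "mat s'" using mat_frame[OF s(1) 9] by simp
  then show ?case by (simp add: mat_def rows_def inp_def)
next
  case (10 s')
  then show ?case using s(2) by (simp add: frame_def)
next
  case 12
  then show ?case using G H by simp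
next
  case (13 N s')
  have s': "mat s'" "imem s' ''S'' = imem s ''S''"
    using mat_frame[OF s(1) 13(2)] 13(2) by (auto simp: frame_def)
  have T': "imem s' ''S'' (imem s' ''T'' j) < n" if "j < k" for j
    using 13(3) that S digit_less[OF s(3)] s'(2) by simp
  show ?case
  proof (rule timed_conseq[OF timed_tuple[OF s'(1) T' _ u]], goal_cases)
    case (6 s'')
    have eq: "(\<Sum>y<n. dst y (imem s' ''S'' (imem s' ''T'' (A y)))) = (\<Sum>y<n. dst y (imem s ''S'' (digit m N (A y))))"
      if "cap_feasible k u n A" for A
      using that 13(3) s'(2) by (intro sum.cong) (auto simp: cap_feasible_def)
    have "rmem s'' ''V'' 0 \<le> (\<Sum>y<n. dst y (imem s ''S'' (digit m M (A y))))"
      if "M < Suc N" "cap_feasible k u n A" for M A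
    proof (cases "M = N")
      case True
      have "rmem s'' ''V'' 0 \<le> (\<Sum>y<n. dst y (imem s' ''S'' (imem s' ''T'' (A y))))"
        using 6(1) that(2) by blast
      then show ?thesis using eq[OF that(2)] True by simp
    next
      case False
      then have M: "M < N" using that(1) by simp
      then have "0 < imem s' ''H'' 0" using 13(4) by auto
      then have "rmem s'' ''V'' 0 \<le> rmem s' ''V'' 0" using 6(1) by blast
      also have "\<dots> \<le> (\<Sum>y<n. dst y (imem s ''S'' (digit m M (A y))))" using 13(4) M that(2) by blast
      finally show ?thesis .
    qed
    then show ?case using 6(1) by blast
  qed (use 13(4) in auto)
next
  case (14 N s1 s2)
  then show ?case by (simp add: frame_def solution_def)
next
  case (16 s')
  have pos: "0 < m ^ k" using s(3) by simp
  have "rmem s' ''V'' 0 \<le> (\<Sum>y<n. dst y (imem s ''S'' (\<tau> (A y))))"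
    if \<tau>: "\<forall>i<k. \<tau> i < m" and A: "cap_feasible k u n A" for \<tau> A
  proof -
    obtain M where M: "M < m ^ k" "\<forall>j<k. digit m M j = \<tau> j" using digit_surj[OF \<tau>] by blast
    have "rmem s' ''V'' 0 \<le> (\<Sum>y<n. dst y (imem s ''S'' (digit m M (A y))))" using 16(1) M(1) A by blast
    also have "\<dots> = (\<Sum>y<n. dst y (imem s ''S'' (\<tau> (A y))))"
      using M(2) A by (intro sum.cong) (auto simp: cap_feasible_def)
    finally show ?thesis .
  qed
  then show ?case using 16(1) pos by blast
qed (use s(3) T k in \<open>auto simp: Z_def\<close>)

text \<open>\<open>L\<close> is found during the run, while the time bound has to be fixed
  beforehand; \<open>Lm\<close> bounds every value that \<open>L\<close> can take.\<close>

lemma timed_main: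
  assumes s: "inp s" and zero: "imem s ''RN'' 0 = 0" "imem s ''RD'' 0 = 0" "imem s ''S'' 0 = 0" "\<forall>j. imem s ''G'' j = 0"
      "\<forall>j. imem s ''T'' j = 0" "imem s ''H'' 0 = 0"
    and u: "0 < u" "n \<le> k * u"
    and Lm: "\<And>L. 2 ^ L \<le> 2 * n \<Longrightarrow> L \<le> Lm"
  shows "timed (Suc (k + 3 * (k * Lm)) ^ k * k ^ Suc k) 105 main_prog s (\<lambda>s'. solution s' \<and>
    (\<exists>L S. n \<le> 2 ^ L \<and> greedy n dst S (k + 3 * (k * L)) \<and>
      (\<forall>\<tau> A. (\<forall>i<k. \<tau> i < Suc (k + 3 * (k * L))) \<and> cap_feasible k u n A \<longrightarrow>
        rmem s' ''V'' 0 \<le> (\<Sum>y<n. dst y (S (\<tau> (A y)))))))"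
  (is "timed ?K _ _ _ ?Q")
proof -
  have K: "1 \<le> ?K" using k by (simp add: Suc_le_eq)
  have up: "timed ?K e p s' R" if "timed 1 e p s' R" for e p s' R
    using that by (rule timed_conseq) (use K in auto)
  show ?thesis
    unfolding main_prog_def
  proof (rule timed_Seq[where a = 3 and b = 101], rule up, rule timed_rows[OF s], goal_cases)
    case (3 s1)
    have z1: "imem s1 ''S'' 0 = 0" "\<forall>j. imem s1 ''G'' j = 0" "\<forall>j. imem s1 ''T'' j = 0" "imem s1 ''H'' 0 = 0"
      using 3(2) zero by (simp_all add: frame_def)
    show ?case
    proof (rule timed_Seq[where a = 11 and b = 89], rule up, rule timed_matrix[OF 3(1)], goal_cases)
      case (1 s2)
      have z2: "imem s2 ''S'' 0 = 0" "\<forall>j. imem s2 ''G'' j = 0" "\<forall>j. imem s2 ''T'' j = 0" "imem s2 ''H'' 0 = 0"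
      using 1(2) z1 by (simp_all add: frame_def)
      show ?case
      proof (rule timed_Seq[where a = 4 and b = 84], rule up, rule timed_size[OF 1(1)], goal_cases)
        case (1 s3)
        then obtain L where L: "n \<le> 2 ^ L" "2 ^ L \<le> 2 * n" "imem s3 ''m'' 0 = Suc (k + 3 * (k * L))" by blast
        have s3: "mat s3" using mat_frame[OF \<open>mat s2\<close> 1(2)] by simp
        have z3: "imem s3 ''S'' 0 = 0" "\<forall>j. imem s3 ''G'' j = 0" "\<forall>j. imem s3 ''T'' j = 0" "imem s3 ''H'' 0 = 0"
      using 1(2) z2 by (simp_all add: frame_def)
        \<comment> \<open>\<open>L < 2 ^ L \<le> 2 * n\<close> gives the crude bound
          \<open>8 * Z ^ 2\<close> on the number of candidates, and
          \<open>8 \<le> Z\<close>.\<close>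
        have mZ: "Suc (k + 3 * (k * L)) \<le> Z ^ 3"
        proof -
          have "L < 2 ^ L" by simp
          then have "L \<le> 2 * n" using L(2) by linarith
          then have "k * L \<le> Z * (2 * Z)" using k by (intro mult_le_mono) (auto simp: Z_def)
          moreover have "k \<le> Z * Z" "1 \<le> Z * Z"
            using k Z mult_le_mono[of k Z 1 Z] mult_le_mono[of 1 Z 1 Z] by (auto simp: Z_def)
          ultimately have "Suc (k + 3 * (k * L)) \<le> 8 * (Z * Z)" by linarith
          also have "\<dots> \<le> Z * (Z * Z)" using Z by (intro mult_le_mono1) simp
          finally show ?thesis by (simp add: power3_eq_cube)
        qed
        show ?case
        proof (rule timed_Seq[where a = 23 and b = 60], rule up, rule timed_greedy[OF s3 _ L(3) mZ], goal_cases)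
          case 1
          show ?case using z3 by simp
        next
          case (2 s4)
          have s4: "mat s4" "imem s4 ''m'' 0 = Suc (k + 3 * (k * L))"
            using mat_frame[OF s3 2(2)] 2(2) L(3) by (simp_all add: frame_def)
          have z4: "\<forall>j. imem s4 ''G'' j = 0" "\<forall>j. imem s4 ''T'' j = 0" "imem s4 ''H'' 0 = 0"
            using 2(2) z3 by (simp_all add: frame_def)
          have S: "imem s4 ''S'' j < n" if "j < Suc (k + 3 * (k * L))" for j
            using 2(1) that by (simp add: greedy_def)
          have "timed (Suc (k + 3 * (k * L)) ^ k * k ^ Suc k) 60 (Enum ''T'' (IVar ''k'') (IVar ''m'') tuple_prog) s4
              (\<lambda>s'. solution s' \<and> (\<forall>\<tau> A. (\<forall>i<k. \<tau> i < Suc (k + 3 * (k * L))) \<and> cap_feasible k u n A \<longrightarrow>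
                rmem s' ''V'' 0 \<le> (\<Sum>y<n. dst y (imem s4 ''S'' (\<tau> (A y))))))"
            using s4 S z4 u by (intro timed_enumeration) auto
          then show ?case
          proof (rule timed_conseq)
            show "Suc (k + 3 * (k * L)) ^ k * k ^ Suc k \<le> ?K"
              using Lm[OF L(2)] by (intro mult_le_mono1 power_mono) auto
          qed (use L(1) 2(1) in blast)+
        qed simp
      qed simp
    qed simp
  qed (use zero in auto)
qed

end

section \<open>Running time\<close>

text \<open>The \<open>k\<close>-th power of \<open>y / k \<le> exp (y / k)\<close>. With
  \<open>y\<close> a logarithm, it trades a \<open>k\<close>-th power of \<open>y\<close> for
  \<open>k ^ k\<close> and a power of \<open>n\<close>.\<close>

lemma power_le_self_power_exp:
  fixes y :: real
  assumes "0 \<le> y" "0 < k"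
  shows "y ^ k \<le> real k ^ k * exp y"
proof -
  have "y / real k \<le> exp (y / real k)" using exp_ge_add_one_self[of "y / real k"] by linarith
  then have "(y / real k) ^ k \<le> exp (y / real k) ^ k" using assms by (intro power_mono) auto
  also have "\<dots> = exp y" using assms(2) by (simp flip: exp_of_nat_mult)
  finally show ?thesis using assms(2) by (simp add: power_divide field_simps)
qed

text \<open>Here \<open>L\<close> is about \<open>log n\<close>; the point is that \<open>(log n) ^ k\<close> is at most \<open>k ^ k\<close> times a power of \<open>n\<close>.\<close>

lemma tuples_bound:
  assumes "0 < k" and L: "2 ^ L \<le> 2 * n"
  shows "real (Suc (k + 3 * (k * L)) ^ k) \<le> 48 * (real k ^ k) ^ 4 * real n ^ 2"
proof -
  have k1: "1 \<le> real k" using assms(1) by simp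
  have "Suc (k + 3 * (k * L)) \<le> 3 * k * Suc L" using assms(1) by simp
  then have "real (Suc (k + 3 * (k * L))) \<le> real (3 * k * Suc L)" by (simp only: of_nat_le_iff)
  also have "\<dots> = 3 * real k * (1 + real L)" by (simp add: algebra_simps)
  finally have "real (Suc (k + 3 * (k * L))) \<le> 3 * real k * (1 + real L)" .
  then have "real (Suc (k + 3 * (k * L)) ^ k) \<le> (3 * real k * (1 + real L)) ^ k"
    unfolding of_nat_power by (rule power_mono) simp
  also have "\<dots> = 3 ^ k * real k ^ k * (1 + real L) ^ k" by (simp add: power_mult_distrib)
  also have "\<dots> \<le> (3 * (real k ^ k) ^ 2) * real k ^ k * (real k ^ k * (16 * real n ^ 2))"
  proof (intro mult_mono)
    \<comment> \<open>The factor \<open>3 ^ k\<close> has to be hidden in powers of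
      \<open>k ^ k\<close>, which is 1 for \<open>k = 1\<close>; the constant 3 in front covers this
      case, and \<open>3 \<le> k ^ 2\<close> the others.\<close>
    show "3 ^ k \<le> 3 * (real k ^ k)\<^sup>2"
    proof (cases "k = 1")
      case False
      then have "2 \<le> real k" using assms(1) by simp
      then have "3 \<le> (real k)\<^sup>2" using power_mono[of 2 "real k" 2] by simp
      then have "3 ^ k \<le> ((real k)\<^sup>2) ^ k" by (intro power_mono) auto
      also have "\<dots> = (real k ^ k)\<^sup>2" by (simp add: power_mult[symmetric] mult.commute)
      finally show ?thesis using zero_le_power2[of "real k ^ k"] by linarith
    qed simp
    have "(1 + real L) ^ k \<le> real k ^ k * exp (1 + real L)"
      using assms(1) by (intro power_le_self_power_exp) auto
    \<comment> \<open>\<open>exp 1\<close> is rounded up to 4, so that its powers are squares of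
      powers of 2, which the hypothesis on \<open>L\<close> controls.\<close>
    also have "exp (1 + real L) \<le> 16 * real n ^ 2"
    proof -
      have "exp (1 + real L) = exp 1 ^ Suc L" by (simp add: exp_add flip: exp_of_nat_mult)
      also have "\<dots> \<le> 4 ^ Suc L" using exp_le by (intro power_mono) auto
      also have "\<dots> = 4 * (2 ^ L)\<^sup>2" by (simp add: power2_eq_square flip: power_mult_distrib)
      also have "\<dots> \<le> 4 * (2 * real n)\<^sup>2"
      proof -
        have "real (2 ^ L) \<le> real (2 * n)" using L by (simp only: of_nat_le_iff)
        then show ?thesis by (intro mult_left_mono power_mono) auto
      qed
      finally show ?thesis by (simp add: power_mult_distrib)
    qed
    finally show "(1 + real L) ^ k \<le> real k ^ k * (16 * real n ^ 2)" by (simp add: mult_left_mono)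
  qed (use k1 in auto)
  also have "\<dots> = 48 * (real k ^ k) ^ 4 * real n ^ 2"
    by (simp add: power2_eq_square power4_eq_xxxx)
  finally show ?thesis .
qed

text \<open>Four factors \<open>k ^ k\<close> come from the tuples and one from the maps; the spare
  \<open>k\<close> of \<open>k ^ Suc k\<close> is bounded by \<open>n\<close>. The exponent of
  \<open>d + 1\<close> is raised to that of \<open>n\<close>.\<close>

lemma total_time_bound:
  assumes k: "0 < k" "k \<le> n" and L: "2 ^ L \<le> 2 * n"
    and t: "t \<le> (Suc (k + 3 * (k * L)) ^ k * k ^ Suc k) * (n + d + 100) ^ 105"
  shows "real t \<le> (48 * 101 ^ 105) * 2 powr (5 * (real k * log 2 (real k))) * real n ^ 108 * real (d + 1) ^ 108"
proof -
  define q where "q = real k ^ k"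
  have n1: "1 \<le> real n" and k1: "1 \<le> real k" using k by auto
  have q: "2 powr (5 * (real k * log 2 (real k))) = q ^ 5"
  proof -
    have "2 powr (5 * (real k * log 2 (real k))) = (2 powr log 2 (real k)) powr (real k * 5)"
      by (simp add: powr_powr mult_ac)
    also have "\<dots> = real k powr (real k * 5)" using k by simp
    also have "\<dots> = q ^ 5" using k by (simp add: q_def powr_powr[symmetric] powr_realpow)
    finally show ?thesis .
  qed
  have q0: "0 \<le> q" by (simp add: q_def)
  \<comment> \<open>A product instead of a sum, so that powers of \<open>n\<close> and of
    \<open>d + 1\<close> separate; \<open>d + 1\<close> rather than \<open>d\<close> because the
    dimension may be 0.\<close>
  have Z: "real (n + d + 100) \<le> 101 * real n * real (d + 1)"
  proof -
    have "real d \<le> real n * real d" using n1 mult_right_mono[of 1 "real n" "real d"] by simp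
    then show ?thesis using n1 by (simp add: algebra_simps)
  qed
  have "real t \<le> real ((Suc (k + 3 * (k * L)) ^ k * k ^ Suc k) * (n + d + 100) ^ 105)"
    using t by (simp only: of_nat_le_iff)
  also have "\<dots> = real (Suc (k + 3 * (k * L)) ^ k) * (real k * q) * real (n + d + 100) ^ 105"
    by (simp add: q_def)
  also have "\<dots> \<le> (48 * q ^ 4 * real n ^ 2) * (real n * q) * (101 * real n * real (d + 1)) ^ 105"
    using tuples_bound[OF k(1) L] k q0 Z unfolding q_def[symmetric]
    by (intro mult_mono power_mono) auto
  also have "\<dots> = (48 * 101 ^ 105) * (q ^ 4 * q) * (real n ^ 2 * real n * real n ^ 105) * real (d + 1) ^ 105"
    by (simp only: power_mult_distrib mult_ac)
  also have "real n ^ 2 * real n * real n ^ 105 = real n ^ (2 + 1 + 105)"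
    by (simp only: power_add power_one_right)
  also have "q ^ 4 * q = q ^ (4 + 1)" by (simp only: power_add power_one_right)
  also have "48 * 101 ^ 105 * q ^ (4 + 1) * real n ^ (2 + 1 + 105) * real (d + 1) ^ 105
      \<le> 48 * 101 ^ 105 * q ^ (4 + 1) * real n ^ (2 + 1 + 105) * real (d + 1) ^ 108"
    using q0 by (intro mult_left_mono power_increasing mult_nonneg_nonneg zero_le_power) auto
  finally show ?thesis unfolding q by simp
qed

section \<open>From list positions to sets of points, and the final bound\<close>

lemma sum_nth: "distinct xs \<Longrightarrow> (\<Sum>x\<in>set xs. f x) = (\<Sum>i<length xs. f (xs ! i))"
  by (rule sum.reindex_bij_betw[symmetric, OF bij_betw_nth]) auto

lemma card_nth:
  assumes "distinct xs"
  shows "card {x \<in> set xs. P x} = card {i. i < length xs \<and> P (xs ! i)}"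
proof -
  have "bij_betw ((!) xs) {i. i < length xs \<and> P (xs ! i)} {x \<in> set xs. P x}"
    using assms by (auto simp: bij_betw_def inj_on_def nth_eq_iff_index_eq in_set_conv_nth image_iff)
  then show ?thesis by (simp add: bij_betw_same_card)
qed

lemma main_prog_correct:
  assumes carr_xs: "set xs \<subseteq> carrier_vec d" and dist: "distinct xs" and k: "0 < k" "k \<le> length xs"
    and u: "0 < u" "length xs \<le> k * u"
  shows "\<exists>t s c \<pi>. runs main_prog (hckm_input d xs k u) t s \<and> hckm_output d xs k s c \<pi> \<and>
    hckm_feasible d (set xs) k u c \<pi> \<and> hckm_cost (set xs) c \<pi> \<le> 66 * hckm_opt d (set xs) k u \<and>
    real t \<le> (48 * 101 ^ 105) * 2 powr (5 * (real k * log 2 (real k))) * real (length xs) ^ 108 * real (d + 1) ^ 108"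
proof -
  let ?n = "length xs"
  let ?Z = "?n + d + 100"
  let ?s = "hckm_input d xs k u"
  interpret hckm_instance ?Z d k u xs
    using carr_xs k by unfold_locales auto
  have inp: "inp ?s"
  proof -
    have "y * d + l < ?n * d" if "y < ?n" "l < d" for y l
    proof -
      have "y * d + l < Suc y * d" using that by simp
      also have "\<dots> \<le> ?n * d" using that by (intro mult_le_mono1) simp
      finally show ?thesis .
    qed
    then show ?thesis by (auto simp: inp_def hckm_input_def)
  qed
  obtain Lm where Lm: "2 ^ Lm \<le> 2 * ?n" "2 * ?n < 2 ^ (Lm + 1)"
    using ex_power_ivl1[of 2 "2 * ?n"] k by auto
  have Lmax: "L \<le> Lm" if "2 ^ L \<le> 2 * ?n" for L
  proof -
    have "(2::nat) ^ L < 2 ^ (Lm + 1)" using that Lm(2) by linarith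
    then have "L < Lm + 1" by (rule power_less_imp_less_exp[rotated]) simp
    then show ?thesis by simp
  qed
  have "timed (Suc (k + 3 * (k * Lm)) ^ k * k ^ Suc k) 105 main_prog ?s (\<lambda>s'. solution s' \<and>
    (\<exists>L S. ?n \<le> 2 ^ L \<and> greedy ?n dst S (k + 3 * (k * L)) \<and>
      (\<forall>\<tau> A. (\<forall>i<k. \<tau> i < Suc (k + 3 * (k * L))) \<and> cap_feasible k u ?n A \<longrightarrow>
        rmem s' ''V'' 0 \<le> (\<Sum>y<?n. dst y (S (\<tau> (A y)))))))"
    by (rule timed_main[OF inp _ _ _ _ _ _ u Lmax]) (simp_all add: hckm_input_def)
  then obtain t s L S where run: "runs main_prog ?s t s"
    and t: "t \<le> (Suc (k + 3 * (k * Lm)) ^ k * k ^ Suc k) * ?Z ^ 105"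
    and sol: "solution s" and L: "?n \<le> 2 ^ L" and greedy: "greedy ?n dst S (k + 3 * (k * L))"
    and best: "\<And>\<tau> A. (\<And>i. i < k \<Longrightarrow> \<tau> i < Suc (k + 3 * (k * L))) \<Longrightarrow> cap_feasible k u ?n A \<Longrightarrow>
        rmem s ''V'' 0 \<le> (\<Sum>y<?n. dst y (S (\<tau> (A y))))"
    unfolding timed_def ok_def by blast
  from sol obtain \<sigma> where \<sigma>: "\<And>j. j < k \<Longrightarrow> \<sigma> j < ?n" "\<And>j l. j < k \<Longrightarrow> l < d \<Longrightarrow> rmem s ''C'' (j * d + l) = xs ! \<sigma> j $ l"
    and feas: "cap_feasible k u ?n (imem s ''pi'')"
    and V: "rmem s ''V'' 0 = (\<Sum>y<?n. dst y (\<sigma> (imem s ''pi'' y)))"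
    unfolding solution_def by blast
  have carr: "xs ! i \<in> carrier_vec d" if "i < ?n" for i using carr_xs that nth_mem by blast

  define c where "c j = vec d (\<lambda>l. rmem s ''C'' (j * d + l))" for j
  \<comment> \<open>The memory indexes points by their position in \<open>xs\<close>; distinctness
    makes this invertible.\<close>
  define \<pi> where "\<pi> x = imem s ''pi'' (inv_into {..<?n} ((!) xs) x)" for x
  have inj: "inj_on ((!) xs) {..<?n}" using dist by (auto simp: inj_on_def nth_eq_iff_index_eq)
  have \<pi>: "\<pi> (xs ! i) = imem s ''pi'' i" if "i < ?n" for i
    using inv_into_f_f[OF inj, of i] that by (simp add: \<pi>_def)
  have c: "c j = xs ! \<sigma> j" if "j < k" for j
    using \<sigma> that carr[OF \<sigma>(1)[OF that]] by (intro eq_vecI) (auto simp: c_def)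
  have out: "hckm_output d xs k s c \<pi>" using \<pi> by (simp add: hckm_output_def c_def)
  have pik: "imem s ''pi'' i < k" if "i < ?n" for i using feas that by (simp add: cap_feasible_def)
  have fe: "hckm_feasible d (set xs) k u c \<pi>"
    unfolding hckm_feasible_def
  proof (intro conjI allI impI ballI)
    fix i assume "i < k"
    then have "card {y. y < ?n \<and> imem s ''pi'' y = i} \<le> u" using feas by (simp add: cap_feasible_def)
    also have "{y. y < ?n \<and> imem s ''pi'' y = i} = {y. y < ?n \<and> \<pi> (xs ! y) = i}" using \<pi> by auto
    finally show "card {x \<in> set xs. \<pi> x = i} \<le> u" using card_nth[OF dist] by simp
  next
    fix x assume "x \<in> set xs"
    then show "\<pi> x < k" using \<pi> pik by (auto simp: in_set_conv_nth)
  qed (simp add: c_def)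
  have cost: "hckm_cost (set xs) c \<pi> = rmem s ''V'' 0"
    unfolding hckm_cost_def V sum_nth[OF dist]
    using \<pi> pik c by (intro sum.cong) (auto simp: dst_def vdist_def)

  obtain c' \<pi>' where opt: "hckm_feasible d (set xs) k u c' \<pi>'" "hckm_cost (set xs) c' \<pi>' = hckm_opt d (set xs) k u"
    using hckm_opt_attained[of "set xs" d u k] carr_xs dist u by (auto simp: distinct_card)
  \<comment> \<open>The greedy analysis is applied to an optimal capacitated solution, so that
    \<open>total\<close> becomes the optimum.\<close>
  interpret C: clustering d "(!) xs" ?n k c' "\<lambda>i. \<pi>' (xs ! i)"
    using opt(1) carr k by unfold_locales (auto simp: hckm_feasible_def)
  have D: "C.D = dst" by (simp add: fun_eq_iff C.D_def dst_def)
  have total: "C.total = hckm_opt d (set xs) k u"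
    unfolding opt(2)[symmetric] hckm_cost_def C.total_def sum_nth[OF dist] by (simp add: vdist_def)
  have gr: "greedy ?n C.D S (k + 3 * (k * L))" using greedy by (simp add: D)
  obtain \<tau> where \<tau>: "\<And>i. i < k \<Longrightarrow> \<tau> i < Suc (k + 3 * (k * L))"
    "(\<Sum>x<?n. C.D x (S (\<tau> (\<pi>' (xs ! x))))) \<le> 12 * C.total + 3 / 2 * C.f S (k + 3 * (k * L))"
    using C.candidate_tuple[OF gr] by blast
  \<comment> \<open>Replacing the centres by candidates keeps the optimal assignment feasible, so it
    competes with the output for the tuple \<tau>.\<close>
  have "cap_feasible k u ?n (\<lambda>i. \<pi>' (xs ! i))"
    using opt(1) card_nth[OF dist, of "\<lambda>x. \<pi>' x = i" for i] by (auto simp: cap_feasible_def hckm_feasible_def)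
  then have "rmem s ''V'' 0 \<le> (\<Sum>y<?n. dst y (S (\<tau> (\<pi>' (xs ! y)))))" using best[of \<tau>, OF \<tau>(1)] by blast
  also have "\<dots> \<le> 12 * C.total + 3 / 2 * C.f S (k + 3 * (k * L))" using \<tau>(2) by (simp add: D)
  also have "\<dots> \<le> 66 * C.total" using C.greedy_final[OF gr refl L] by simp
  finally have "hckm_cost (set xs) c \<pi> \<le> 66 * hckm_opt d (set xs) k u" by (simp add: cost total)
  moreover have "real t \<le> (48 * 101 ^ 105) * 2 powr (5 * (real k * log 2 (real k))) * real ?n ^ 108 * real (d + 1) ^ 108"
    by (rule total_time_bound[OF k Lm(1) t])
  ultimately show ?thesis using run out fe by blast
qed

theorem theorem1:
  fixes \<epsilon> :: real
  assumes "\<epsilon> > 0"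
  shows "\<exists>(p :: com) (A :: real) (b :: real) (e :: nat).
    \<forall>(d :: nat) (X :: real vec set) (n :: nat) (k :: nat) (u :: nat) (xs :: real vec list).
      X \<subseteq> carrier_vec d \<and> finite X \<and> card X = n \<and>
      0 < k \<and> k \<le> n \<and> 0 < u \<and> n \<le> k * u \<and>
      distinct xs \<and> set xs = X \<longrightarrow>
      (\<exists>t s c \<pi>.
        runs p (hckm_input d xs k u) t s \<and>
        hckm_output d xs k s c \<pi> \<and>
        hckm_feasible d X k u c \<pi> \<and>
        hckm_cost X c \<pi> \<le> (69 + \<epsilon>) * hckm_opt d X k u \<and>
        real t \<le> A * 2 powr (b * (real k * log 2 (real k))) * real n ^ e * real (d + 1) ^ e)"
proof (rule exI[of _ main_prog], rule exI[of _ "48 * 101 ^ 105"], rule exI[of _ 5], rule exI[of _ 108],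
    intro allI impI, elim conjE)
  fix d :: nat and X :: "real vec set" and n k u :: nat and xs :: "real vec list"
  assume X: "X \<subseteq> carrier_vec d" "finite X" "card X = n" and k: "0 < k" "k \<le> n" and u: "0 < u" "n \<le> k * u"
    and xs: "distinct xs" "set xs = X"
  have n: "n = length xs" using X xs by (auto simp: distinct_card)
  obtain t s c \<pi> where R: "runs main_prog (hckm_input d xs k u) t s" "hckm_output d xs k s c \<pi>"
    "hckm_feasible d X k u c \<pi>" "hckm_cost X c \<pi> \<le> 66 * hckm_opt d X k u"
    "real t \<le> (48 * 101 ^ 105) * 2 powr (5 * (real k * log 2 (real k))) * real n ^ 108 * real (d + 1) ^ 108"
    using main_prog_correct[of xs d k u] X k u xs unfolding n by auto
  \<comment> \<open>Nonnegativity of the optimum allows the factor 66 to be replaced by a larger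
    one.\<close>
  have "0 \<le> hckm_opt d X k u"
  proof -
    obtain c' \<pi>' where "hckm_cost X c' \<pi>' = hckm_opt d X k u"
      using hckm_opt_attained[OF X(2,1) u(1)] u(2) X(3) by blast
    moreover have "0 \<le> hckm_cost X c' \<pi>'" unfolding hckm_cost_def by (intro sum_nonneg) simp
    ultimately show ?thesis by simp
  qed
  then have "66 * hckm_opt d X k u \<le> (69 + \<epsilon>) * hckm_opt d X k u"
    using assms by (intro mult_right_mono) auto
  then show "\<exists>t s c \<pi>.
        runs main_prog (hckm_input d xs k u) t s \<and>
        hckm_output d xs k s c \<pi> \<and>
        hckm_feasible d X k u c \<pi> \<and>
        hckm_cost X c \<pi> \<le> (69 + \<epsilon>) * hckm_opt d X k u \<and>
        real t \<le> (48 * 101 ^ 105) * 2 powr (5 * (real k * log 2 (real k))) * real n ^ 108 * real (d + 1) ^ 108"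
    using R by (intro exI[of _ t] exI[of _ s] exI[of _ c] exI[of _ \<pi>]) auto
qed

end
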